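(* Let $n\ge1$ be an integer, $s\in(1/2,1)$, $a\in\mathbb{R}$ and $q_0\in\mathbb{R}^n$. Let $V\in C^1(\mathbb{R}^n,\mathbb{R})$ satisfy $V(0)=0$ and $V(q)<V(0)$ for all $q\in\mathbb{R}^n\setminus\{0\}$. Assume moreover that, for some $R>0$ which is sufficiently large (namely such that every component of $q_0$ satisfies $|q_{0,i}|\le R$), one has $V(q_1,\dots,q_n)\le V(T_R(q_1),\dots,T_R(q_n))$ for all $q=(q_1,\dots,q_n)\in\mathbb{R}^n\setminus(-R,R)^n$. Then there exists a solution $q$ of $$\begin{cases}(-\Delta)^s q=\nabla V(q)&\text{in }\mathbb{R}\setminus\{a\},\\ q(a)=q_0,\end{cases}$$ such that $q\in C^{s-\frac12}(\mathbb{R},\mathbb{R}^n)$ and $\|q\|_{C^{s-\frac12}(\mathbb{R},\mathbb{R}^n)}\le C$ for a positive constant $C$ depending only on $n,s,V$ and $q_0$. Moreover, $I(q)<+\infty$, $I(q)\le I(\widetilde q)$ for any $\widetilde q\in\Gamma$, and $\lim_{x\to\pm\infty}q(x)=0$. Also, if $V\in C^{1+\gamma}(\mathbb{R}^n,\mathbb{R})$ for some $\gamma\in(\max\{0,1-2s\},1)$, then $\lim_{x\to\pm\infty}\dot q(x)=0$. Furthermore, $q$ is symmetric with respect to $a$, namely $q(a-x)=q(a+x)$ for all $x\in\mathbb{R}$.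
   Context: Truncation: $T_R(r)=r$ if $|r|<R$, $T_R(r)=R$ if $r\ge R$, $T_R(r)=-R$ if $r\le -R$. Fractional Laplacian: $(-\Delta)^s u(x)=2c_s\int_{\mathbb{R}}\frac{u(x)-u(y)}{|x-y|^{1+2s}}\,dy$ (principal value), acting componentwise, with $c_s>0$ the usual normalizing constant (so that the Fourier symbol is $|2\pi\xi|^{2s}$). Gagliardo seminorm: $[q]_s=\big(c_s\iint_{\mathbb{R}^2}\frac{|q(x)-q(y)|^2}{|x-y|^{1+2s}}\,dx\,dy\big)^{1/2}$. $\mathcal{D}^{s,2}(\mathbb{R},\mathbb{R}^n)$ is the space of measurable $q:\mathbb{R}\to\mathbb{R}^n$ with $[q]_s<+\infty$ (for $s>1/2$ such functions have continuous representatives, so point values make sense). $\Gamma:=\{q\in\mathcal{D}^{s,2}(\mathbb{R},\mathbb{R}^n): q(a)=q_0\}$ and $I(q):=\frac12[q]_s^2-\int_{\mathbb{R}}V(q(x))\,dx$ for $q\in\Gamma$ (possibly $+\infty$). Solution means weak solution: $q\in\mathcal{D}^{s,2}(\mathbb{R},\mathbb{R}^n)$, $q(a)=q_0$, and for every $i\in\{1,\dots,n\}$ and every $\varphi\in C_0^\infty(\mathbb{R}\setminus\{a\})$, $$c_s\iint_{\mathbb{R}^2}\frac{(q_i(x)-q_i(y))(\varphi(x)-\varphi(y))}{|x-y|^{1+2s}}\,dx\,dy=\int_{\mathbb{R}}\partial_iV(q(x))\,\varphi(x)\,dx.$$ $V\in C^{1+\gamma}$ means $C^1$ with $\gamma$-Hölder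 continuous gradient. *)

theory Defs
  imports "HOL-Analysis.Analysis"
begin

definition grad :: "('a::real_inner \<Rightarrow> real) \<Rightarrow> 'a \<Rightarrow> 'a" where
  "grad V x = (THE D. GDERIV V x :> D)"

definition C1 :: "('a::real_inner \<Rightarrow> real) \<Rightarrow> bool" where
  "C1 V \<longleftrightarrow> (\<forall>x. \<exists>D. GDERIV V x :> D) \<and> continuous_on UNIV (grad V)"

definition C1_hoelder :: "real \<Rightarrow> ('a::real_inner \<Rightarrow> real) \<Rightarrow> bool" where
  "C1_hoelder \<gamma> V \<longleftrightarrow>
     C1 V \<and> (\<exists>L. \<forall>x y. norm (grad V x - grad V y) \<le> L * norm (x - y) powr \<gamma>)"

definition trunc :: "real \<Rightarrow> real \<Rightarrow> real" where
  "trunc R r = (if \<bar>r\<bar> < R then r else if r \<ge> R then R else - R)"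

text \<open>
  With the convention \<open>(-\<Delta>)\<^sup>s u(x) = 2 c\<^sub>s PV\<integral> (u(x) - u(y)) / |x - y|^(1+2s) dy\<close>, the Fourier symbol is
  \<open>2 c\<^sub>s \<integral> (1 - cos(2\<pi>\<xi>y)) / |y|^(1+2s) dy\<close>. The constant below is the one for which this equals
  \<open>|2\<pi>\<xi>|^(2s)\<close>; see \<open>c_s_symbol\<close>.
\<close>
definition c_s :: "real \<Rightarrow> real" where
  "c_s s = 1 / (2 * (LINT t|lebesgue. (1 - cos t) / \<bar>t\<bar> powr (1 + 2 * s)))"

text \<open>The square \<open>[q]\<^sub>s\<^sup>2\<close> of the Gagliardo seminorm, with values in \<open>[0,\<infinity>]\<close>.\<close>
definition gagliardo_sq :: "real \<Rightarrow> (real \<Rightarrow> 'a::euclidean_space) \<Rightarrow> ennreal" where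
  "gagliardo_sq s q = ennreal (c_s s) *
     (\<integral>\<^sup>+ (x, y). ennreal ((norm (q x - q y))\<^sup>2 / \<bar>x - y\<bar> powr (1 + 2 * s))
        \<partial>(lebesgue :: (real \<times> real) measure))"

definition Ds2 :: "real \<Rightarrow> (real \<Rightarrow> 'a::euclidean_space) set" where
  "Ds2 s = {q. q \<in> borel_measurable lebesgue \<and> gagliardo_sq s q < \<infinity>}"

text \<open>Elements of \<^term>\<open>Ds2 s\<close> are only meaningful up to null sets; the value at a point is that of
  the (unique) continuous representative.\<close>
definition has_point_value :: "(real \<Rightarrow> 'a::euclidean_space) \<Rightarrow> real \<Rightarrow> 'a \<Rightarrow> bool" where
  "has_point_value q a v \<longleftrightarrow>
     (\<exists>r. continuous_on UNIV r \<and> (AE x in lebesgue. q x = r x) \<and> r a = v)"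

definition Gam :: "real \<Rightarrow> real \<Rightarrow> 'a::euclidean_space \<Rightarrow> (real \<Rightarrow> 'a) set" where
  "Gam s a q\<^sub>0 = {q \<in> Ds2 s. has_point_value q a q\<^sub>0}"

definition ext_integral :: "(real \<Rightarrow> real) \<Rightarrow> ereal" where
  "ext_integral f = enn2ereal (\<integral>\<^sup>+ x. ennreal (f x) \<partial>lebesgue)
                  - enn2ereal (\<integral>\<^sup>+ x. ennreal (- f x) \<partial>lebesgue)"

definition energy :: "real \<Rightarrow> ('a::euclidean_space \<Rightarrow> real) \<Rightarrow> (real \<Rightarrow> 'a) \<Rightarrow> ereal" where
  "energy s V q = enn2ereal (gagliardo_sq s q) / 2 - ext_integral (\<lambda>x. V (q x))"

definition test_fun :: "real set \<Rightarrow> (real \<Rightarrow> real) \<Rightarrow> bool" where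
  "test_fun U \<phi> \<longleftrightarrow>
     (\<forall>k x. ((deriv ^^ k) \<phi>) field_differentiable (at x)) \<and>
     compact (closure {x. \<phi> x \<noteq> 0}) \<and> closure {x. \<phi> x \<noteq> 0} \<subseteq> U"

text \<open>Both integrands are absolutely integrable: on the left by the Cauchy-Schwarz inequality, as
  \<open>q\<^sub>i\<close> and \<open>\<phi>\<close> have finite Gagliardo seminorm; on the right since \<open>q\<close> is a.e. equal to a
  continuous function.\<close>
definition weak_solution ::
    "real \<Rightarrow> (real ^ 'n \<Rightarrow> real) \<Rightarrow> real \<Rightarrow> real ^ 'n \<Rightarrow> (real \<Rightarrow> real ^ 'n) \<Rightarrow> bool" where
  "weak_solution s V a q\<^sub>0 q \<longleftrightarrow>
     q \<in> Ds2 s \<and> has_point_value q a q\<^sub>0 \<and>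
     (\<forall>i \<phi>. test_fun (UNIV - {a}) \<phi> \<longrightarrow>
        c_s s * integral\<^sup>L (lebesgue :: (real \<times> real) measure)
                  (\<lambda>(x, y). (q x $ i - q y $ i) * (\<phi> x - \<phi> y) / \<bar>x - y\<bar> powr (1 + 2 * s))
        = (LINT x|lebesgue. grad V (q x) $ i * \<phi> x))"

definition Hoelder :: "real \<Rightarrow> (real \<Rightarrow> 'a::real_normed_vector) set" where
  "Hoelder \<alpha> =
     {q. bounded (range q) \<and> (\<exists>L. \<forall>x y. norm (q x - q y) \<le> L * \<bar>x - y\<bar> powr \<alpha>)}"

text \<open>The suprema are those of bounded sets only for \<^term>\<open>q \<in> Hoelder \<alpha>\<close>.\<close>
definition Hoelder_norm :: "real \<Rightarrow> (real \<Rightarrow> 'a::real_normed_vector) \<Rightarrow> real" where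
  "Hoelder_norm \<alpha> q = (SUP x. norm (q x)) +
     (SUP (x, y) \<in> {(x, y). x \<noteq> y}. norm (q x - q y) / \<bar>x - y\<bar> powr \<alpha>)"

lemma grad_eqI:
  assumes "GDERIV V x :> D"
  shows "grad V x = D"
  unfolding grad_def
proof (rule the_equality)
  fix E assume "GDERIV V x :> E"
  with assms have "(\<lambda>h. inner h D) = (\<lambda>h. inner h E)"
    unfolding gderiv_def by (rule has_derivative_unique)
  then show "E = D"
    by (metis vector_eq_ldot)
qed (rule assms)

lemma c_s_integrable:
  assumes "0 < s" "s < 1"
  shows "integrable lborel (\<lambda>t::real. (1 - cos t) / \<bar>t\<bar> powr (1 + 2 * s))"
proof -
  let ?f = "\<lambda>t::real. (1 - cos t) / \<bar>t\<bar> powr (1 + 2 * s)"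
  have f0: "?f t \<ge> 0" for t by simp
  have near: "set_integrable lborel {0..1} ?f"
  proof -
    have "(\<lambda>x. x powr (1 - 2 * s)) integrable_on {0..1::real}"
      using assms by (intro integrable_on_powr_from_0) auto
    then have "set_integrable lebesgue {0..1} (\<lambda>x::real. x powr (1 - 2 * s))"
      by (intro nonnegative_absolutely_integrable_1) auto
    then have *: "set_integrable lborel {0..1} (\<lambda>x::real. x powr (1 - 2 * s))"
      unfolding set_integrable_def by (subst (asm) integrable_completion) auto
    show ?thesis
    proof (rule set_integrable_bound[OF *])
      show "set_borel_measurable lborel {0..1} ?f"
        unfolding set_borel_measurable_def by measurable
      show "AE x in lborel. x \<in> {0..1} \<longrightarrow> norm (?f x) \<le> norm (x powr (1 - 2 * s))"
      proof (intro AE_I2 impI)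
        fix x :: real assume x: "x \<in> {0..1}"
        show "norm (?f x) \<le> norm (x powr (1 - 2 * s))"
        proof (cases "x = 0")
          case False
          with x have x0: "x > 0" by auto
          have "1 - cos x = 2 * (sin (x / 2))\<^sup>2"
            using cos_double_sin[of "x / 2"] by simp
          also have "\<dots> \<le> 2 * (x / 2)\<^sup>2"
            using abs_sin_x_le_abs_x[of "x / 2"] unfolding abs_le_square_iff
            by (rule mult_left_mono) simp
          also have "\<dots> \<le> x\<^sup>2" by (simp add: power2_eq_square)
          finally have "?f x \<le> x\<^sup>2 / x powr (1 + 2 * s)"
            using x0 by (auto intro!: divide_right_mono)
          also have "\<dots> = x powr (2 - (1 + 2 * s))"
            using x0 powr_diff[of x 2 "1 + 2 * s"] by (simp only: powr_numeral)
          finally show ?thesis using f0[of x] by simp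
        qed simp
      qed
    qed
  qed
  have far: "set_integrable lborel {1..} ?f"
  proof -
    have "(\<lambda>x. x powr (- 1 - 2 * s)) integrable_on {1::real..}"
      using has_integral_powr_to_inf[of "- 1 - 2 * s" "1::real"] assms by (auto simp: integrable_on_def)
    then have "set_integrable lebesgue {1..} (\<lambda>x::real. x powr (- 1 - 2 * s))"
      by (intro nonnegative_absolutely_integrable_1) auto
    then have "set_integrable lborel {1..} (\<lambda>x::real. x powr (- 1 - 2 * s))"
      unfolding set_integrable_def by (subst (asm) integrable_completion) auto
    then have *: "set_integrable lborel {1..} (\<lambda>x::real. 2 * x powr (- 1 - 2 * s))"
      by (rule set_integrable_mult_right)
    show ?thesis
    proof (rule set_integrable_bound[OF *])
      show "set_borel_measurable lborel {1..} ?f"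
        unfolding set_borel_measurable_def by measurable
      show "AE x in lborel. x \<in> {1..} \<longrightarrow> norm (?f x) \<le> norm (2 * x powr (- 1 - 2 * s))"
      proof (intro AE_I2 impI)
        fix x :: real assume x: "x \<in> {1..}"
        have "?f x \<le> 2 / x powr (1 + 2 * s)"
          using x cos_ge_minus_one[of x] by (auto intro!: divide_right_mono)
        also have "\<dots> = 2 * x powr (- (1 + 2 * s))"
          unfolding powr_minus_divide by simp
        finally show "norm (?f x) \<le> norm (2 * x powr (- 1 - 2 * s))"
          using f0[of x] by simp
      qed
    qed
  qed
  have "set_integrable lborel ({0..1} \<union> {1..}) ?f"
    by (rule set_integrable_Un[OF near far]) auto
  also have "{0..1} \<union> {1..} = {0::real..}" by auto
  finally have pos: "integrable lborel (\<lambda>t. indicator {0..} t * ?f t)"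
    by (simp add: set_integrable_def)
  have neg: "integrable lborel (\<lambda>t. indicator {0..} (- t) * ?f t)"
    using lborel_integrable_real_affine[OF pos, of "-1" 0] by simp
  show ?thesis
  proof (rule Bochner_Integration.integrable_bound[OF Bochner_Integration.integrable_add[OF pos neg]])
    show "AE t in lborel. norm (?f t) \<le> norm (indicator {0..} t * ?f t + indicator {0..} (- t) * ?f t)"
      by (intro AE_I2) (auto simp: indicator_def)
  qed measurable
qed

lemma c_s_pos:
  assumes "0 < s" "s < 1"
  shows "c_s s > 0"
proof -
  let ?f = "\<lambda>t::real. (1 - cos t) / \<bar>t\<bar> powr (1 + 2 * s)"
  have eq: "integral\<^sup>L lebesgue ?f = integral\<^sup>L lborel ?f"
    by (rule integral_completion) measurable
  have "integral\<^sup>L lborel ?f \<noteq> 0"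
  proof
    assume "integral\<^sup>L lborel ?f = 0"
    then have "AE t in lborel. ?f t = 0"
      using integral_nonneg_eq_0_iff_AE[OF c_s_integrable[OF assms]] by simp
    then have "AE t in lborel. t \<notin> {1<..<2::real}"
    proof eventually_elim
      case (elim t)
      show ?case
      proof
        assume t: "t \<in> {1<..<2}"
        with elim have "cos t = 1" by simp
        moreover have "cos t < cos 0"
          using t pi_gt3 by (intro cos_monotone_0_pi) auto
        ultimately show False by simp
      qed
    qed
    then have "emeasure lborel {1<..<2::real} = 0"
      by (subst (asm) AE_iff_measurable[where N = "{1<..<2}"]) auto
    then show False by simp
  qed
  moreover have "integral\<^sup>L lborel ?f \<ge> 0"
    by (rule Bochner_Integration.integral_nonneg) simp
  ultimately have "integral\<^sup>L lborel ?f > 0" by linarith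
  then show ?thesis unfolding c_s_def eq by simp
qed

lemma c_s_symbol:
  assumes "0 < s" "s < 1"
  shows "2 * c_s s * (LINT y|lebesgue. (1 - cos (2 * pi * \<xi> * y)) / \<bar>y\<bar> powr (1 + 2 * s))
         = \<bar>2 * pi * \<xi>\<bar> powr (2 * s)"
proof (cases "\<xi> = 0")
  case False
  define b where "b = 2 * pi * \<xi>"
  have b: "b \<noteq> 0" using False by (simp add: b_def)
  let ?f = "\<lambda>t::real. (1 - cos t) / \<bar>t\<bar> powr (1 + 2 * s)"
  have "(LINT y|lborel. ?f y) = \<bar>b\<bar> * (LINT y|lborel. ?f (b * y))"
    using lborel_integral_real_affine[OF b, of ?f 0] by simp
  also have "(\<lambda>y. ?f (b * y)) = (\<lambda>y. \<bar>b\<bar> powr - (1 + 2 * s) * ((1 - cos (b * y)) / \<bar>y\<bar> powr (1 + 2 * s)))"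
    unfolding abs_mult powr_mult powr_minus_divide by (simp add: mult_ac)
  also have "\<bar>b\<bar> * (LINT y|lborel. \<bar>b\<bar> powr - (1 + 2 * s) * ((1 - cos (b * y)) / \<bar>y\<bar> powr (1 + 2 * s)))
      = \<bar>b\<bar> powr (- (2 * s)) * (LINT y|lborel. (1 - cos (b * y)) / \<bar>y\<bar> powr (1 + 2 * s))"
    unfolding integral_mult_right_zero using b powr_add[of "\<bar>b\<bar>" 1 "- (1 + 2 * s)"] by simp
  finally have "(LINT y|lborel. (1 - cos (b * y)) / \<bar>y\<bar> powr (1 + 2 * s))
      = \<bar>b\<bar> powr (2 * s) * (LINT y|lborel. ?f y)"
    using b by (simp add: powr_minus field_simps)
  moreover have "(LINT y|lebesgue. (1 - cos (b * y)) / \<bar>y\<bar> powr (1 + 2 * s))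
      = (LINT y|lborel. (1 - cos (b * y)) / \<bar>y\<bar> powr (1 + 2 * s))"
    by (rule integral_completion) measurable
  moreover have "(LINT y|lebesgue. ?f y) = (LINT y|lborel. ?f y)"
    by (rule integral_completion) measurable
  moreover have "(LINT y|lebesgue. ?f y) \<noteq> 0"
    using c_s_pos[OF assms] by (auto simp: c_s_def)
  ultimately show ?thesis unfolding b_def[symmetric] by (simp add: c_s_def)
qed simp

end

theory Submission
  imports Defs "HOL-Probability.Distributions" "HOL-Probability.Sinc_Integral" "HOL-Complex_Analysis.Great_Picard"
begin

text \<open>
  Existence is the direct method: truncation bounds a minimizing sequence, the Gagliardo seminorm makes it
  equicontinuous (Campanato's argument with means over shrinking intervals), and Fatou's lemma passes to the
  limit. If the two halves of a minimizer are reflected at \<open>a\<close>, the energies of the two symmetric functions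
  so obtained have at most the energy of the minimizer as their mean, because the kernel \<open>(x + y)\<^sup>-\<^sup>1\<^sup>-\<^sup>2\<^sup>s\<close> is
  positive definite on the half line; hence both are minimizers.

  For the derivative, write \<open>(-\<Delta>)\<^sup>s q = \<nabla>V(q) + \<mu> \<delta>\<^sub>a\<close> and test with derivatives of heat kernels. As
  \<open>|h|\<^sup>-\<^sup>1\<^sup>-\<^sup>2\<^sup>s\<close> is a superposition of heat kernels, this is an equation for the Marchaud derivative of order \<open>s\<close>,
  in the time variable, of the space derivative of the heat extension of \<open>q\<close>. Inverting that derivative
  recovers \<open>q'\<close> from \<open>\<nabla>V(q)\<close> by integrable kernels, since \<open>2 s > 1\<close>.
\<close>

section \<open>Gagliardo seminorms\<close>

text \<open>The heat extension of \<open>q\<close> solves \<open>u_t = u_xx / 2\<close>, so the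
  power \<open>s\<close> of the negative Laplacian in space acts on it as the power \<open>s\<close>
  of \<open>- 2 d/dt\<close>. This one-variable operator has an explicit inverse, which takes the
  place of a regularity theory for the nonlocal equation. Two obstacles shape the inversion. The
  gradient term is only known to be bounded, so the right-hand side is merely of order
  \<open>\<tau> powr (- 1 / 2)\<close>, and its product with \<open>\<tau> powr (s - 1)\<close> is
  not integrable at infinity. Hence the inversion is cut off at \<tau> = 1; the price is an integral
  over times above 1 of the time derivative of the extended derivative, which is of order
  \<open>\<sigma> powr (- 3 / 2)\<close>. The second obstacle is the point mass of unknown size at
  \<open>a\<close>: it contributes a derivative of the heat kernel, bounded uniformly in time at a
  positive distance from \<open>a\<close>. All integrands then have dominating functions that
  survive both regularization time 0 and escape to infinity in space, so existence of the derivative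
  and its decay are both matters of dominated convergence.\<close>

lemma set_integrable_powr_Icc01:
  assumes "p > (-1::real)"
  shows "set_integrable lborel {0..1} (\<lambda>x::real. x powr p)"
proof -
  have "(\<lambda>x. x powr p) integrable_on {0..1::real}"
    using assms by (intro integrable_on_powr_from_0) auto
  then have "set_integrable lebesgue {0..1} (\<lambda>x::real. x powr p)"
    by (intro nonnegative_absolutely_integrable_1) auto
  then show ?thesis
    unfolding set_integrable_def by (subst (asm) integrable_completion) auto
qed

lemma set_integrable_powr_Ici1:
  assumes "p < (-1::real)"
  shows "set_integrable lborel {1..} (\<lambda>x::real. x powr p)"
proof -
  have "(\<lambda>x. x powr p) integrable_on {1::real..}"
    using has_integral_powr_to_inf[of p "1::real"] assms by (auto simp: integrable_on_def)
  then have "set_integrable lebesgue {1..} (\<lambda>x::real. x powr p)"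
    by (intro nonnegative_absolutely_integrable_1) auto
  then show ?thesis
    unfolding set_integrable_def by (subst (asm) integrable_completion) auto
qed

text \<open>\<open>min 1 (h\<^sup>2)\<close> is what bounds the squared increments of a bounded
  Lipschitz function. The comparison function is \<open>h powr (1 - 2 * s)\<close> near 0,
  integrable as \<open>s < 1\<close>, and \<open>h powr (- 1 - 2 * s)\<close> far out, integrable as
  \<open>s > 0\<close>.\<close>

lemma integrable_min_square_powr:
  fixes s :: real
  assumes "0 < s" "s < 1"
  shows "integrable lborel (\<lambda>h::real. min 1 (h\<^sup>2) / \<bar>h\<bar> powr (1 + 2 * s))"
proof -
  let ?f = "\<lambda>h::real. min 1 (h\<^sup>2) / \<bar>h\<bar> powr (1 + 2 * s)"
  define F where "F h = indicator {0..1} h * h powr (1 - 2 * s) + indicator {1..} h * h powr (- 1 - 2 * s)" for h :: real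
  have F: "integrable lborel F"
    unfolding F_def
    using set_integrable_powr_Icc01[of "1 - 2 * s"] set_integrable_powr_Ici1[of "-1 - 2 * s"] assms
    by (intro Bochner_Integration.integrable_add) (auto simp: set_integrable_def)
  have F': "integrable lborel (\<lambda>h. F (- h))"
    using lborel_integrable_real_affine[OF F, of "-1" 0] by simp
  have F0: "F h \<ge> 0" for h by (simp add: F_def)
  have le: "?f h \<le> F h" if "h > 0" for h
  proof (cases "h \<le> 1")
    case True
    have "?f h \<le> h\<^sup>2 / h powr (1 + 2 * s)" using that by (auto intro!: divide_right_mono)
    also have "\<dots> = h powr (2 - (1 + 2 * s))"
      using that powr_diff[of h 2 "1 + 2 * s"] by (simp only: powr_numeral)
    also have "\<dots> \<le> F h" using True that by (simp add: F_def)
    finally show ?thesis .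
  next
    case False
    have "?f h \<le> 1 / h powr (1 + 2 * s)" using that by (auto intro!: divide_right_mono)
    also have "\<dots> = h powr (-1 - 2 * s)"
      using powr_minus_divide[of h "1 + 2 * s"] by simp
    also have "\<dots> \<le> F h" using False that by (simp add: F_def)
    finally show ?thesis .
  qed
  have "\<bar>?f h\<bar> \<le> F h + F (- h)" for h
  proof -
    consider "h > 0" | "h = 0" | "h < 0" by linarith
    then show ?thesis
    proof cases
      case 1 then show ?thesis using le[OF 1] F0[of "-h"] by simp
    next
      case 2 then show ?thesis using F0 by simp
    next
      case 3 then show ?thesis using le[of "-h"] F0[of h] by simp
    qed
  qed
  then show ?thesis
    by (intro Bochner_Integration.integrable_bound[OF Bochner_Integration.integrable_add[OF F F']]) (auto intro!: AE_I2 simp: F0)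
qed

lemma integrable_inverse_one_plus_square: "integrable lborel (\<lambda>x::real. 1 / (1 + x\<^sup>2))"
  using integrable_inverse_1_plus_square
  by (simp add: set_integrable_def einterval_def inverse_eq_divide)

text \<open>Scalar, without the factor \<open>c_s\<close>, and over the Borel product measure
  instead of the completed one, so that Tonelli's theorem applies directly;
  \<open>gagliardo_sq_eq_gag\<close> translates for continuous functions.\<close>

definition gag :: "real \<Rightarrow> (real \<Rightarrow> real) \<Rightarrow> ennreal" where
  "gag s u = (\<integral>\<^sup>+ z. ennreal ((u (fst z) - u (snd z))\<^sup>2 / \<bar>fst z - snd z\<bar> powr (1 + 2 * s)) \<partial>(lborel \<Otimes>\<^sub>M lborel))"

lemma gag_iterated:
  assumes [measurable]: "u \<in> borel_measurable borel"
  shows "gag s u = (\<integral>\<^sup>+ x. \<integral>\<^sup>+ y. ennreal ((u x - u y)\<^sup>2 / \<bar>x - y\<bar> powr (1 + 2 * s)) \<partial>lborel \<partial>lborel)"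
  unfolding gag_def by (subst lborel.nn_integral_fst[symmetric]) auto

lemma norm_vec_power2: "(norm (x :: real ^ 'n))\<^sup>2 = (\<Sum>i\<in>UNIV. (x $ i)\<^sup>2)"
  by (simp add: norm_vec_def L2_set_def sum_nonneg)

lemma gagliardo_sq_eq_gag:
  fixes q :: "real \<Rightarrow> real ^ 'n"
  assumes q: "continuous_on UNIV q"
  shows "gagliardo_sq s q = ennreal (c_s s) * (\<Sum>i\<in>UNIV. gag s (\<lambda>x. q x $ i))"
proof -
  have [measurable]: "(\<lambda>x. q x $ i) \<in> borel_measurable borel" for i
    using q by (intro borel_measurable_continuous_onI continuous_intros)
  have "(\<integral>\<^sup>+ (x, y). ennreal ((norm (q x - q y))\<^sup>2 / \<bar>x - y\<bar> powr (1 + 2 * s)) \<partial>(lebesgue :: (real \<times> real) measure))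
     = (\<integral>\<^sup>+ z. (\<Sum>i\<in>UNIV. ennreal ((q (fst z) $ i - q (snd z) $ i)\<^sup>2 / \<bar>fst z - snd z\<bar> powr (1 + 2 * s))) \<partial>(lborel \<Otimes>\<^sub>M lborel))"
    unfolding nn_integral_completion lborel_prod
    by (intro nn_integral_cong)
      (auto simp: norm_vec_power2 sum_divide_distrib sum_ennreal)
  also have "\<dots> = (\<Sum>i\<in>UNIV. gag s (\<lambda>x. q x $ i))"
    unfolding gag_def by (intro nn_integral_sum) measurable
  finally show ?thesis by (simp add: gagliardo_sq_def)
qed

text \<open>The factor 18 is 9 = 3 * 3, the cost of moving the squared weight by a distance at most
  1, times 2 for the two symmetric halves of the bound in \<open>gag_le_of_decay\<close>.\<close>

definition gag_const :: "real \<Rightarrow> real" where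
  "gag_const s = 18 * (LBINT x. 1 / (1 + x\<^sup>2)) * (LBINT h. min 1 (h\<^sup>2) / \<bar>h\<bar> powr (1 + 2 * s))"

text \<open>Increments at distance below 1 are estimated by the mean value theorem, the others by
  the two values; both leave a weight centred at \<open>b\<close> times an integrable kernel in
  \<open>x - y\<close>. The bound is free of \<open>b\<close>, which later makes the energy bound
  uniform in the position of the constraint.\<close>

lemma gag_le_of_decay:
  fixes \<phi> :: "real \<Rightarrow> real"
  assumes s: "0 < s" "s < 1"
    and der: "\<And>x. (\<phi> has_real_derivative \<phi>' x) (at x)"
    and b0: "\<And>x. \<bar>\<phi> x\<bar> \<le> A / (1 + (x - b)\<^sup>2)"
    and b1: "\<And>x. \<bar>\<phi>' x\<bar> \<le> A / (1 + (x - b)\<^sup>2)"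
  shows "gag s \<phi> \<le> ennreal (A\<^sup>2 * gag_const s)"
proof -
  define w where "w x = 1 / (1 + x\<^sup>2)" for x :: real
  define m where "m h = min 1 (h\<^sup>2) / \<bar>h\<bar> powr (1 + 2 * s)" for h :: real
  have cont: "continuous_on UNIV \<phi>"
    using der by (meson DERIV_isCont continuous_at_imp_continuous_on)
  then have [measurable]: "\<phi> \<in> borel_measurable borel" by (rule borel_measurable_continuous_onI)
  have [measurable]: "w \<in> borel_measurable borel" "m \<in> borel_measurable borel"
    by (auto simp: w_def m_def [abs_def] w_def [abs_def])
  have w0: "w x > 0" for x by (auto simp: w_def add_pos_nonneg)
  have w1: "w x \<le> 1" for x by (simp add: w_def divide_le_eq add_pos_nonneg)
  have m0: "m h \<ge> 0" for h by (auto simp: m_def)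
  have A0: "A \<ge> 0" using b0[of b] by simp
  \<comment> \<open>The weight is at most 1, so its square is absorbed into itself.\<close>
  have sq: "c\<^sup>2 \<le> A\<^sup>2 * w (x - b)" if "\<bar>c\<bar> \<le> A * w (x - b)" for c x
  proof -
    have "c\<^sup>2 \<le> (A * w (x - b))\<^sup>2" using that by (metis abs_ge_zero power2_abs power_mono)
    also have "\<dots> = A\<^sup>2 * (w (x - b) * w (x - b))" by (simp add: power2_eq_square)
    also have "\<dots> \<le> A\<^sup>2 * (w (x - b) * 1)" using w0[of "x - b"] w1[of "x - b"] by (intro mult_left_mono) auto
    finally show ?thesis by simp
  qed
  have main: "(\<phi> x - \<phi> y)\<^sup>2 \<le> min 1 ((x - y)\<^sup>2) * (9 * A\<^sup>2 * (w (x - b) + w (y - b)))" for x y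
  proof (cases "\<bar>x - y\<bar> < 1")
    case True
    obtain z where z: "\<bar>z - x\<bar> \<le> \<bar>x - y\<bar>" "\<phi> x - \<phi> y = (x - y) * \<phi>' z"
    proof -
      consider "x < y" | "x = y" | "y < x" by linarith
      then show thesis
      proof cases
        case 1
        from MVT2[OF this, of \<phi> \<phi>'] der obtain z where "z > x" "z < y" "\<phi> y - \<phi> x = (y - x) * \<phi>' z" by blast
        then show thesis by (intro that[of z]) (auto simp: algebra_simps)
      next
        case 2 then show thesis by (intro that[of x]) auto
      next
        case 3
        from MVT2[OF this, of \<phi> \<phi>'] der obtain z where "z > y" "z < x" "\<phi> x - \<phi> y = (x - y) * \<phi>' z" by blast
        then show thesis by (intro that[of z]) (auto simp: algebra_simps)
      qed
    qed
    have zx: "(x - z)\<^sup>2 \<le> 1" using z(1) True by (simp add: abs_square_le_1 abs_minus_commute)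
    \<comment> \<open>This square equals
      \<open>2 * (z - b)\<^sup>2 + 2 * (x - z)\<^sup>2 - (x - b)\<^sup>2\<close>. As
      \<open>z\<close> is within distance 1 of \<open>x\<close>, the weight at \<open>z\<close> is
      at most 3 times the weight at \<open>x\<close>.\<close>
    have "0 \<le> (x - b - 2 * (z - b))\<^sup>2" by simp
    then have "(x - b)\<^sup>2 \<le> 2 * (z - b)\<^sup>2 + 2 * (x - z)\<^sup>2" by (simp add: power2_eq_square algebra_simps)
    then have "1 + (x - b)\<^sup>2 \<le> 3 * (1 + (z - b)\<^sup>2)" using zx zero_le_power2[of "z - b"] unfolding distrib_left by linarith
    then have "w (z - b) \<le> 3 * w (x - b)"
      by (simp add: w_def field_simps add_pos_nonneg)
    moreover have "\<bar>\<phi>' z\<bar> \<le> A * w (z - b)" using b1[of z] by (simp add: w_def)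
    ultimately have "\<bar>\<phi>' z\<bar> \<le> A * (3 * w (x - b))"
      using A0 by (meson mult_left_mono order_trans)
    then have "\<bar>\<phi>' z / 3\<bar> \<le> A * w (x - b)" by simp
    from sq[OF this] have "(\<phi>' z)\<^sup>2 \<le> 9 * A\<^sup>2 * w (x - b)" by (simp add: power_divide)
    also have "\<dots> \<le> 9 * A\<^sup>2 * (w (x - b) + w (y - b))" using w0[of "y - b"] by (intro mult_left_mono) auto
    finally have "(x - y)\<^sup>2 * (\<phi>' z)\<^sup>2 \<le> (x - y)\<^sup>2 * (9 * A\<^sup>2 * (w (x - b) + w (y - b)))" by (intro mult_left_mono) auto
    moreover have "(x - y)\<^sup>2 < 1" using True by (simp add: abs_square_less_1)
    then have "min 1 ((x - y)\<^sup>2) = (x - y)\<^sup>2" by simp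
    ultimately show ?thesis unfolding z(2) power_mult_distrib by simp
  next
    case False
    have "0 \<le> (\<phi> x + \<phi> y)\<^sup>2" by simp
    then have "(\<phi> x - \<phi> y)\<^sup>2 \<le> 2 * (\<phi> x)\<^sup>2 + 2 * (\<phi> y)\<^sup>2" by (simp add: power2_eq_square algebra_simps)
    also have "\<dots> \<le> 2 * (A\<^sup>2 * w (x - b)) + 2 * (A\<^sup>2 * w (y - b))"
      using sq[of "\<phi> x" x] sq[of "\<phi> y" y] b0[of x] b0[of y] by (intro add_mono mult_left_mono) (auto simp: w_def)
    also have "\<dots> \<le> 9 * A\<^sup>2 * (w (x - b) + w (y - b))"
      using w0[of "x - b"] w0[of "y - b"] mult_nonneg_nonneg[of "A\<^sup>2" "w (x - b)"] mult_nonneg_nonneg[of "A\<^sup>2" "w (y - b)"]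
      by (simp add: algebra_simps)
    finally show ?thesis using False abs_le_square_iff[of 1 "x - y"] by (simp add: min_def)
  qed
  have iw: "(\<integral>\<^sup>+ x. ennreal (w (x - b)) \<partial>lborel) = ennreal (LBINT x. w x)"
  proof -
    have "(\<integral>\<^sup>+ x. ennreal (w (x - b)) \<partial>lborel) = (\<integral>\<^sup>+ x. ennreal (w x) \<partial>lborel)"
      using nn_integral_real_affine[of "\<lambda>x. ennreal (w (x - b))" 1 b] by simp
    also have "\<dots> = ennreal (LBINT x. w x)"
      using integrable_inverse_one_plus_square w0 by (intro nn_integral_eq_integral) (auto simp: w_def less_imp_le)
    finally show ?thesis .
  qed
  have im: "(\<integral>\<^sup>+ y. ennreal (m (x - y)) \<partial>lborel) = ennreal (LBINT x. m x)" for x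
  proof -
    have "(\<integral>\<^sup>+ y. ennreal (m (x - y)) \<partial>lborel) = (\<integral>\<^sup>+ y. ennreal (m y) \<partial>lborel)"
      using nn_integral_real_affine[of "\<lambda>y. ennreal (m (x - y))" "-1" x] by simp
    also have "\<dots> = ennreal (LBINT x. m x)"
      using integrable_min_square_powr[OF s] m0 by (intro nn_integral_eq_integral) (auto simp: m_def)
    finally show ?thesis .
  qed
  define W where "W = (LBINT x. w x)"
  define M where "M = (LBINT x. m x)"
  have WM: "W \<ge> 0" "M \<ge> 0" using w0 m0 by (auto simp: W_def M_def less_imp_le intro!: Bochner_Integration.integral_nonneg)
  have one: "(\<integral>\<^sup>+ x. \<integral>\<^sup>+ y. ennreal (w (x - b)) * ennreal (m (x - y)) \<partial>lborel \<partial>lborel) = ennreal W * ennreal M"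
    by (simp add: nn_integral_cmult nn_integral_multc im iw W_def M_def)
  have two: "(\<integral>\<^sup>+ x. \<integral>\<^sup>+ y. ennreal (w (y - b)) * ennreal (m (x - y)) \<partial>lborel \<partial>lborel) = ennreal W * ennreal M"
  proof -
    have "(\<integral>\<^sup>+ x. \<integral>\<^sup>+ y. ennreal (w (y - b)) * ennreal (m (x - y)) \<partial>lborel \<partial>lborel)
       = (\<integral>\<^sup>+ y. \<integral>\<^sup>+ x. ennreal (w (y - b)) * ennreal (m (x - y)) \<partial>lborel \<partial>lborel)"
      by (rule lborel_pair.Fubini') measurable
    also have "\<dots> = (\<integral>\<^sup>+ y. \<integral>\<^sup>+ x. ennreal (w (y - b)) * ennreal (m (y - x)) \<partial>lborel \<partial>lborel)"
      by (simp add: m_def power2_commute abs_minus_commute)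
    finally show ?thesis using one by simp
  qed
  have "gag s \<phi> \<le> (\<integral>\<^sup>+ x. \<integral>\<^sup>+ y. ennreal (9 * A\<^sup>2) * (ennreal (w (x - b)) * ennreal (m (x - y)) + ennreal (w (y - b)) * ennreal (m (x - y))) \<partial>lborel \<partial>lborel)"
    unfolding gag_iterated[OF \<open>\<phi> \<in> borel_measurable borel\<close>]
  proof (intro nn_integral_mono)
    fix x y :: real
    have "(\<phi> x - \<phi> y)\<^sup>2 / \<bar>x - y\<bar> powr (1 + 2 * s) \<le> min 1 ((x - y)\<^sup>2) * (9 * A\<^sup>2 * (w (x - b) + w (y - b))) / \<bar>x - y\<bar> powr (1 + 2 * s)"
      using main[of x y] by (intro divide_right_mono) auto
    also have "\<dots> = 9 * A\<^sup>2 * (w (x - b) * m (x - y) + w (y - b) * m (x - y))"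
      by (simp add: m_def algebra_simps add_divide_distrib)
    finally show "ennreal ((\<phi> x - \<phi> y)\<^sup>2 / \<bar>x - y\<bar> powr (1 + 2 * s)) \<le> ennreal (9 * A\<^sup>2) * (ennreal (w (x - b)) * ennreal (m (x - y)) + ennreal (w (y - b)) * ennreal (m (x - y)))"
      using w0 m0 by (auto simp: ennreal_mult[symmetric] ennreal_plus[symmetric] less_imp_le simp del: ennreal_plus intro!: ennreal_leI)
  qed
  also have "\<dots> = ennreal (9 * A\<^sup>2) * (ennreal W * ennreal M + ennreal W * ennreal M)"
    using one two by (simp add: nn_integral_cmult nn_integral_add)
  also have "\<dots> = ennreal (A\<^sup>2 * gag_const s)"
    using WM by (simp add: gag_const_def W_def[symmetric] M_def[symmetric] ennreal_mult[symmetric] ennreal_plus[symmetric] w_def[symmetric] m_def[symmetric] del: ennreal_plus)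
  finally show ?thesis .
qed

section \<open>Hoelder continuity from the seminorm\<close>

text \<open>Jensen's inequality, from integrating \<open>(h t - c)\<^sup>2 \<ge> 0\<close> with
  \<open>c\<close> the mean of \<open>h\<close>.\<close>

lemma square_integral_unit_interval_le:
  fixes h :: "real \<Rightarrow> real"
  assumes h: "continuous_on UNIV h"
  shows "ennreal ((LBINT t:{0..1}. h t)\<^sup>2) \<le> (\<integral>\<^sup>+ t. ennreal ((h t)\<^sup>2) * indicator {0..1} t \<partial>lborel)"
proof -
  define c where "c = (LBINT t:{0..1}. h t)"
  have i1: "set_integrable lborel {0..1} h"
    using h by (intro borel_integrable_atLeastAtMost') (auto intro: continuous_on_subset)
  have i2: "set_integrable lborel {0..1} (\<lambda>t. (h t)\<^sup>2)"
    using h by (intro borel_integrable_atLeastAtMost' continuous_intros) (auto intro: continuous_on_subset)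
  have i3: "set_integrable lborel {0..1} (\<lambda>t. c\<^sup>2 - 2 * c * h t)"
    using h by (intro borel_integrable_atLeastAtMost' continuous_intros) (auto intro: continuous_on_subset)
  have i4: "set_integrable lborel {0..1} (\<lambda>t::real. c\<^sup>2)"
    by (intro borel_integrable_atLeastAtMost' continuous_intros)
  have "0 \<le> (LBINT t:{0..1}. (h t)\<^sup>2 + (c\<^sup>2 - 2 * c * h t))"
  proof -
    have "(h t)\<^sup>2 + (c\<^sup>2 - 2 * c * h t) = (h t - c)\<^sup>2" for t by (simp add: power2_eq_square algebra_simps)
    then show ?thesis by (auto simp: set_lebesgue_integral_def intro!: Bochner_Integration.integral_nonneg)
  qed
  also have "\<dots> = (LBINT t:{0..1}. (h t)\<^sup>2) + ((LBINT t:{0..1::real}. c\<^sup>2) - (LBINT t:{0..1}. 2 * c * h t))"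
    using i1 by (subst set_integral_add(2)[OF i2 i3], subst set_integral_diff(2)[OF i4]) auto
  also have "\<dots> = (LBINT t:{0..1}. (h t)\<^sup>2) - c\<^sup>2"
    by (simp add: c_def[symmetric] power2_eq_square) (simp add: set_lebesgue_integral_def)
  finally have "c\<^sup>2 \<le> (LBINT t:{0..1}. (h t)\<^sup>2)" by simp
  moreover have "ennreal (LBINT t:{0..1}. (h t)\<^sup>2) = (\<integral>\<^sup>+ t. ennreal ((h t)\<^sup>2) * indicator {0..1} t \<partial>lborel)"
  proof -
    have "ennreal (LBINT t:{0..1}. (h t)\<^sup>2) = (\<integral>\<^sup>+ t. ennreal (indicator {0..1} t * (h t)\<^sup>2) \<partial>lborel)"
      using i2 by (simp add: set_lebesgue_integral_def set_integrable_def) (subst nn_integral_eq_integral, auto)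
    also have "\<dots> = (\<integral>\<^sup>+ t. ennreal ((h t)\<^sup>2) * indicator {0..1} t \<partial>lborel)"
      by (intro nn_integral_cong) (auto simp: indicator_def)
    finally show ?thesis .
  qed
  ultimately show ?thesis unfolding c_def[symmetric] by (metis ennreal_leI)
qed

text \<open>The mean over the segment from \<alpha> to \<alpha> + \<rho>. The sign of \<rho> is
  free, so one formula serves segments on either side of a point.\<close>

definition segment_mean :: "(real \<Rightarrow> real) \<Rightarrow> real \<Rightarrow> real \<Rightarrow> real" where
  "segment_mean u \<alpha> \<rho> = (LBINT t:{0..1}. u (\<alpha> + \<rho> * t))"

lemma segment_mean_diff:
  assumes u: "continuous_on UNIV u"
  shows "segment_mean u \<alpha> \<rho> - c = (LBINT t:{0..1}. u (\<alpha> + \<rho> * t) - c)"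
    and "c - segment_mean u \<alpha> \<rho> = (LBINT t:{0..1}. c - u (\<alpha> + \<rho> * t))"
proof -
  have i1: "set_integrable lborel {0..1} (\<lambda>t. u (\<alpha> + \<rho> * t))"
    by (intro borel_integrable_atLeastAtMost' continuous_on_compose2[OF u] continuous_intros) auto
  have i2: "set_integrable lborel {0..1} (\<lambda>t::real. c)"
    by (intro borel_integrable_atLeastAtMost' continuous_intros)
  have c: "(LBINT t:{0..1::real}. c) = c" by (simp add: set_lebesgue_integral_def)
  show "segment_mean u \<alpha> \<rho> - c = (LBINT t:{0..1}. u (\<alpha> + \<rho> * t) - c)"
    by (simp add: segment_mean_def set_integral_diff(2)[OF i1 i2] c)
  show "c - segment_mean u \<alpha> \<rho> = (LBINT t:{0..1}. c - u (\<alpha> + \<rho> * t))"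
    by (simp add: segment_mean_def set_integral_diff(2)[OF i2 i1] c)
qed

text \<open>Jensen's inequality in each variable bounds the squared difference of the means by a
  double mean of squared increments. Points of the two segments are at distance at most \<rho>, so
  the kernel is at least \<open>\<rho> powr - (1 + 2 * s)\<close>; passing from the unit square to
  the segments costs \<open>1 / (\<bar>\<rho>1\<bar> * \<bar>\<rho>2\<bar>)\<close>.\<close>

lemma segment_mean_diff_le_gag:
  fixes u :: "real \<Rightarrow> real"
  assumes s: "0 < s" and u: "continuous_on UNIV u" and G: "gag s u \<le> ennreal G" "G \<ge> 0"
    and nz: "\<rho>1 \<noteq> 0" "\<rho>2 \<noteq> 0"
    and near: "\<And>t t'. t \<in> {0..1} \<Longrightarrow> t' \<in> {0..1} \<Longrightarrow> \<bar>\<alpha> + \<rho>1 * t - (\<beta> + \<rho>2 * t')\<bar> \<le> \<rho>"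
  shows "(segment_mean u \<alpha> \<rho>1 - segment_mean u \<beta> \<rho>2)\<^sup>2 \<le> \<rho> powr (1 + 2 * s) / (\<bar>\<rho>1\<bar> * \<bar>\<rho>2\<bar>) * G"
proof -
  have [measurable]: "u \<in> borel_measurable borel" using u by (rule borel_measurable_continuous_onI)
  let ?m = "segment_mean u"
  let ?p = "\<rho> powr (1 + 2 * s)"
  let ?k = "\<lambda>x y. ennreal ((u x - u y)\<^sup>2 / \<bar>x - y\<bar> powr (1 + 2 * s))"
  have cont: "continuous_on UNIV (\<lambda>t. u (\<alpha> + \<rho>1 * t) - c)" "continuous_on UNIV (\<lambda>t. c - u (\<beta> + \<rho>2 * t))" for c
    by (intro continuous_intros continuous_on_compose2[OF u], auto)+
  have "ennreal ((?m \<alpha> \<rho>1 - ?m \<beta> \<rho>2)\<^sup>2)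
      \<le> (\<integral>\<^sup>+ t. ennreal ((u (\<alpha> + \<rho>1 * t) - ?m \<beta> \<rho>2)\<^sup>2) * indicator {0..1} t \<partial>lborel)"
    unfolding segment_mean_diff(1)[OF u, of \<alpha>] by (rule square_integral_unit_interval_le[OF cont(1)])
  also have "\<dots> \<le> (\<integral>\<^sup>+ t. (\<integral>\<^sup>+ t'. ennreal ((u (\<alpha> + \<rho>1 * t) - u (\<beta> + \<rho>2 * t'))\<^sup>2) * indicator {0..1} t' \<partial>lborel) * indicator {0..1} t \<partial>lborel)"
    unfolding segment_mean_diff(2)[OF u, of _ \<beta>]
    by (intro nn_integral_mono mult_right_mono square_integral_unit_interval_le[OF cont(2)]) auto
  also have "\<dots> \<le> (\<integral>\<^sup>+ t. \<integral>\<^sup>+ t'. ennreal ?p * ?k (\<alpha> + \<rho>1 * t) (\<beta> + \<rho>2 * t') \<partial>lborel \<partial>lborel)"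
  proof (intro nn_integral_mono)
    fix t :: real
    have "ennreal ((u (\<alpha> + \<rho>1 * t) - u (\<beta> + \<rho>2 * t'))\<^sup>2) \<le> ennreal ?p * ?k (\<alpha> + \<rho>1 * t) (\<beta> + \<rho>2 * t')"
      if tt: "t \<in> {0..1}" "t' \<in> {0..1}" for t'
    proof (cases "\<alpha> + \<rho>1 * t = \<beta> + \<rho>2 * t'")
      case False
      let ?d = "\<bar>\<alpha> + \<rho>1 * t - (\<beta> + \<rho>2 * t')\<bar>"
      have d: "0 < ?d" "?d \<le> \<rho>" using near[OF tt] False by auto
      have "?d powr (1 + 2 * s) \<le> ?p" using d s by (intro powr_mono2) auto
      moreover have "?d powr (1 + 2 * s) > 0" using d by simp
      ultimately have "(u (\<alpha> + \<rho>1 * t) - u (\<beta> + \<rho>2 * t'))\<^sup>2 \<le> ?p * ((u (\<alpha> + \<rho>1 * t) - u (\<beta> + \<rho>2 * t'))\<^sup>2 / ?d powr (1 + 2 * s))"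
        by (simp add: pos_le_divide_eq mult.commute[of "?p"] mult_left_mono)
      then show ?thesis by (subst ennreal_mult[symmetric]) (auto intro!: ennreal_leI)
    qed simp
    then show "(\<integral>\<^sup>+ t'. ennreal ((u (\<alpha> + \<rho>1 * t) - u (\<beta> + \<rho>2 * t'))\<^sup>2) * indicator {0..1} t' \<partial>lborel) * indicator {0..1} t
       \<le> (\<integral>\<^sup>+ t'. ennreal ?p * ?k (\<alpha> + \<rho>1 * t) (\<beta> + \<rho>2 * t') \<partial>lborel)"
      by (cases "t \<in> {0..1}") (auto intro!: nn_integral_mono split: split_indicator)
  qed
  also have "\<dots> = ennreal ?p * (\<integral>\<^sup>+ t. \<integral>\<^sup>+ t'. ?k (\<alpha> + \<rho>1 * t) (\<beta> + \<rho>2 * t') \<partial>lborel \<partial>lborel)"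
    by (simp add: nn_integral_cmult)
  also have "(\<integral>\<^sup>+ t. \<integral>\<^sup>+ t'. ?k (\<alpha> + \<rho>1 * t) (\<beta> + \<rho>2 * t') \<partial>lborel \<partial>lborel)
     = ennreal (1 / (\<bar>\<rho>1\<bar> * \<bar>\<rho>2\<bar>)) * gag s u"
  proof -
    have in1: "(\<integral>\<^sup>+ t'. ?k x (\<beta> + \<rho>2 * t') \<partial>lborel) = ennreal (1 / \<bar>\<rho>2\<bar>) * (\<integral>\<^sup>+ y. ?k x y \<partial>lborel)" for x
      using nz by (subst nn_integral_real_affine[of "?k x" \<rho>2 \<beta>])
        (auto simp: mult.assoc[symmetric] ennreal_mult[symmetric])
    have in2: "(\<integral>\<^sup>+ t. (\<integral>\<^sup>+ y. ?k (\<alpha> + \<rho>1 * t) y \<partial>lborel) \<partial>lborel) = ennreal (1 / \<bar>\<rho>1\<bar>) * (\<integral>\<^sup>+ x. (\<integral>\<^sup>+ y. ?k x y \<partial>lborel) \<partial>lborel)"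
      using nz by (subst nn_integral_real_affine[of "\<lambda>x. (\<integral>\<^sup>+ y. ?k x y \<partial>lborel)" \<rho>1 \<alpha>])
        (auto simp: mult.assoc[symmetric] ennreal_mult[symmetric])
    show ?thesis
      by (simp add: in1 nn_integral_cmult in2 gag_iterated mult.assoc[symmetric] ennreal_mult[symmetric] mult.commute[of "\<bar>\<rho>2\<bar>"])
  qed
  also have "ennreal ?p * (ennreal (1 / (\<bar>\<rho>1\<bar> * \<bar>\<rho>2\<bar>)) * gag s u) \<le> ennreal ?p * (ennreal (1 / (\<bar>\<rho>1\<bar> * \<bar>\<rho>2\<bar>)) * ennreal G)"
    using G by (intro mult_left_mono) auto
  also have "\<dots> = ennreal (?p / (\<bar>\<rho>1\<bar> * \<bar>\<rho>2\<bar>) * G)"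
    using G(2) by (simp add: ennreal_mult[symmetric])
  finally show ?thesis using G(2) by (subst (asm) ennreal_le_iff) auto
qed

lemma segment_mean_tendsto:
  assumes u: "continuous_on UNIV u" and r: "r \<longlonglongrightarrow> 0"
  shows "(\<lambda>n. segment_mean u x (r n)) \<longlonglongrightarrow> u x"
proof -
  have [measurable]: "u \<in> borel_measurable borel" using u by (rule borel_measurable_continuous_onI)
  from r have "Bseq r" by (intro convergent_imp_Bseq convergentI)
  then obtain B where B: "B > 0" "\<And>n. \<bar>r n\<bar> \<le> B" by (auto simp: Bseq_def)
  have "compact (u ` {x - B..x + B})"
    using u by (intro compact_continuous_image) (auto intro: continuous_on_subset)
  then obtain M where M: "\<And>y. y \<in> {x - B..x + B} \<Longrightarrow> \<bar>u y\<bar> \<le> M"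
    by (metis bounded_iff compact_imp_bounded imageI real_norm_def)
  have lim: "(\<lambda>n. integral\<^sup>L lborel (\<lambda>t. indicator {0..1} t *\<^sub>R u (x + r n * t))) \<longlonglongrightarrow> integral\<^sup>L lborel (\<lambda>t::real. indicator {0..1} t *\<^sub>R u x)"
  proof (rule integral_dominated_convergence[where w="\<lambda>t::real. indicator {0..1} t *\<^sub>R M"])
    show "AE t in lborel. (\<lambda>n. indicator {0..1} t *\<^sub>R u (x + r n * t)) \<longlonglongrightarrow> indicator {0..1} t *\<^sub>R u x"
    proof (rule AE_I2)
      fix t :: real
      have "(\<lambda>n. x + r n * t) \<longlonglongrightarrow> x + 0 * t" by (intro tendsto_intros r)
      then have "(\<lambda>n. u (x + r n * t)) \<longlonglongrightarrow> u (x + 0 * t)"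
        by (rule continuous_on_tendsto_compose[OF u]) auto
      then show "(\<lambda>n. indicator {0..1} t *\<^sub>R u (x + r n * t)) \<longlonglongrightarrow> indicator {0..1} t *\<^sub>R u x"
        by (intro tendsto_intros) simp
    qed
    show "AE t in lborel. norm (indicator {0..1} t *\<^sub>R u (x + r n * t)) \<le> indicator {0..1} t *\<^sub>R M" for n
    proof (rule AE_I2)
      fix t :: real
      have "\<bar>u (x + r n * t)\<bar> \<le> M" if t: "0 \<le> t" "t \<le> 1"
      proof (rule M)
        have "\<bar>r n * t\<bar> \<le> B * 1" unfolding abs_mult using t B(1) B(2)[of n] by (intro mult_mono) auto
        then show "x + r n * t \<in> {x - B..x + B}" by auto
      qed
      then show "norm (indicator {0..1} t *\<^sub>R u (x + r n * t)) \<le> indicator {0..1} t *\<^sub>R M"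
        by (auto simp: indicator_def)
    qed
  qed auto
  then show ?thesis by (simp add: segment_mean_def set_lebesgue_integral_def)
qed

text \<open>With \<open>\<theta> = (1 / 2) powr (s - 1 / 2)\<close>, the quotient
  \<open>sqrt 2 / (1 - \<theta>)\<close> sums the errors along successively halved segments; the
  factor 2 stands for the two end points in \<open>holder_of_gag\<close>.\<close>

definition morrey_const :: "real \<Rightarrow> real" where
  "morrey_const s = 2 * sqrt 2 / (1 - (1 / 2) powr (s - 1 / 2))"

lemma morrey_const_pos: "1 / 2 < s \<Longrightarrow> morrey_const s > 0"
proof -
  assume s: "1 / 2 < s"
  have "(1 / 2) powr (s - 1 / 2) < (1::real)" using s by (simp add: powr01_less_one)
  then show ?thesis by (simp add: morrey_const_def)
qed

text \<open>The means over the segments of lengths \<open>r / 2 ^ n\<close> issuing from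
  \<open>x\<close> tend to \<open>u x\<close>. By scaling, the squared difference of consecutive
  means is at most \<open>2 * G * \<bar>r / 2 ^ n\<bar> powr (2 * s - 1)\<close>, which decreases
  geometrically exactly because \<open>s > 1 / 2\<close>.\<close>

lemma segment_mean_near_point:
  fixes u :: "real \<Rightarrow> real"
  assumes s: "1 / 2 < s" and u: "continuous_on UNIV u" and G: "gag s u \<le> ennreal G" "G \<ge> 0" and r: "r \<noteq> 0"
  shows "\<bar>segment_mean u x r - u x\<bar> \<le> morrey_const s / 2 * sqrt G * \<bar>r\<bar> powr (s - 1 / 2)"
proof -
  define \<beta> where "\<beta> = s - 1 / 2"
  define \<theta> where "\<theta> = (1 / 2 :: real) powr \<beta>"
  have \<theta>: "0 < \<theta>" "\<theta> < 1" using s by (auto simp: \<theta>_def \<beta>_def powr01_less_one)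
  define R where "R n = r / 2 ^ n" for n :: nat
  define m where "m n = segment_mean u x (R n)" for n
  have step: "\<bar>m n - m (Suc n)\<bar> \<le> sqrt (2 * G) * \<bar>r\<bar> powr \<beta> * \<theta> ^ n" for n
  proof -
    have Rn: "R n \<noteq> 0" "R (Suc n) = R n / 2" using r by (auto simp: R_def)
    have "(m n - m (Suc n))\<^sup>2 \<le> \<bar>R n\<bar> powr (1 + 2 * s) / (\<bar>R n\<bar> * \<bar>R (Suc n)\<bar>) * G"
      unfolding m_def
    proof (rule segment_mean_diff_le_gag[OF _ u G])
      fix t t' :: real assume t: "t \<in> {0..1}" "t' \<in> {0..1}"
      have "\<bar>t - t' / 2\<bar> \<le> 1" using t by (auto simp: abs_le_iff)
      then have "\<bar>R n\<bar> * \<bar>t - t' / 2\<bar> \<le> \<bar>R n\<bar> * 1" by (intro mult_left_mono) auto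
      then show "\<bar>x + R n * t - (x + R (Suc n) * t')\<bar> \<le> \<bar>R n\<bar>"
        by (simp add: abs_mult[symmetric] Rn algebra_simps)
    qed (use Rn s in auto)
    also have "\<dots> = 2 * G * \<bar>R n\<bar> powr (2 * \<beta>)"
    proof -
      have "\<bar>R n\<bar> powr (1 + 2 * s) = \<bar>R n\<bar> powr (2 * \<beta> + 2)" by (simp add: \<beta>_def)
      also have "\<dots> = \<bar>R n\<bar> powr (2 * \<beta>) * \<bar>R n\<bar>\<^sup>2" using Rn by (subst powr_add) simp
      finally have "\<bar>R n\<bar> powr (1 + 2 * s) / (\<bar>R n\<bar> * \<bar>R (Suc n)\<bar>) = 2 * \<bar>R n\<bar> powr (2 * \<beta>)"
        using Rn(1) unfolding Rn(2) by (simp add: power2_eq_square abs_divide abs_mult_self_eq)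
      then show ?thesis by simp
    qed
    also have "\<bar>R n\<bar> powr (2 * \<beta>) = (\<bar>R n\<bar> powr \<beta>)\<^sup>2"
      by (simp add: powr_add[symmetric] power2_eq_square)
    also have "\<bar>R n\<bar> powr \<beta> = \<bar>r\<bar> powr \<beta> * \<theta> ^ n"
    proof -
      have "\<bar>R n\<bar> = \<bar>r\<bar> * (1 / 2) ^ n" by (simp add: R_def abs_mult power_one_over)
      also have "\<dots> powr \<beta> = \<bar>r\<bar> powr \<beta> * ((1 / 2) ^ n) powr \<beta>" by (rule powr_mult)
      also have "((1 / 2 :: real) ^ n) powr \<beta> = \<theta> ^ n"
        by (simp add: \<theta>_def powr_realpow[symmetric] powr_powr mult.commute)
      finally show ?thesis .
    qed
    finally have "\<bar>m n - m (Suc n)\<bar> \<le> sqrt (2 * G * (\<bar>r\<bar> powr \<beta> * \<theta> ^ n)\<^sup>2)"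
      using real_sqrt_le_mono by fastforce
    also have "\<dots> = sqrt (2 * G) * (\<bar>r\<bar> powr \<beta> * \<theta> ^ n)"
      using \<theta> by (subst real_sqrt_mult) simp
    finally show ?thesis by simp
  qed
  have part: "\<bar>m 0 - m n\<bar> \<le> sqrt (2 * G) * \<bar>r\<bar> powr \<beta> * (\<Sum>k<n. \<theta> ^ k)" for n
  proof (induction n)
    case (Suc n)
    have "\<bar>m 0 - m (Suc n)\<bar> \<le> \<bar>m 0 - m n\<bar> + \<bar>m n - m (Suc n)\<bar>" by simp
    with Suc step[of n] show ?case by (simp add: algebra_simps)
  qed simp
  have bd: "\<bar>m 0 - m n\<bar> \<le> sqrt (2 * G) * \<bar>r\<bar> powr \<beta> * (1 / (1 - \<theta>))" for n
  proof -
    have "(\<Sum>k<n. \<theta> ^ k) \<le> 1 / (1 - \<theta>)"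
      using \<theta> by (simp add: sum_gp_strict divide_right_mono)
    then have "sqrt (2 * G) * \<bar>r\<bar> powr \<beta> * (\<Sum>k<n. \<theta> ^ k) \<le> sqrt (2 * G) * \<bar>r\<bar> powr \<beta> * (1 / (1 - \<theta>))"
      using G by (intro mult_left_mono) auto
    with part[of n] show ?thesis by linarith
  qed
  have "R \<longlonglongrightarrow> 0"
  proof -
    have "(\<lambda>n. r * (1 / 2) ^ n) \<longlonglongrightarrow> r * 0" by (intro tendsto_intros LIMSEQ_power_zero) auto
    then show ?thesis by (simp add: R_def [abs_def] power_one_over field_simps)
  qed
  then have "m \<longlonglongrightarrow> u x" unfolding m_def by (rule segment_mean_tendsto[OF u])
  then have "(\<lambda>n. \<bar>m 0 - m n\<bar>) \<longlonglongrightarrow> \<bar>m 0 - u x\<bar>" by (intro tendsto_intros)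
  then have "\<bar>m 0 - u x\<bar> \<le> sqrt (2 * G) * \<bar>r\<bar> powr \<beta> * (1 / (1 - \<theta>))"
    by (rule LIMSEQ_le_const2) (use bd in auto)
  also have "\<dots> = morrey_const s / 2 * sqrt G * \<bar>r\<bar> powr \<beta>"
    unfolding morrey_const_def \<beta>_def[symmetric] \<theta>_def[symmetric] using \<theta> by (simp add: real_sqrt_mult field_simps)
  finally show ?thesis by (simp add: m_def R_def \<beta>_def)
qed

text \<open>The segment from \<open>x\<close> to \<open>y\<close> is also the segment from
  \<open>y\<close> to \<open>x\<close>, so a single mean is compared with both end values.\<close>

lemma holder_of_gag:
  fixes u :: "real \<Rightarrow> real"
  assumes s: "1 / 2 < s" and u: "continuous_on UNIV u" and G: "gag s u \<le> ennreal G" "G \<ge> 0"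
  shows "\<bar>u x - u y\<bar> \<le> morrey_const s * sqrt G * \<bar>x - y\<bar> powr (s - 1 / 2)"
proof (cases "x = y")
  case False
  have "segment_mean u x (y - x) = segment_mean u y (x - y)"
  proof -
    have "(LBINT t. indicator {0..1} t *\<^sub>R u (x + (y - x) * t)) = (LBINT t. indicator {0..1} (1 - t) *\<^sub>R u (x + (y - x) * (1 - t)))"
      using lborel_integral_real_affine[of "-1" "\<lambda>t. indicator {0..1} t *\<^sub>R u (x + (y - x) * t)" 1] by simp
    also have "\<dots> = (LBINT t. indicator {0..1} t *\<^sub>R u (y + (x - y) * t))"
      by (intro Bochner_Integration.integral_cong) (auto simp: indicator_def algebra_simps)
    finally show ?thesis by (simp add: segment_mean_def set_lebesgue_integral_def)
  qed
  then have "\<bar>u x - u y\<bar> \<le> \<bar>segment_mean u x (y - x) - u x\<bar> + \<bar>segment_mean u y (x - y) - u y\<bar>" by linarith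
  also have "\<dots> \<le> morrey_const s / 2 * sqrt G * \<bar>y - x\<bar> powr (s - 1 / 2) + morrey_const s / 2 * sqrt G * \<bar>x - y\<bar> powr (s - 1 / 2)"
    using False by (intro add_mono segment_mean_near_point[OF s u G]) auto
  finally show ?thesis by (simp add: abs_minus_commute mult_ac)
qed simp

section \<open>Existence of minimizers\<close>

text \<open>For \<open>V \<le> 0\<close> both parts of the energy are nonnegative, so it can live in
  \<open>ennreal\<close>: no difference of infinities arises and Fatou's lemma applies at once.
  \<open>energy_eq_nrg\<close> is the link to \<open>energy\<close>.\<close>

definition nrg :: "real \<Rightarrow> ('a::euclidean_space \<Rightarrow> real) \<Rightarrow> (real \<Rightarrow> 'a) \<Rightarrow> ennreal" where
  "nrg s V q = gagliardo_sq s q / 2 + (\<integral>\<^sup>+ x. ennreal (- V (q x)) \<partial>lborel)"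

lemma energy_eq_nrg:
  assumes "\<And>x. V x \<le> 0"
  shows "energy s V q = enn2ereal (nrg s V q)"
proof -
  have 0: "(\<integral>\<^sup>+ x. ennreal (V (q x)) \<partial>lebesgue) = 0"
    using assms by (simp add: ennreal_neg)
  have h: "enn2ereal (x / 2) = enn2ereal x / 2" for x
    by (cases x) (auto simp: divide_ennreal[of _ 2, simplified] ennreal_top_divide)
  have "nrg s V q = gagliardo_sq s q / 2 + (\<integral>\<^sup>+ x. ennreal (- V (q x)) \<partial>lebesgue)"
    by (simp add: nrg_def nn_integral_completion)
  then show ?thesis
    by (simp add: energy_def ext_integral_def 0 plus_ennreal.rep_eq h) (simp add: minus_ereal_def zero_ennreal.rep_eq)
qed

lemma AE_lborel_pair:
  fixes P :: "real \<Rightarrow> bool"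
  assumes "AE x in lborel. P x"
  shows "AE z in lborel \<Otimes>\<^sub>M lborel. P (fst z) \<and> P (snd z)"
proof -
  from assms obtain N where N: "{x \<in> space lborel. \<not> P x} \<subseteq> N" "emeasure lborel N = 0" "N \<in> sets lborel"
    by (rule AE_E)
  have "N \<times> UNIV \<union> UNIV \<times> N \<in> null_sets (lborel \<Otimes>\<^sub>M lborel)"
    using N by (intro null_sets.Un null_setsI)
      (auto simp: lborel.emeasure_pair_measure_Times intro!: pair_measureI)
  moreover have "{z \<in> space (lborel \<Otimes>\<^sub>M lborel). \<not> (P (fst z) \<and> P (snd z))} \<subseteq> N \<times> UNIV \<union> UNIV \<times> N"
    using N(1) by (auto simp: space_pair_measure)
  ultimately show ?thesis by (rule AE_I'[rotated -1, rotated]) 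
qed

lemma gagliardo_sq_cong_AE:
  assumes "AE x in lebesgue. q x = r x"
  shows "gagliardo_sq s q = gagliardo_sq s r"
proof -
  have "AE x in lborel. q x = r x" using assms by (simp add: AE_completion_iff)
  from AE_lborel_pair[OF this] have ae: "AE z in lborel. q (fst z) = r (fst z) \<and> q (snd z) = r (snd z)"
    unfolding lborel_prod .
  show ?thesis unfolding gagliardo_sq_def nn_integral_completion
    by (intro arg_cong2[where f="(*)"] refl nn_integral_cong_AE eventually_mono[OF ae]) auto
qed

lemma nrg_cong_AE:
  assumes "AE x in lebesgue. q x = r x"
  shows "nrg s V q = nrg s V r"
proof -
  have "AE x in lborel. q x = r x" using assms by (simp add: AE_completion_iff)
  then have "(\<integral>\<^sup>+ x. ennreal (- V (q x)) \<partial>lborel) = (\<integral>\<^sup>+ x. ennreal (- V (r x)) \<partial>lborel)"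
    by (intro nn_integral_cong_AE) (auto elim!: eventually_mono)
  then show ?thesis by (simp add: nrg_def gagliardo_sq_cong_AE[OF assms])
qed

lemma ennreal_Liminf_add_le:
  fixes f g :: "nat \<Rightarrow> ennreal"
  shows "liminf f + liminf g \<le> liminf (\<lambda>n. f n + g n)"
  including ennreal.lifting
  by (transfer, rule Liminf_add_le) auto

text \<open>Fatou's lemma asks only for pointwise convergence of the two nonnegative integrands, so
  no weak compactness in the energy space enters.\<close>

lemma nrg_lower_semicontinuous:
  fixes p :: "nat \<Rightarrow> real \<Rightarrow> 'a::euclidean_space"
  assumes p: "\<And>n. continuous_on UNIV (p n)" and V: "continuous_on UNIV V"
    and lim: "\<And>x. (\<lambda>n. p n x) \<longlonglongrightarrow> q x"
  shows "nrg s V q \<le> liminf (\<lambda>n. nrg s V (p n))"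
proof -
  have [measurable]: "p n \<in> borel_measurable borel" for n using p by (rule borel_measurable_continuous_onI)
  have [measurable]: "V \<in> borel_measurable borel" using V by (rule borel_measurable_continuous_onI)
  let ?F = "\<lambda>q z. ennreal ((norm (q (fst z) - q (snd z) :: 'a))\<^sup>2 / \<bar>fst z - snd z\<bar> powr (1 + 2 * s))"
  let ?W = "\<lambda>q. \<integral>\<^sup>+ x. ennreal (- V (q x)) \<partial>lborel"
  define C where "C = ennreal (c_s s) / 2"
  have C: "C < top" by (simp add: C_def ennreal_divide_eq_top_iff less_top[symmetric])
  have [measurable]: "q \<in> borel_measurable borel"
    by (rule borel_measurable_LIMSEQ_metric[of p]) (use lim in auto)
  have g: "gagliardo_sq s q / 2 = (\<integral>\<^sup>+ z. C * ?F q z \<partial>(lborel \<Otimes>\<^sub>M lborel))"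
    if [measurable]: "q \<in> borel_measurable borel" for q :: "real \<Rightarrow> 'a"
  proof -
    have "gagliardo_sq s q / 2 = C * (\<integral>\<^sup>+ z. ?F q z \<partial>(lborel \<Otimes>\<^sub>M lborel))"
      unfolding gagliardo_sq_def nn_integral_completion lborel_prod
      by (simp add: C_def case_prod_unfold divide_ennreal_def mult_ac)
    then show ?thesis by (simp add: nn_integral_cmult)
  qed
  have "gagliardo_sq s q / 2 = (\<integral>\<^sup>+ z. liminf (\<lambda>n. C * ?F (p n) z) \<partial>(lborel \<Otimes>\<^sub>M lborel))"
    unfolding g[OF \<open>q \<in> borel_measurable borel\<close>]
  proof (intro nn_integral_cong)
    fix z :: "real \<times> real"
    have "(\<lambda>n. C * ?F (p n) z) \<longlonglongrightarrow> C * ?F q z"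
      unfolding divide_inverse by (intro ennreal_tendsto_cmult[OF C] tendsto_intros lim)
    then show "C * ?F q z = liminf (\<lambda>n. C * ?F (p n) z)" by (rule lim_imp_Liminf[OF trivial_limit_sequentially, symmetric])
  qed
  also have "\<dots> \<le> liminf (\<lambda>n. \<integral>\<^sup>+ z. C * ?F (p n) z \<partial>(lborel \<Otimes>\<^sub>M lborel))"
    by (intro nn_integral_liminf) measurable
  also have "\<dots> = liminf (\<lambda>n. gagliardo_sq s (p n) / 2)" by (simp add: g)
  finally have 1: "gagliardo_sq s q / 2 \<le> liminf (\<lambda>n. gagliardo_sq s (p n) / 2)" .
  have "?W q = (\<integral>\<^sup>+ x. liminf (\<lambda>n. ennreal (- V (p n x))) \<partial>lborel)"
  proof (intro nn_integral_cong)
    fix x :: real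
    have "(\<lambda>n. V (p n x)) \<longlonglongrightarrow> V (q x)" by (rule continuous_on_tendsto_compose[OF V lim]) auto
    then have "(\<lambda>n. ennreal (- V (p n x))) \<longlonglongrightarrow> ennreal (- V (q x))" by (intro tendsto_intros)
    then show "ennreal (- V (q x)) = liminf (\<lambda>n. ennreal (- V (p n x)))" by (rule lim_imp_Liminf[OF trivial_limit_sequentially, symmetric])
  qed
  also have "\<dots> \<le> liminf (\<lambda>n. ?W (p n))" by (intro nn_integral_liminf) measurable
  finally have "nrg s V q \<le> liminf (\<lambda>n. gagliardo_sq s (p n) / 2) + liminf (\<lambda>n. ?W (p n))"
    unfolding nrg_def using 1 by (intro add_mono)
  also have "\<dots> \<le> liminf (\<lambda>n. nrg s V (p n))" unfolding nrg_def by (rule ennreal_Liminf_add_le)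
  finally show ?thesis .
qed

section \<open>Componentwise truncation\<close>

definition truncv :: "real \<Rightarrow> real ^ 'n \<Rightarrow> real ^ 'n" where
  "truncv R v = (\<chi> i. trunc R (v $ i))"

lemma trunc_eq:
  assumes R: "R > 0"
  shows "trunc R r = max (- R) (min R r)"
proof -
  consider "\<bar>r\<bar> < R" | "r \<ge> R" | "r \<le> - R" by linarith
  then show ?thesis
  proof cases
    case 1
    then have "min R r = r" "max (- R) r = r" by linarith+
    then show ?thesis using 1 by (simp only: trunc_def if_True)
  next
    case 2
    then have "min R r = R" "max (- R) R = R" "\<not> \<bar>r\<bar> < R" using R by linarith+
    then show ?thesis using 2 by (simp only: trunc_def if_True if_False)
  next
    case 3
    then have "min R r = r" "max (- R) r = - R" "\<not> \<bar>r\<bar> < R" "\<not> R \<le> r" using R by linarith+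
    then show ?thesis by (simp only: trunc_def if_False)
  qed
qed

lemma trunc_lipschitz:
  assumes "R > 0"
  shows "\<bar>trunc R a - trunc R b\<bar> \<le> \<bar>a - b\<bar>"
proof -
  have "\<bar>min R a - min R b\<bar> \<le> \<bar>a - b\<bar>"
    by (cases "R \<le> a"; cases "R \<le> b") (simp_all add: min_def)
  moreover have "\<bar>max (- R) x - max (- R) y\<bar> \<le> \<bar>x - y\<bar>" for x y
    by (cases "- R \<le> x"; cases "- R \<le> y") (simp_all add: max_def)
  ultimately show ?thesis unfolding trunc_eq[OF assms] by (rule order_trans[rotated])
qed

lemma truncv_props:
  assumes "R > 0"
  shows "continuous_on UNIV (truncv R)" and "norm (truncv R u - truncv R v) \<le> norm (u - v)"
    and "\<bar>truncv R u $ i\<bar> \<le> R" and "(\<forall>i. \<bar>u $ i\<bar> \<le> R) \<Longrightarrow> truncv R u = u"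
proof -
  show "continuous_on UNIV (truncv R)"
    unfolding truncv_def trunc_eq[OF assms] by (intro continuous_intros)
  show "norm (truncv R u - truncv R v) \<le> norm (u - v)"
    by (rule norm_le_componentwise_cart) (simp add: truncv_def trunc_lipschitz[OF assms])
  show "\<bar>truncv R u $ i\<bar> \<le> R" using assms by (auto simp: truncv_def trunc_eq)
  show "truncv R u = u" if "\<forall>i. \<bar>u $ i\<bar> \<le> R"
  proof -
    have "trunc R (u $ i) = u $ i" for i using that[rule_format, of i] by (auto simp: trunc_def)
    then show ?thesis by (simp add: truncv_def vec_eq_iff)
  qed
qed

text \<open>Truncation is 1-Lipschitz, so no increment grows, and by hypothesis it never lowers
  \<open>V\<close>; inside the open cube it is the identity.\<close>

lemma nrg_truncv_le:
  fixes V :: "real ^ 'n \<Rightarrow> real"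
  assumes R: "R > 0" and V: "\<And>q. q \<notin> {p. \<forall>i. - R < p $ i \<and> p $ i < R} \<Longrightarrow> V q \<le> V (truncv R q)"
  shows "nrg s V (\<lambda>x. truncv R (q x)) \<le> nrg s V q"
proof -
  have V': "V v \<le> V (truncv R v)" for v
  proof (cases "v \<in> {p. \<forall>i. - R < p $ i \<and> p $ i < R}")
    case True
    then have "truncv R v = v" by (intro truncv_props(4) R) (auto simp: abs_le_iff less_imp_le minus_less_iff minus_le_iff)
    then show ?thesis by simp
  qed (rule V)
  show ?thesis unfolding nrg_def gagliardo_sq_def
    using truncv_props(2)[OF R] V'
    by (intro add_mono nn_integral_mono divide_right_mono_ennreal mult_left_mono)
       (auto intro!: ennreal_leI divide_right_mono power_mono)
qed

lemma norm_vec_le_card: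
  fixes x :: "real ^ 'n"
  assumes "\<And>i. \<bar>x $ i\<bar> \<le> B"
  shows "norm x \<le> real CARD('n) * B"
proof -
  have "norm x \<le> (\<Sum>i\<in>UNIV. \<bar>x $ i\<bar>)" by (rule norm_le_l1_cart)
  also have "\<dots> \<le> (\<Sum>i\<in>(UNIV :: 'n set). B)" by (intro sum_mono assms)
  finally show ?thesis by simp
qed

text \<open>Both summands of \<open>nrg\<close> are nonnegative, so the energy alone controls the
  seminorm of every component.\<close>

lemma gag_component_le:
  fixes q :: "real \<Rightarrow> real ^ 'n"
  assumes s: "0 < s" "s < 1" and q: "continuous_on UNIV q" and E: "nrg s V q \<le> ennreal E" "E \<ge> 0"
  shows "gag s (\<lambda>x. q x $ i) \<le> ennreal (2 * E / c_s s)"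
proof -
  have c: "c_s s > 0" by (rule c_s_pos[OF s])
  have "ennreal (c_s s) * gag s (\<lambda>x. q x $ i) \<le> ennreal (c_s s) * (\<Sum>i\<in>UNIV. gag s (\<lambda>x. q x $ i))"
    by (intro mult_left_mono member_le_sum) auto
  also have "\<dots> = gagliardo_sq s q" by (rule gagliardo_sq_eq_gag[OF q, symmetric])
  also have "\<dots> = 2 * (gagliardo_sq s q / 2)" 
    by (simp add: ennreal_times_divide ennreal_mult_divide_eq mult.commute)
  also have "\<dots> \<le> 2 * nrg s V q" unfolding nrg_def by (intro mult_left_mono) auto
  also have "\<dots> \<le> 2 * ennreal E" using E by (intro mult_left_mono) auto
  also have "\<dots> = ennreal (2 * E)" using E by (simp add: ennreal_mult)
  finally have *: "ennreal (c_s s) * gag s (\<lambda>x. q x $ i) \<le> ennreal (2 * E)" .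
  have "gag s (\<lambda>x. q x $ i) = ennreal (1 / c_s s) * (ennreal (c_s s) * gag s (\<lambda>x. q x $ i))"
    using c by (simp add: mult.assoc[symmetric] ennreal_mult[symmetric])
  also have "\<dots> \<le> ennreal (1 / c_s s) * ennreal (2 * E)" using * by (intro mult_left_mono) auto
  also have "\<dots> = ennreal (2 * E / c_s s)" using c E by (simp add: ennreal_mult[symmetric])
  finally show ?thesis .
qed

lemma holder_of_nrg:
  fixes q :: "real \<Rightarrow> real ^ 'n"
  assumes s: "1 / 2 < s" "s < 1" and q: "continuous_on UNIV q" and E: "nrg s V q \<le> ennreal E" "E \<ge> 0"
  shows "norm (q x - q y) \<le> real CARD('n) * (morrey_const s * sqrt (2 * E / c_s s)) * \<bar>x - y\<bar> powr (s - 1 / 2)"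
proof -
  have c: "c_s s > 0" using s by (intro c_s_pos) auto
  have "\<bar>(q x - q y) $ i\<bar> \<le> morrey_const s * sqrt (2 * E / c_s s) * \<bar>x - y\<bar> powr (s - 1 / 2)" for i
  proof -
    have "continuous_on UNIV (\<lambda>x. q x $ i)" using q by (intro continuous_intros)
    from holder_of_gag[OF s(1) this gag_component_le[OF _ s(2) q E]]
    show ?thesis using s E c by simp
  qed
  from norm_vec_le_card[OF this] show ?thesis by (simp add: mult.assoc)
qed

lemma continuous_of_holder:
  fixes q :: "real \<Rightarrow> 'a::real_normed_vector"
  assumes \<beta>: "\<beta> > 0" and H: "\<And>x y. norm (q x - q y) \<le> H * \<bar>x - y\<bar> powr \<beta>"
  shows "uniformly_continuous_on UNIV q"
  unfolding uniformly_continuous_on_def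
proof (intro allI impI)
  fix e :: real assume e: "e > 0"
  define H' where "H' = max H 1"
  have H': "H' > 0" "norm (q x - q y) \<le> H' * \<bar>x - y\<bar> powr \<beta>" for x y
  proof -
    show "H' > 0" by (simp add: H'_def)
    have "H * \<bar>x - y\<bar> powr \<beta> \<le> H' * \<bar>x - y\<bar> powr \<beta>" by (intro mult_right_mono) (auto simp: H'_def)
    with H[of x y] show "norm (q x - q y) \<le> H' * \<bar>x - y\<bar> powr \<beta>" by linarith
  qed
  define d where "d = (e / H') powr (1 / \<beta>)"
  have "d > 0" using e H'(1) by (simp add: d_def)
  moreover have "norm (q y - q x) < e" if "\<bar>y - x\<bar> < d" for x y
  proof -
    have "\<bar>y - x\<bar> powr \<beta> < d powr \<beta>" using that \<beta> by (intro powr_less_mono2) auto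
    also have "\<dots> = e / H'" using e H'(1) \<beta> by (simp add: d_def powr_powr)
    finally show ?thesis using H'(2)[of y x] H'(1) by (simp add: field_simps)
  qed
  ultimately show "\<exists>d>0. \<forall>x\<in>UNIV. \<forall>x'\<in>UNIV. dist x' x < d \<longrightarrow> dist (q x') (q x) < e"
    by (auto simp: dist_norm dist_real_def intro!: exI[of _ d])
qed

text \<open>Arzela-Ascoli in pointwise form: a diagonal subsequence converges at all rationals, and
  the common Hoelder bound carries the Cauchy property to every real number.\<close>

lemma equicontinuous_pointwise_convergent:
  fixes p :: "nat \<Rightarrow> real \<Rightarrow> 'a::euclidean_space"
  assumes \<beta>: "\<beta> > 0" and H: "\<And>n x y. norm (p n x - p n y) \<le> H * \<bar>x - y\<bar> powr \<beta>"
    and bd: "\<And>n x. norm (p n x) \<le> M"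
  obtains k q where "strict_mono (k :: nat \<Rightarrow> nat)" "\<And>x. (\<lambda>n. p (k n) x) \<longlonglongrightarrow> q x"
proof -
  obtain k where k: "strict_mono (k :: nat \<Rightarrow> nat)" and conv: "\<And>x. x \<in> \<rat> \<Longrightarrow> \<exists>l. (\<lambda>n. p (k n) x) \<longlonglongrightarrow> l"
    using function_convergent_subsequence[of "\<rat> :: real set" p M] countable_rat bd by blast
  have H0: "H \<ge> 0" using order_trans[OF norm_ge_zero H[of 0 1 0]] by simp
  have "convergent (\<lambda>n. p (k n) x)" for x
    unfolding Cauchy_convergent_iff[symmetric]
  proof (rule metric_CauchyI)
    fix e :: real assume e: "e > 0"
    \<comment> \<open>\<open>H + 1\<close> instead of \<open>H\<close> covers \<open>H = 0\<close>
      and makes the estimate below strict.\<close>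
    define d where "d = (e / (3 * (H + 1))) powr (1 / \<beta>)"
    have d: "d > 0" using e H0 by (simp add: d_def)
    obtain y where y: "y \<in> \<rat>" "x < y" "y < x + d" using Rats_dense_in_real[of x "x + d"] d by auto
    have near: "norm (p n x - p n y) < e / 3" for n
    proof -
      have "\<bar>x - y\<bar> powr \<beta> \<le> d powr \<beta>" using y \<beta> by (intro powr_mono2) auto
      also have "\<dots> = e / (3 * (H + 1))" using e H0 \<beta> by (simp add: d_def powr_powr)
      finally have "H * \<bar>x - y\<bar> powr \<beta> \<le> H * (e / (3 * (H + 1)))" using H0 by (intro mult_left_mono)
      also have "\<dots> < e / 3" using e H0 by (simp add: field_simps)
      finally show ?thesis using H[of n x y] by linarith
    qed
    from conv[OF y(1)] have "Cauchy (\<lambda>n. p (k n) y)" using LIMSEQ_imp_Cauchy by blast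
    then obtain N where N: "\<And>m n. m \<ge> N \<Longrightarrow> n \<ge> N \<Longrightarrow> dist (p (k m) y) (p (k n) y) < e / 3"
      using e unfolding Cauchy_def by (metis divide_pos_pos zero_less_numeral)
    have "dist (p (k m) x) (p (k n) x) < e" if "m \<ge> N" "n \<ge> N" for m n
    proof -
      have "dist (p (k m) x) (p (k n) x) \<le> dist (p (k m) x) (p (k m) y) + dist (p (k m) y) (p (k n) y) + dist (p (k n) y) (p (k n) x)"
        using dist_triangle[of "p (k m) x" "p (k n) x" "p (k m) y"] dist_triangle[of "p (k m) y" "p (k n) x" "p (k n) y"] by linarith
      then show ?thesis using near[of "k m"] near[of "k n"] N[OF that]
        by (simp add: dist_norm norm_minus_commute)
    qed
    then show "\<exists>M. \<forall>m\<ge>M. \<forall>n\<ge>M. dist (p (k m) x) (p (k n) x) < e" by blast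
  qed
  then have "(\<lambda>n. p (k n) x) \<longlonglongrightarrow> lim (\<lambda>n. p (k n) x)" for x by (simp add: convergent_LIMSEQ_iff)
  with k show thesis by (rule that)
qed

lemma continuous_in_Ds2:
  fixes q :: "real \<Rightarrow> 'a::euclidean_space"
  assumes "continuous_on UNIV q" "gagliardo_sq s q < \<infinity>"
  shows "q \<in> Ds2 s"
  using assms by (auto simp: Ds2_def intro!: measurable_completion)
    (simp add: borel_measurable_continuous_onI)

lemma exists_truncated_minimizer:
  fixes V :: "real ^ 'n \<Rightarrow> real" and q\<^sub>0 :: "real ^ 'n"
  assumes s: "1 / 2 < s" "s < 1" and Vc: "continuous_on UNIV V"
    and R: "R > 0" "\<And>i. \<bar>q\<^sub>0 $ i\<bar> \<le> R"
    and VR: "\<And>q. q \<notin> {p. \<forall>i. - R < p $ i \<and> p $ i < R} \<Longrightarrow> V q \<le> V (truncv R q)"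
    and comp: "p0 \<in> Gam s a q\<^sub>0" "nrg s V p0 \<le> ennreal E" "E \<ge> 0"
  shows "\<exists>q. continuous_on UNIV q \<and> q a = q\<^sub>0 \<and> (\<forall>x i. \<bar>q x $ i\<bar> \<le> R) \<and>
    (\<forall>p \<in> Gam s a q\<^sub>0. nrg s V q \<le> nrg s V p)"
proof -
  define I where "I = (INF p\<in>Gam s a q\<^sub>0. nrg s V p)"
  have IE: "I \<le> ennreal E" using comp INF_lower[of p0 "Gam s a q\<^sub>0" "nrg s V"] by (auto simp: I_def)
  then have If: "I < top" by (rule le_less_trans) simp
  have "\<exists>p. continuous_on UNIV p \<and> p a = q\<^sub>0 \<and> (\<forall>x i. \<bar>p x $ i\<bar> \<le> R) \<and> nrg s V p < I + ennreal (1 / real (Suc n))" for n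
  proof -
    \<comment> \<open>Strict because \<open>I\<close> is finite, which the given competitor
      guarantees.\<close>
    have "I < I + ennreal (1 / real (Suc n))" using If by (cases I) (auto simp: ennreal_less_iff simp flip: ennreal_plus)
    then obtain p where p: "p \<in> Gam s a q\<^sub>0" "nrg s V p < I + ennreal (1 / real (Suc n))"
      unfolding I_def by (subst (asm) INF_less_iff) auto
    from p(1) obtain r where r: "continuous_on UNIV r" "AE x in lebesgue. p x = r x" "r a = q\<^sub>0"
      unfolding Gam_def has_point_value_def by auto
    \<comment> \<open>What is truncated is the continuous representative, which has the same energy;
      its value at \<open>a\<close> survives because \<open>q\<^sub>0\<close> lies in the closed
      cube.\<close>
    have "nrg s V (\<lambda>x. truncv R (r x)) < I + ennreal (1 / real (Suc n))"
      using p(2) nrg_truncv_le[of R V s r, OF R(1) VR] nrg_cong_AE[OF r(2), of s V] by (metis le_less_trans)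
    moreover have "continuous_on UNIV (\<lambda>x. truncv R (r x))"
      by (rule continuous_on_compose2[OF truncv_props(1)[OF R(1)] r(1)]) auto
    ultimately show ?thesis using r(3) R truncv_props(3,4)[OF R(1)]
      by (intro exI[of _ "\<lambda>x. truncv R (r x)"]) auto
  qed
  then obtain p where p: "\<And>n. continuous_on UNIV (p n)" "\<And>n. p n a = q\<^sub>0" "\<And>n x i. \<bar>p n x $ i\<bar> \<le> R"
    "\<And>n. nrg s V (p n) < I + ennreal (1 / real (Suc n))" by metis
  \<comment> \<open>One energy bound for the whole sequence, as
    \<open>1 / real (Suc n) \<le> 1\<close>; it gives all terms the same Hoelder constant.\<close>
  have pE: "nrg s V (p n) \<le> ennreal (E + 1)" for n
  proof -
    have "nrg s V (p n) \<le> I + ennreal (1 / real (Suc n))" using p(4) by (simp add: less_imp_le)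
    also have "\<dots> \<le> ennreal E + ennreal 1" using IE by (intro add_mono ennreal_leI) auto
    finally show ?thesis using comp(3) by simp
  qed
  note hol = holder_of_nrg[OF s p(1) pE]
  have "norm (p n x) \<le> real CARD('n) * R" for n x by (intro norm_vec_le_card p(3))
  with s comp(3) obtain k q where k: "strict_mono (k :: nat \<Rightarrow> nat)" and lim: "\<And>x. (\<lambda>n. p (k n) x) \<longlonglongrightarrow> q x"
    by (elim equicontinuous_pointwise_convergent[OF _ hol, rotated -1]) auto
  have "norm (q x - q y) \<le> real CARD('n) * (morrey_const s * sqrt (2 * (E + 1) / c_s s)) * \<bar>x - y\<bar> powr (s - 1 / 2)" for x y
    by (rule LIMSEQ_le_const2[OF tendsto_norm[OF tendsto_diff[OF lim lim]]]) (use hol comp(3) in auto)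
  from continuous_of_holder[OF _ this] s have "continuous_on UNIV q"
    by (simp add: uniformly_continuous_imp_continuous)
  moreover have "q a = q\<^sub>0" using LIMSEQ_unique[OF lim[of a]] p(2) by simp
  moreover have "\<bar>q x $ i\<bar> \<le> R" for x i
    by (rule LIMSEQ_le_const2[OF tendsto_rabs[OF tendsto_vec_nth[OF lim]]]) (use p(3) in auto)
  moreover have "nrg s V q \<le> I"
  proof -
    have "(\<lambda>n. I + ennreal (1 / real (Suc n))) \<longlonglongrightarrow> I + ennreal 0"
      by (intro tendsto_intros LIMSEQ_Suc[OF lim_1_over_n])
    from LIMSEQ_subseq_LIMSEQ[OF this k] have l: "(\<lambda>n. I + ennreal (1 / real (Suc (k n)))) \<longlonglongrightarrow> I"
      by (simp add: o_def)
    have "nrg s V q \<le> liminf (\<lambda>n. nrg s V (p (k n)))"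
      by (rule nrg_lower_semicontinuous[OF p(1) Vc lim])
    also have "\<dots> \<le> liminf (\<lambda>n. I + ennreal (1 / real (Suc (k n))))"
      using p(4) by (intro Liminf_mono always_eventually allI less_imp_le)
    also have "\<dots> = I" by (rule lim_imp_Liminf[OF trivial_limit_sequentially l])
    finally show ?thesis .
  qed
  moreover have "I \<le> nrg s V p" if "p \<in> Gam s a q\<^sub>0" for p using that by (simp add: I_def INF_lower)
  ultimately show ?thesis by (intro exI[of _ q]) (auto intro: order_trans)
qed

section \<open>Reflection\<close>

text \<open>Euler's integral after replacing \<open>t\<close> by \<open>z * t\<close>; it presents a
  negative power of \<open>z\<close> as a superposition of exponentials.\<close>

lemma has_bochner_integral_Gamma_scaled:
  fixes p z :: real
  assumes p: "p > 0" and z: "z > 0"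
  shows "has_bochner_integral lborel (\<lambda>t. indicator {0<..} t * (t powr (p - 1) * exp (- (t * z)))) (Gamma p / z powr p)"
proof -
  let ?f = "\<lambda>t::real. indicator {0<..} t * (t powr (p - 1) * exp (- t))"
  have "((\<lambda>t. t powr (p - 1) / exp t) has_integral Gamma p) {0..}" by (rule Gamma_integral_real[OF p])
  then have "((\<lambda>t. if t \<in> {0..} then t powr (p - 1) / exp t else 0) has_integral Gamma p) UNIV"
    by (simp only: has_integral_restrict_UNIV)
  also have "(\<lambda>t. if t \<in> {0..} then t powr (p - 1) / exp t else 0) = ?f"
    by (auto simp: fun_eq_iff indicator_def exp_minus field_simps)
  finally have "(?f has_integral Gamma p) UNIV" .
  then have nn: "(\<integral>\<^sup>+ t. ennreal (?f t) \<partial>lborel) = ennreal (Gamma p)"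
    using p by (intro nn_integral_has_integral_lborel) (auto simp: indicator_def)
  have "has_bochner_integral lborel ?f (Gamma p)"
    using p nn by (intro has_bochner_integral_nn_integral) (auto simp: Gamma_real_pos less_imp_le)
  then have "has_bochner_integral lborel (\<lambda>t. ?f (0 + z * t)) (Gamma p /\<^sub>R \<bar>z\<bar>)"
    using z by (subst (asm) lborel_has_bochner_integral_real_affine_iff[of z _ _ 0]) auto
  then have "has_bochner_integral lborel (\<lambda>t. z powr (1 - p) * ?f (0 + z * t)) (z powr (1 - p) * (Gamma p /\<^sub>R \<bar>z\<bar>))"
    by (rule has_bochner_integral_mult_right)
  moreover have "z powr (1 - p) * ?f (0 + z * t) = indicator {0<..} t * (t powr (p - 1) * exp (- (t * z)))" for t
  proof (cases "t > 0")
    case True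
    have "z powr (1 - p) * z powr (p - 1) = 1" using z by (simp add: powr_add[symmetric])
    then show ?thesis using True z by (simp add: powr_mult mult_ac)
  qed (use z in \<open>auto simp: indicator_def zero_less_mult_iff\<close>)
  moreover have "z powr (1 - p) * (Gamma p /\<^sub>R \<bar>z\<bar>) = Gamma p / z powr p"
    using z by (simp add: powr_diff field_simps)
  ultimately show ?thesis by simp
qed

text \<open>The kernel \<open>(x + y)\<^sup>-\<^sup>p\<close> is positive definite on the half line, being a superposition of the
  products \<open>exp (- t x) exp (- t y)\<close>.\<close>
lemma half_line_kernel_nonneg:
  fixes d :: "real \<Rightarrow> real"
  assumes p: "p > 0" and d [measurable]: "d \<in> borel_measurable borel"
    and int: "integrable lborel (\<lambda>z::real \<times> real. indicator ({0<..} \<times> {0<..}) z * (d (fst z) * d (snd z) / (fst z + snd z) powr p))"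
  shows "0 \<le> (LBINT z. indicator ({0<..} \<times> {0<..}) z * (d (fst z) * d (snd z) / (fst z + snd z) powr p))"
proof -
  let ?Q = "{0<..} \<times> {0<..} :: (real \<times> real) set"
  have [measurable]: "?Q \<in> sets borel" by (intro borel_open open_Times) auto
  define h where "h z t = indicator ?Q z * (d (fst z) * d (snd z)) *
     (indicator {0<..} t * (t powr (p - 1) * exp (- (t * (fst z + snd z)))))" for z :: "real \<times> real" and t :: real
  define D where "D z = indicator ?Q z * (d (fst z) * d (snd z) / (fst z + snd z) powr p)" for z :: "real \<times> real"
  have \<Gamma>: "Gamma p > 0" using p by (simp add: Gamma_real_pos)
  have [measurable]: "(\<lambda>(z, t). h z t) \<in> borel_measurable (borel \<Otimes>\<^sub>M borel)"
    unfolding h_def by (simp add: borel_prod[symmetric], measurable)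
  have inner: "has_bochner_integral lborel (h z) (Gamma p * D z)" for z
  proof (cases "z \<in> ?Q")
    case True
    then have pos: "fst z + snd z > 0" by auto
    have "has_bochner_integral lborel (h z) (indicator ?Q z * (d (fst z) * d (snd z)) * (Gamma p / (fst z + snd z) powr p))"
      unfolding h_def [abs_def] by (intro has_bochner_integral_mult_right has_bochner_integral_Gamma_scaled p pos)
    then show ?thesis by (simp add: D_def mult_ac)
  next
    case False
    then show ?thesis by (simp add: h_def [abs_def] D_def has_bochner_integral_zero)
  qed
  have inner_abs: "(LBINT t. norm (h z t)) = Gamma p * norm (D z)" for z
  proof (cases "z \<in> ?Q")
    case True
    then have pos: "fst z + snd z > 0" by auto
    have "(LBINT t. norm (h z t)) = (LBINT t. \<bar>d (fst z) * d (snd z)\<bar> * (indicator {0<..} t * (t powr (p - 1) * exp (- (t * (fst z + snd z))))))"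
      using True by (intro Bochner_Integration.integral_cong) (auto simp: h_def abs_mult)
    also have "\<dots> = \<bar>d (fst z) * d (snd z)\<bar> * (Gamma p / (fst z + snd z) powr p)"
      by (simp only: integral_mult_right_zero has_bochner_integral_integral_eq[OF has_bochner_integral_Gamma_scaled[OF p pos]])
    finally show ?thesis using True by (simp add: D_def abs_mult)
  qed (simp add: h_def D_def)
  \<comment> \<open>The exponentials are nonnegative, so the absolute inner integrals are
    \<open>Gamma p * norm (D z)\<close>, and Fubini rests on the assumed integrability
    alone.\<close>
  have hint: "integrable (lborel \<Otimes>\<^sub>M lborel) (\<lambda>(z, t). h z t)"
  proof (rule lborel_pair.Fubini_integrable)
    show "integrable lborel (\<lambda>z. \<integral>t. norm (case (z, t) of (z, t) \<Rightarrow> h z t) \<partial>lborel)"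
      using integrable_norm[OF int] by (simp only: prod.case inner_abs D_def[symmetric]) (rule integrable_mult_right)
    show "AE z in lborel. integrable lborel (\<lambda>t. case (z, t) of (z, t) \<Rightarrow> h z t)"
      using inner by (auto simp: has_bochner_integral_iff)
  qed (simp add: measurable_lborel1)
  have "Gamma p * (LBINT z. D z) = (LBINT z. \<integral>t. h z t \<partial>lborel)"
    by (simp add: has_bochner_integral_integral_eq[OF inner])
  also have "\<dots> = (LBINT t. \<integral>z. h z t \<partial>lborel)"
    using lborel_pair.Fubini_integral[OF hint] by simp
  also have "\<dots> \<ge> 0"
  proof (rule Bochner_Integration.integral_nonneg)
    fix t :: real
    define e where "e x = indicator {0<..} x * (d x * exp (- (t * x)))" for x
    have h: "h z t = indicator {0<..} t * t powr (p - 1) * (e (fst z) * e (snd z))" for z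
      by (auto simp: h_def e_def indicator_def mem_Times_iff exp_add[symmetric] distrib_left)
    show "0 \<le> (LBINT z. h z t)"
    \<comment> \<open>For fixed \<open>t\<close> the integrand is a product in the two variables, so
      its integral is a square. If it is not integrable, the integral is 0 by convention and the
      inequality holds as well.\<close>
    proof (cases "integrable lborel (\<lambda>z::real \<times> real. e (fst z) * e (snd z))")
      case True
      then have "integrable (lborel \<Otimes>\<^sub>M lborel) (\<lambda>(x, y). e x * e y)" by (simp add: lborel_prod case_prod_unfold)
      from lborel_pair.integral_fst[OF this]
      have "(LBINT z. e (fst z) * e (snd z)) = (LBINT x. e x) * (LBINT x. e x)"
        by (simp add: lborel_prod case_prod_unfold)
      then show ?thesis by (simp add: h)
    next
      case False
      then show ?thesis by (simp add: h not_integrable_integral_eq)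
    qed
  qed
  finally show ?thesis using \<Gamma> by (simp add: zero_le_mult_iff D_def)
qed

section \<open>Folding integrals at a point\<close>

lemma nn_integral_fold:
  fixes f :: "real \<Rightarrow> ennreal"
  assumes [measurable]: "f \<in> borel_measurable borel"
  shows "(\<integral>\<^sup>+ x. f x \<partial>lborel) = (\<integral>\<^sup>+ x. (f (a + x) + f (a - x)) * indicator {0<..} x \<partial>lborel)"
proof -
  have "(\<integral>\<^sup>+ x. f x \<partial>lborel) = (\<integral>\<^sup>+ x. f (a + x) \<partial>lborel)"
    using nn_integral_real_affine[of f 1 a] by simp
  also have "\<dots> = (\<integral>\<^sup>+ x. f (a + x) * indicator {0<..} x + f (a + x) * indicator {..<0} x \<partial>lborel)"
  proof (rule nn_integral_cong_AE)
    have "AE x in lborel. x \<noteq> (0::real)" by (rule AE_lborel_singleton)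
    then show "AE x in lborel. f (a + x) = f (a + x) * indicator {0<..} x + f (a + x) * indicator {..<0} x"
      by (rule eventually_mono) (auto simp: indicator_def)
  qed
  also have "\<dots> = (\<integral>\<^sup>+ x. f (a + x) * indicator {0<..} x \<partial>lborel) + (\<integral>\<^sup>+ x. f (a + x) * indicator {..<0} x \<partial>lborel)"
    by (rule nn_integral_add) measurable
  also have "(\<integral>\<^sup>+ x. f (a + x) * indicator {..<0} x \<partial>lborel) = (\<integral>\<^sup>+ x. f (a - x) * indicator {0<..} x \<partial>lborel)"
    by (subst nn_integral_real_affine[of _ "-1" 0]) (auto intro!: nn_integral_cong simp: indicator_def)
  finally show ?thesis by (simp add: nn_integral_add[symmetric] distrib_right)
qed

text \<open>The integrand of \<open>gag\<close> collected from the four quadrants around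
  \<open>(a, a)\<close>: pairs on the same side of \<open>a\<close> are at distance
  \<open>\<bar>x - y\<bar>\<close>, pairs on opposite sides at distance
  \<open>x + y\<close>.\<close>

definition fold_density :: "real \<Rightarrow> (real \<Rightarrow> real) \<Rightarrow> real \<Rightarrow> real \<times> real \<Rightarrow> real" where
  "fold_density p u a z = indicator ({0<..} \<times> {0<..}) z *
     (((u (a + fst z) - u (a + snd z))\<^sup>2 + (u (a - fst z) - u (a - snd z))\<^sup>2) / \<bar>fst z - snd z\<bar> powr p
     + ((u (a + fst z) - u (a - snd z))\<^sup>2 + (u (a - fst z) - u (a + snd z))\<^sup>2) / (fst z + snd z) powr p)"

lemma fold_density_measurable:
  assumes [measurable]: "u \<in> borel_measurable borel"
  shows "fold_density p u a \<in> borel_measurable (borel \<Otimes>\<^sub>M borel)"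
  unfolding fold_density_def [abs_def] by measurable

lemma gag_eq_fold_density:
  assumes u [measurable]: "u \<in> borel_measurable borel"
  shows "gag s u = (\<integral>\<^sup>+ z. ennreal (fold_density (1 + 2 * s) u a z) \<partial>(lborel \<Otimes>\<^sub>M lborel))"
proof -
  note [measurable] = fold_density_measurable[OF u]
  let ?k = "\<lambda>x y. ennreal ((u x - u y)\<^sup>2 / \<bar>x - y\<bar> powr (1 + 2 * s))"
  have "gag s u = (\<integral>\<^sup>+ x. \<integral>\<^sup>+ y. (?k x (a + y) + ?k x (a - y)) * indicator {0<..} y \<partial>lborel \<partial>lborel)"
    unfolding gag_iterated[OF u] by (intro nn_integral_cong nn_integral_fold) measurable
  also have "\<dots> = (\<integral>\<^sup>+ x. ((\<integral>\<^sup>+ y. (?k (a + x) (a + y) + ?k (a + x) (a - y)) * indicator {0<..} y \<partial>lborel) +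
      (\<integral>\<^sup>+ y. (?k (a - x) (a + y) + ?k (a - x) (a - y)) * indicator {0<..} y \<partial>lborel)) * indicator {0<..} x \<partial>lborel)"
    by (rule nn_integral_fold) measurable
  also have "\<dots> = (\<integral>\<^sup>+ x. \<integral>\<^sup>+ y. ennreal (fold_density (1 + 2 * s) u a (x, y)) \<partial>lborel \<partial>lborel)"
  proof (rule nn_integral_cong)
    fix x :: real
    show "((\<integral>\<^sup>+ y. (?k (a + x) (a + y) + ?k (a + x) (a - y)) * indicator {0<..} y \<partial>lborel) +
      (\<integral>\<^sup>+ y. (?k (a - x) (a + y) + ?k (a - x) (a - y)) * indicator {0<..} y \<partial>lborel)) * indicator {0<..} x
      = (\<integral>\<^sup>+ y. ennreal (fold_density (1 + 2 * s) u a (x, y)) \<partial>lborel)"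
    proof (cases "x > 0")
      case True
      have "((\<integral>\<^sup>+ y. (?k (a + x) (a + y) + ?k (a + x) (a - y)) * indicator {0<..} y \<partial>lborel) +
        (\<integral>\<^sup>+ y. (?k (a - x) (a + y) + ?k (a - x) (a - y)) * indicator {0<..} y \<partial>lborel))
        = (\<integral>\<^sup>+ y. (?k (a + x) (a + y) + ?k (a + x) (a - y)) * indicator {0<..} y + (?k (a - x) (a + y) + ?k (a - x) (a - y)) * indicator {0<..} y \<partial>lborel)"
        by (rule nn_integral_add[symmetric]) measurable
      also have "\<dots> = (\<integral>\<^sup>+ y. ennreal (fold_density (1 + 2 * s) u a (x, y)) \<partial>lborel)"
      proof (rule nn_integral_cong)
        fix y :: real
        have "ennreal A + ennreal B + (ennreal C + ennreal D) = ennreal ((A + D) + (B + C))"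
          if "A \<ge> 0" "B \<ge> 0" "C \<ge> 0" "D \<ge> 0" for A B C D
          using that by (simp add: ennreal_plus[symmetric] algebra_simps del: ennreal_plus)
        then show "(?k (a + x) (a + y) + ?k (a + x) (a - y)) * indicator {0<..} y + (?k (a - x) (a + y) + ?k (a - x) (a - y)) * indicator {0<..} y
          = ennreal (fold_density (1 + 2 * s) u a (x, y))"
          using True by (auto simp: fold_density_def indicator_def add_divide_distrib abs_minus_commute algebra_simps)
      qed
      finally show ?thesis using True by simp
    qed (simp add: fold_density_def)
  qed
  also have "\<dots> = (\<integral>\<^sup>+ z. ennreal (fold_density (1 + 2 * s) u a z) \<partial>(lborel \<Otimes>\<^sub>M lborel))"
    by (subst lborel.nn_integral_fst[symmetric]) auto
  finally show ?thesis .
qed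

text \<open>Let \<open>l\<close>, \<open>r\<close> be the values at \<open>a - x\<close>,
  \<open>a + x\<close>, and \<open>l'\<close>, \<open>r'\<close> those for \<open>y\<close>. The
  same-side terms of the two reflections add up to exactly twice those of \<open>u\<close>. The
  opposite-side terms differ from twice those of \<open>u\<close> by
  \<open>- 4 * ((l - r) * (l' - r')) / (x + y) powr (1 + 2 * s)\<close>, whose integral has a sign
  by \<open>half_line_kernel_nonneg\<close>.\<close>

lemma gag_reflect:
  fixes u :: "real \<Rightarrow> real"
  assumes s: "0 < s" and u [measurable]: "u \<in> borel_measurable borel"
  shows "gag s (\<lambda>x. u (a - \<bar>x - a\<bar>)) + gag s (\<lambda>x. u (a + \<bar>x - a\<bar>)) \<le> 2 * gag s u"
proof (cases "gag s u = \<infinity>")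
  case False
  let ?p = "1 + 2 * s"
  let ?r1 = "\<lambda>x. u (a - \<bar>x - a\<bar>)" and ?r2 = "\<lambda>x. u (a + \<bar>x - a\<bar>)"
  let ?Q = "{0<..} \<times> {0<..} :: (real \<times> real) set"
  let ?M = "lborel \<Otimes>\<^sub>M lborel :: (real \<times> real) measure"
  define d where "d x = u (a - x) - u (a + x)" for x
  have [measurable]: "d \<in> borel_measurable borel" unfolding d_def [abs_def] by measurable
  define S where "S = fold_density ?p u a"
  define S1 where "S1 = fold_density ?p ?r1 a"
  define S2 where "S2 = fold_density ?p ?r2 a"
  define D where "D z = indicator ?Q z * (d (fst z) * d (snd z) / (fst z + snd z) powr ?p)" for z :: "real \<times> real"
  have [measurable]: "S \<in> borel_measurable ?M" "S1 \<in> borel_measurable ?M" "S2 \<in> borel_measurable ?M"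
    unfolding S_def S1_def S2_def
    by (simp_all add: fold_density_measurable measurable_cong_sets[OF sets_pair_measure_cong[OF sets_lborel sets_lborel] refl])
  have [measurable]: "D \<in> borel_measurable ?M" unfolding D_def [abs_def] by measurable
  have nn: "S z \<ge> 0" "S1 z \<ge> 0" "S2 z \<ge> 0" for z by (auto simp: S_def S1_def S2_def fold_density_def)
  have le: "c / (x + y) powr ?p \<le> c / \<bar>x - y\<bar> powr ?p" if "x > 0" "y > 0" "x \<noteq> y" "c \<ge> 0" for x y c :: real
    using that s by (intro divide_left_mono powr_mono2 mult_pos_pos) auto
  \<comment> \<open>Integrability has to precede the integrated identity. Since
    \<open>\<bar>x - y\<bar> \<le> x + y\<close>, the opposite-side terms of a reflection are
    dominated by same-side terms of \<open>u\<close>.\<close>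
  have bnd: "S1 z \<le> 4 * S z" "S2 z \<le> 4 * S z" for z
  proof -
    obtain x y where z: "z = (x, y)" by (cases z)
    have "S1 z \<le> 4 * S z \<and> S2 z \<le> 4 * S z"
    proof (cases "x > 0 \<and> y > 0")
      case True
      then have pos: "x > 0" "y > 0" by auto
      have nn': "0 \<le> (u (a + x) - u (a - y))\<^sup>2 / (x + y) powr ?p" "0 \<le> (u (a - x) - u (a + y))\<^sup>2 / (x + y) powr ?p"
        "0 \<le> (u (a + x) - u (a + y))\<^sup>2 / \<bar>x - y\<bar> powr ?p" "0 \<le> (u (a - x) - u (a - y))\<^sup>2 / \<bar>x - y\<bar> powr ?p"
        by auto
      show ?thesis
      proof (cases "x = y")
        case True
        then show ?thesis using pos nn' unfolding z S_def S1_def S2_def fold_density_def by simp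
      next
        case False
        then show ?thesis using pos nn' le[OF pos False, of "(u (a - x) - u (a - y))\<^sup>2"] le[OF pos False, of "(u (a + x) - u (a + y))\<^sup>2"]
          unfolding z S_def S1_def S2_def fold_density_def
          by (simp add: add_divide_distrib times_divide_eq_right[symmetric] del: times_divide_eq_right,
              intro conjI; use nn' in linarith)
      qed
    qed (auto simp: z S_def S1_def S2_def fold_density_def indicator_def)
    then show "S1 z \<le> 4 * S z" "S2 z \<le> 4 * S z" by auto
  qed
  have id: "S1 z + S2 z = 2 * S z - 4 * D z" for z
  proof -
    have "(l - l')\<^sup>2 + (l - l')\<^sup>2 + ((r - r')\<^sup>2 + (r - r')\<^sup>2) = 2 * ((r - l')\<^sup>2 + (l - r')\<^sup>2) - 4 * ((l - r) * (l' - r'))"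
      for l l' r r' :: real by (simp add: power2_eq_square algebra_simps)
    then have *: "((l - l')\<^sup>2 + (l - l')\<^sup>2) / k + ((r - r')\<^sup>2 + (r - r')\<^sup>2) / k = 2 * (((r - l')\<^sup>2 + (l - r')\<^sup>2) / k) - 4 * (((l - r) * (l' - r')) / k)"
      for l l' r r' k :: real by (metis (no_types, lifting) add_divide_distrib diff_divide_distrib times_divide_eq_right)
    obtain x y where z: "z = (x, y)" by (cases z)
    show ?thesis
    proof (cases "x > 0 \<and> y > 0")
      case True
      then show ?thesis unfolding z S_def S1_def S2_def fold_density_def D_def d_def
        using *[of "u (a - x)" "u (a - y)" "(x + y) powr ?p" "u (a + x)" "u (a + y)"]
        by (simp add: add_divide_distrib)
    qed (auto simp: z S_def S1_def S2_def fold_density_def D_def indicator_def)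
  qed
  have iS: "integrable ?M S"
  proof (rule integrableI_nonneg)
    show "(\<integral>\<^sup>+ z. ennreal (S z) \<partial>?M) < \<infinity>"
      using False gag_eq_fold_density[OF u, of s a] by (simp add: S_def less_top)
  qed (auto simp: nn)
  have i1: "integrable ?M S1" "integrable ?M S2"
    using iS nn bnd by (auto intro!: Bochner_Integration.integrable_bound[OF integrable_mult_right[OF iS, of 4]])
  \<comment> \<open>\<open>D\<close> has no sign, and its integrability is read off from the
    identity instead of being estimated.\<close>
  have iD: "integrable ?M D"
  proof -
    have "D = (\<lambda>z. (2 * S z - (S1 z + S2 z)) / 4)" using id by (auto simp: fun_eq_iff)
    then show ?thesis using iS i1 by simp
  qed
  have D0: "0 \<le> (\<integral>z. D z \<partial>?M)"
    using half_line_kernel_nonneg[of ?p d] s iD unfolding D_def [abs_def] lborel_prod by simp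
  have "gag s ?r1 + gag s ?r2 = (\<integral>\<^sup>+ z. ennreal (S1 z) \<partial>?M) + (\<integral>\<^sup>+ z. ennreal (S2 z) \<partial>?M)"
    unfolding S1_def S2_def by (subst (1 2) gag_eq_fold_density[where a=a]) simp_all
  also have "\<dots> = ennreal (\<integral>z. S1 z \<partial>?M) + ennreal (\<integral>z. S2 z \<partial>?M)"
    using i1 nn by (simp add: nn_integral_eq_integral)
  also have "\<dots> = ennreal ((\<integral>z. S1 z \<partial>?M) + (\<integral>z. S2 z \<partial>?M))"
    using nn by (simp add: Bochner_Integration.integral_nonneg)
  also have "(\<integral>z. S1 z \<partial>?M) + (\<integral>z. S2 z \<partial>?M) = (\<integral>z. 2 * S z - 4 * D z \<partial>?M)"
    using i1 by (simp add: id[symmetric])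
  also have "\<dots> = 2 * (\<integral>z. S z \<partial>?M) - 4 * (\<integral>z. D z \<partial>?M)"
    using iS iD by simp
  also have "ennreal \<dots> \<le> ennreal (2 * (\<integral>z. S z \<partial>?M))" using D0 by (intro ennreal_leI) simp
  also have "\<dots> = 2 * (\<integral>\<^sup>+ z. ennreal (S z) \<partial>?M)"
    using iS nn by (simp add: nn_integral_eq_integral ennreal_mult Bochner_Integration.integral_nonneg)
  also have "\<dots> = 2 * gag s u" by (simp add: S_def gag_eq_fold_density[OF u, of s a])
  finally show ?thesis .
qed (simp add: ennreal_mult_top)

section \<open>Decay at infinity\<close>

text \<open>On \<open>{x. norm (q x) \<ge> e/2}\<close> the integrand \<open>U (q x)\<close> is bounded below, and by
  uniform continuity each point with \<open>norm (q x) \<ge> e\<close> brings along an interval of fixed length.\<close>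
lemma tendsto_zero_at_top_of_integrable:
  fixes q :: "real \<Rightarrow> 'a::euclidean_space" and U :: "'a \<Rightarrow> real"
  assumes q: "uniformly_continuous_on UNIV q" and bd: "\<And>x. norm (q x) \<le> B"
    and U: "continuous_on UNIV U" "\<And>v. U v \<ge> 0" "\<And>v. v \<noteq> 0 \<Longrightarrow> U v > 0"
    and int: "integrable lborel (\<lambda>x. U (q x))"
  shows "(q \<longlongrightarrow> 0) at_top"
proof (rule tendstoI)
  fix e :: real assume e: "e > 0"
  obtain d where d: "d > 0" "\<And>x y. \<bar>y - x\<bar> < d \<Longrightarrow> norm (q y - q x) < e / 2"
    using q e unfolding uniformly_continuous_on_def dist_norm real_norm_def
    by (metis UNIV_I half_gt_zero)
  define A where "A = {v :: 'a. e / 2 \<le> norm v \<and> norm v \<le> B}"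
  have A: "compact A"
  proof -
    have "A = cball 0 B - ball 0 (e / 2)" by (auto simp: A_def dist_norm)
    then show ?thesis by (simp add: compact_diff)
  qed
  \<comment> \<open>The set \<open>A\<close> is empty if \<open>B < e / 2\<close>; any positive
    \<open>m\<close> then serves.\<close>
  obtain m where m: "m > 0" "\<And>v. v \<in> A \<Longrightarrow> m \<le> U v"
  proof (cases "A = {}")
    case False
    then obtain v where v: "v \<in> A" "\<And>w. w \<in> A \<Longrightarrow> U v \<le> U w"
      using continuous_attains_inf[OF A False continuous_on_subset[OF U(1)]] by blast
    have "v \<noteq> 0" using v(1) e by (auto simp: A_def)
    then show thesis using that[of "U v"] U(3) v(2) by blast
  qed (use that[of 1] in auto)
  have "(\<lambda>n. \<integral>x. indicator {real n..} x * U (q x) \<partial>lborel) \<longlonglongrightarrow> (\<integral>x. 0 \<partial>(lborel :: real measure))"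
  proof (rule integral_dominated_convergence[where w="\<lambda>x. U (q x)"])
    show "AE x in lborel. (\<lambda>n. indicator {real n..} x * U (q x)) \<longlonglongrightarrow> 0"
    proof (rule AE_I2)
      fix x :: real
      obtain N where "x < real N" using reals_Archimedean2 by blast
      then have "\<forall>\<^sub>F n in sequentially. x < real n" by (intro eventually_sequentiallyI[of N]) auto
      then have "\<forall>\<^sub>F n in sequentially. indicator {real n..} x * U (q x) = 0" by (rule eventually_mono) auto
      then show "(\<lambda>n. indicator {real n..} x * U (q x)) \<longlonglongrightarrow> 0" by (rule tendsto_eventually)
    qed
  qed (use int borel_measurable_integrable[OF int] U(2) in \<open>auto simp: indicator_def\<close>)
  then have "\<forall>\<^sub>F n in sequentially. (LBINT x. indicator {real n..} x * U (q x)) < m * d"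
    using m(1) d(1) by (intro order_tendstoD(2)) auto
  then obtain n where n: "(LBINT x. indicator {real n..} x * U (q x)) < m * d"
    by (auto simp: eventually_sequentially)
  have "norm (q x) < e" if x: "x \<ge> real n" for x
  proof (rule ccontr)
    assume "\<not> norm (q x) < e"
    then have far: "e \<le> norm (q x)" by simp
    have low: "m \<le> U (q y)" if "y \<in> {x..<x + d}" for y
    proof (rule m(2))
      have "norm (q y - q x) < e / 2" using that by (intro d(2)) auto
      then have "e / 2 \<le> norm (q y)" using far norm_triangle_ineq2[of "q x" "q y"] by (simp add: norm_minus_commute)
      then show "q y \<in> A" using bd by (simp add: A_def)
    qed
    have "m * d = (LBINT y. indicator {x..<x + d} y * m)" using d by simp
    also have "\<dots> \<le> (LBINT y. indicator {real n..} y * U (q y))"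
    proof (rule integral_mono)
      show "integrable lborel (\<lambda>y. indicator {x..<x + d} y * m)" using d by simp
      show "integrable lborel (\<lambda>y. indicator {real n..} y * U (q y))"
        using integrable_real_mult_indicator[OF _ int, of "{real n..}"] by (simp add: mult.commute)
      show "indicator {x..<x + d} y * m \<le> indicator {real n..} y * U (q y)" for y
        using low[of y] x U(2) by (auto simp: indicator_def)
    qed
    finally show False using n by simp
  qed
  then show "\<forall>\<^sub>F x in at_top. dist (q x) 0 < e"
    by (auto simp: eventually_at_top_linorder dist_norm)
qed

lemma tendsto_zero_of_integrable:
  fixes q :: "real \<Rightarrow> 'a::euclidean_space" and U :: "'a \<Rightarrow> real"
  assumes q: "uniformly_continuous_on UNIV q" and bd: "\<And>x. norm (q x) \<le> B"
    and U: "continuous_on UNIV U" "\<And>v. U v \<ge> 0" "\<And>v. v \<noteq> 0 \<Longrightarrow> U v > 0"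
    and int: "integrable lborel (\<lambda>x. U (q x))"
  shows "(q \<longlongrightarrow> 0) at_top" and "(q \<longlongrightarrow> 0) at_bot"
proof -
  show "(q \<longlongrightarrow> 0) at_top" by (rule tendsto_zero_at_top_of_integrable[OF assms])
  have "uniformly_continuous_on UNIV (\<lambda>x. q (- x))"
    unfolding uniformly_continuous_on_def
  proof (intro allI impI)
    fix e :: real assume "e > 0"
    then obtain d where d: "d > 0" "\<And>x y. dist y x < d \<Longrightarrow> dist (q y) (q x) < e"
      using q unfolding uniformly_continuous_on_def by (metis UNIV_I)
    then show "\<exists>d>0. \<forall>x\<in>UNIV. \<forall>x'\<in>UNIV. dist x' x < d \<longrightarrow> dist (q (- x')) (q (- x)) < e"
      by (intro exI[of _ d]) (auto simp: dist_real_def abs_minus_commute)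
  qed
  moreover have "integrable lborel (\<lambda>x. U (q (- x)))"
    using lborel_integrable_real_affine[OF int, of "-1" 0] by simp
  ultimately have "((\<lambda>x. q (- x)) \<longlongrightarrow> 0) at_top"
    using tendsto_zero_at_top_of_integrable[of "\<lambda>x. q (- x)" B U] bd U by blast
  then show "(q \<longlongrightarrow> 0) at_bot" by (simp add: filterlim_at_bot_mirror)
qed

section \<open>Euler-Lagrange equation\<close>

definition cform :: "real \<Rightarrow> (real \<Rightarrow> real) \<Rightarrow> (real \<Rightarrow> real) \<Rightarrow> real" where
  "cform s u v = (\<integral>z. (u (fst z) - u (snd z)) * (v (fst z) - v (snd z)) / \<bar>fst z - snd z\<bar> powr (1 + 2 * s) \<partial>(lborel \<Otimes>\<^sub>M lborel))"

text \<open>Increments satisfy \<open>\<bar>A * B\<bar> \<le> A\<^sup>2 + B\<^sup>2\<close>, so the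
  two seminorms dominate the mixed integrand.\<close>

lemma cform_integrable:
  assumes u: "continuous_on UNIV u" "gag s u < \<infinity>" and v: "continuous_on UNIV v" "gag s v < \<infinity>"
  shows "integrable (lborel \<Otimes>\<^sub>M lborel) (\<lambda>z. (u (fst z) - u (snd z)) * (v (fst z) - v (snd z)) / \<bar>fst z - snd z\<bar> powr (1 + 2 * s))"
proof -
  have [measurable]: "u \<in> borel_measurable borel" "v \<in> borel_measurable borel"
    using u v by (auto intro: borel_measurable_continuous_onI)
  have sq: "integrable (lborel \<Otimes>\<^sub>M lborel) (\<lambda>z. (w (fst z) - w (snd z))\<^sup>2 / \<bar>fst z - snd z\<bar> powr (1 + 2 * s))"
    if [measurable]: "w \<in> borel_measurable borel" and "gag s w < \<infinity>" for w :: "real \<Rightarrow> real"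
    using that(2) unfolding gag_def by (intro integrableI_nonneg) auto
  show ?thesis
  proof (rule Bochner_Integration.integrable_bound[OF Bochner_Integration.integrable_add[OF sq[of u] sq[of v]]])
    show "AE z in lborel \<Otimes>\<^sub>M lborel. norm ((u (fst z) - u (snd z)) * (v (fst z) - v (snd z)) / \<bar>fst z - snd z\<bar> powr (1 + 2 * s))
        \<le> norm ((u (fst z) - u (snd z))\<^sup>2 / \<bar>fst z - snd z\<bar> powr (1 + 2 * s) + (v (fst z) - v (snd z))\<^sup>2 / \<bar>fst z - snd z\<bar> powr (1 + 2 * s))"
    proof (rule AE_I2)
      fix z :: "real \<times> real"
      have "\<bar>A * B\<bar> \<le> A\<^sup>2 + B\<^sup>2" for A B :: real
      proof -
        have "0 \<le> (\<bar>A\<bar> - \<bar>B\<bar>)\<^sup>2" by simp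
        then have "2 * \<bar>A * B\<bar> \<le> A\<^sup>2 + B\<^sup>2" by (simp add: power2_diff abs_mult)
        then show ?thesis by simp
      qed
      then show "norm ((u (fst z) - u (snd z)) * (v (fst z) - v (snd z)) / \<bar>fst z - snd z\<bar> powr (1 + 2 * s))
        \<le> norm ((u (fst z) - u (snd z))\<^sup>2 / \<bar>fst z - snd z\<bar> powr (1 + 2 * s) + (v (fst z) - v (snd z))\<^sup>2 / \<bar>fst z - snd z\<bar> powr (1 + 2 * s))"
        by (auto simp: add_divide_distrib[symmetric] abs_mult[symmetric] intro!: divide_right_mono)
    qed
  qed (use u v in auto)
qed

lemma gag_eq_cform:
  assumes "continuous_on UNIV u" "gag s u < \<infinity>"
  shows "gag s u = ennreal (cform s u u)" and "cform s u u \<ge> 0"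
proof -
  show "gag s u = ennreal (cform s u u)"
    using cform_integrable[OF assms assms] unfolding gag_def cform_def power2_eq_square
    by (intro nn_integral_eq_integral) auto
  show "cform s u u \<ge> 0" unfolding cform_def by (intro Bochner_Integration.integral_nonneg) auto
qed

lemma cform_add_scale:
  assumes "continuous_on UNIV u" "gag s u < \<infinity>" "continuous_on UNIV v" "gag s v < \<infinity>" "continuous_on UNIV w" "gag s w < \<infinity>"
  shows "cform s u (\<lambda>x. v x + c * w x) = cform s u v + c * cform s u w"
proof -
  have "cform s u (\<lambda>x. v x + c * w x) = (\<integral>z. (u (fst z) - u (snd z)) * (v (fst z) - v (snd z)) / \<bar>fst z - snd z\<bar> powr (1 + 2 * s)
      + c * ((u (fst z) - u (snd z)) * (w (fst z) - w (snd z)) / \<bar>fst z - snd z\<bar> powr (1 + 2 * s)) \<partial>(lborel \<Otimes>\<^sub>M lborel))"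
    unfolding cform_def by (intro Bochner_Integration.integral_cong) (auto simp: add_divide_distrib[symmetric] algebra_simps)
  also have "\<dots> = cform s u v + c * cform s u w"
    unfolding cform_def
    using cform_integrable[OF assms(1-4)] cform_integrable[OF assms(1,2,5,6)] by (simp del: times_divide_eq_right)
  finally show ?thesis .
qed

lemma cform_commute: "cform s u v = cform s v u"
  by (simp add: cform_def mult.commute)

lemma gag_add_scale_finite:
  assumes "continuous_on UNIV u" "gag s u < \<infinity>" "continuous_on UNIV v" "gag s v < \<infinity>"
  shows "gag s (\<lambda>x. u x + c * v x) < \<infinity>"
proof -
  have [measurable]: "u \<in> borel_measurable borel" "v \<in> borel_measurable borel"
    using assms by (auto intro: borel_measurable_continuous_onI)
  have "gag s (\<lambda>x. u x + c * v x) \<le> (\<integral>\<^sup>+ z. ennreal 2 * ennreal ((u (fst z) - u (snd z))\<^sup>2 / \<bar>fst z - snd z\<bar> powr (1 + 2 * s))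
    + ennreal (2 * c\<^sup>2) * ennreal ((v (fst z) - v (snd z))\<^sup>2 / \<bar>fst z - snd z\<bar> powr (1 + 2 * s)) \<partial>(lborel \<Otimes>\<^sub>M lborel))"
    unfolding gag_def
  proof (rule nn_integral_mono)
    fix z :: "real \<times> real"
    have "(A + c * B)\<^sup>2 \<le> 2 * A\<^sup>2 + 2 * c\<^sup>2 * B\<^sup>2" for A B :: real
    proof -
      have "0 \<le> (A - c * B)\<^sup>2" by simp
      then show ?thesis by (simp add: power2_eq_square algebra_simps)
    qed
    from this[of "u (fst z) - u (snd z)" "v (fst z) - v (snd z)"]
    have "(u (fst z) + c * v (fst z) - (u (snd z) + c * v (snd z)))\<^sup>2 \<le> 2 * (u (fst z) - u (snd z))\<^sup>2 + 2 * c\<^sup>2 * (v (fst z) - v (snd z))\<^sup>2"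
      by (simp add: algebra_simps)
    then have "(u (fst z) + c * v (fst z) - (u (snd z) + c * v (snd z)))\<^sup>2 / \<bar>fst z - snd z\<bar> powr (1 + 2 * s)
      \<le> (2 * (u (fst z) - u (snd z))\<^sup>2 + 2 * c\<^sup>2 * (v (fst z) - v (snd z))\<^sup>2) / \<bar>fst z - snd z\<bar> powr (1 + 2 * s)"
      by (intro divide_right_mono) auto
    also have "\<dots> = 2 * ((u (fst z) - u (snd z))\<^sup>2 / \<bar>fst z - snd z\<bar> powr (1 + 2 * s)) + 2 * c\<^sup>2 * ((v (fst z) - v (snd z))\<^sup>2 / \<bar>fst z - snd z\<bar> powr (1 + 2 * s))"
      by (simp add: add_divide_distrib)
    finally show "ennreal ((u (fst z) + c * v (fst z) - (u (snd z) + c * v (snd z)))\<^sup>2 / \<bar>fst z - snd z\<bar> powr (1 + 2 * s))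
      \<le> ennreal 2 * ennreal ((u (fst z) - u (snd z))\<^sup>2 / \<bar>fst z - snd z\<bar> powr (1 + 2 * s))
    + ennreal (2 * c\<^sup>2) * ennreal ((v (fst z) - v (snd z))\<^sup>2 / \<bar>fst z - snd z\<bar> powr (1 + 2 * s))"
      by (subst (1 2) ennreal_mult[symmetric]) (auto simp del: ennreal_plus simp: ennreal_plus[symmetric] intro!: ennreal_leI)
  qed
  also have "\<dots> = ennreal 2 * gag s u + ennreal (2 * c\<^sup>2) * gag s v"
    unfolding gag_def by (simp add: nn_integral_add nn_integral_cmult)
  also have "\<dots> < \<infinity>" using assms by (simp add: ennreal_mult_less_top)
  finally show ?thesis .
qed

section \<open>Continuously differentiable potentials\<close>

lemma GDERIV_grad: "C1 V \<Longrightarrow> GDERIV V x :> grad V x"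
  unfolding C1_def using grad_eqI by metis

lemma C1_continuous: "C1 V \<Longrightarrow> continuous_on UNIV V"
  by (meson GDERIV_grad gderiv_def has_derivative_continuous continuous_at_imp_continuous_on)

lemma C1_grad_bounded:
  fixes V :: "'a::euclidean_space \<Rightarrow> real"
  assumes V: "C1 V"
  shows "\<exists>M. \<forall>x. norm x \<le> B \<longrightarrow> norm (grad V x) \<le> M"
proof -
  have "compact (grad V ` cball 0 B)"
    using V by (intro compact_continuous_image) (auto simp: C1_def intro: continuous_on_subset)
  then obtain M where "\<And>x. x \<in> cball 0 B \<Longrightarrow> norm (grad V x) \<le> M"
    by (metis bounded_iff compact_imp_bounded imageI)
  then show ?thesis by (intro exI[of _ M]) simp
qed

lemma C1_lipschitz_on_ball:
  fixes V :: "'a::euclidean_space \<Rightarrow> real"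
  assumes V: "C1 V"
  obtains M where "M \<ge> 0" "\<And>u v. norm u \<le> B \<Longrightarrow> norm v \<le> B \<Longrightarrow> \<bar>V u - V v\<bar> \<le> M * norm (u - v)"
proof -
  obtain M where M: "\<And>x. norm x \<le> B \<Longrightarrow> norm (grad V x) \<le> M"
    using C1_grad_bounded[OF V] by blast
  have "norm (V u - V v) \<le> max M 0 * norm (u - v)" if "norm u \<le> B" "norm v \<le> B" for u v
  proof (rule differentiable_bound[of "cball 0 B" V "\<lambda>x h. h \<bullet> grad V x"])
    fix x :: 'a assume x: "x \<in> cball 0 B"
    show "(V has_derivative (\<lambda>h. h \<bullet> grad V x)) (at x within cball 0 B)"
      using GDERIV_grad[OF V, of x] unfolding gderiv_def by (rule has_derivative_at_withinI)
    show "onorm (\<lambda>h. h \<bullet> grad V x) \<le> max M 0"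
    proof (rule onorm_le)
      fix h :: 'a
      have "norm (h \<bullet> grad V x) \<le> norm h * norm (grad V x)" by (simp add: Cauchy_Schwarz_ineq2)
      also have "\<dots> \<le> norm h * max M 0" using M[of x] x by (intro mult_left_mono) auto
      finally show "norm (h \<bullet> grad V x) \<le> max M 0 * norm h" by (simp add: mult.commute)
    qed
  qed (use that in auto)
  then show thesis by (intro that[of "max M 0"]) auto
qed

text \<open>The test class of the first variation, wide enough for derivatives of heat kernels.
  Boundedness keeps \<open>q + t \<phi>\<close> in a ball on which \<open>V\<close> is Lipschitz,
  integrability dominates the difference quotients of \<open>V\<close>, and the finite seminorm
  keeps the varied curve in the energy space.\<close>

definition admissible :: "real \<Rightarrow> (real \<Rightarrow> real) \<Rightarrow> bool" where
  "admissible s \<phi> \<longleftrightarrow> continuous_on UNIV \<phi> \<and> bounded (range \<phi>) \<and> integrable lborel \<phi> \<and> gag s \<phi> < \<infinity>"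

lemma admissible_add_scale:
  assumes "admissible s u" "admissible s v"
  shows "admissible s (\<lambda>x. u x + c * v x)"
proof -
  obtain A B where "\<And>x. \<bar>u x\<bar> \<le> A" "\<And>x. \<bar>v x\<bar> \<le> B"
    using assms by (auto simp: admissible_def bounded_iff)
  then have "\<bar>u x + c * v x\<bar> \<le> A + \<bar>c\<bar> * B" for x
    by (intro order_trans[OF abs_triangle_ineq] add_mono) (auto simp: abs_mult mult_left_mono)
  then have "bounded (range (\<lambda>x. u x + c * v x))" by (auto simp: bounded_iff)
  moreover have "continuous_on UNIV (\<lambda>x. u x + c * v x)"
    using assms by (auto simp: admissible_def intro!: continuous_intros)
  ultimately show ?thesis using assms gag_add_scale_finite[of u s v c] by (simp add: admissible_def)
qed

lemma admissible_of_decay: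
  fixes \<phi> :: "real \<Rightarrow> real"
  assumes s: "0 < s" "s < 1"
    and der: "\<And>x. (\<phi> has_real_derivative \<phi>' x) (at x)"
    and b0: "\<And>x. \<bar>\<phi> x\<bar> \<le> A / (1 + (x - b)\<^sup>2)"
    and b1: "\<And>x. \<bar>\<phi>' x\<bar> \<le> A / (1 + (x - b)\<^sup>2)"
  shows "admissible s \<phi>"
proof -
  have c: "continuous_on UNIV \<phi>"
    using der by (meson DERIV_isCont continuous_at_imp_continuous_on)
  have A: "A \<ge> 0" using b0[of b] by simp
  have "\<bar>\<phi> x\<bar> \<le> A" for x
  proof -
    have "A / (1 + (x - b)\<^sup>2) \<le> A / 1" using A by (intro divide_left_mono) (auto simp: add_pos_nonneg)
    then show ?thesis using b0[of x] by simp
  qed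
  then have "bounded (range \<phi>)" by (auto simp: bounded_iff)
  moreover have "integrable lborel \<phi>"
  proof (rule Bochner_Integration.integrable_bound)
    have "integrable lborel (\<lambda>x. 1 / (1 + (- b + 1 * x)\<^sup>2))"
      by (rule lborel_integrable_real_affine[OF integrable_inverse_one_plus_square]) simp
    then have "integrable lborel (\<lambda>x. 1 / (1 + (x - b)\<^sup>2))" by simp
    then show "integrable lborel (\<lambda>x. A * (1 / (1 + (x - b)\<^sup>2)))" by (rule integrable_mult_right)
    show "AE x in lborel. norm (\<phi> x) \<le> norm (A * (1 / (1 + (x - b)\<^sup>2)))"
      using b0 A by (intro AE_I2) (auto simp: abs_mult)
  qed (use c in \<open>simp add: borel_measurable_continuous_onI\<close>)
  moreover have "gag s \<phi> < \<infinity>"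
    using le_less_trans[OF gag_le_of_decay[OF s der b0 b1]] by simp
  ultimately show ?thesis using c by (simp add: admissible_def)
qed

text \<open>This profile has the value \<open>c\<close> at \<open>b\<close>, and its derivative is
  no larger than \<open>\<bar>c\<bar>\<close> times the weight because
  \<open>2 * \<bar>y\<bar> \<le> 1 + y\<^sup>2\<close>. It serves as the correction at
  \<open>a\<close> in the Euler-Lagrange equation and as the shape of a competitor.\<close>

lemma bump_decay:
  fixes b :: real
  shows "((\<lambda>x. c / (1 + (x - b)\<^sup>2)) has_real_derivative (- c * (2 * (x - b)) / (1 + (x - b)\<^sup>2)\<^sup>2)) (at x)"
    and "\<bar>- c * (2 * (x - b)) / (1 + (x - b)\<^sup>2)\<^sup>2\<bar> \<le> \<bar>c\<bar> / (1 + (x - b)\<^sup>2)"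
proof -
  have pos: "1 + (x - b)\<^sup>2 > 0" by (simp add: add_pos_nonneg)
  show "((\<lambda>x. c / (1 + (x - b)\<^sup>2)) has_real_derivative (- c * (2 * (x - b)) / (1 + (x - b)\<^sup>2)\<^sup>2)) (at x)"
    using pos by (auto intro!: derivative_eq_intros simp: power2_eq_square)
  have "0 \<le> (\<bar>x - b\<bar> - 1)\<^sup>2" by simp
  then have "2 * \<bar>x - b\<bar> \<le> 1 + (x - b)\<^sup>2" by (simp add: power2_diff)
  then have "\<bar>c\<bar> * (2 * \<bar>x - b\<bar>) \<le> \<bar>c\<bar> * (1 + (x - b)\<^sup>2)" by (intro mult_left_mono) auto
  then have "\<bar>c\<bar> * (2 * \<bar>x - b\<bar>) / (1 + (x - b)\<^sup>2)\<^sup>2 \<le> \<bar>c\<bar> * (1 + (x - b)\<^sup>2) / (1 + (x - b)\<^sup>2)\<^sup>2"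
    by (intro divide_right_mono) auto
  also have "\<dots> = \<bar>c\<bar> / (1 + (x - b)\<^sup>2)" using pos by (simp add: power2_eq_square)
  finally show "\<bar>- c * (2 * (x - b)) / (1 + (x - b)\<^sup>2)\<^sup>2\<bar> \<le> \<bar>c\<bar> / (1 + (x - b)\<^sup>2)"
    unfolding abs_divide abs_mult by simp
qed

text \<open>Presents the energy by a real number, so that the energies of \<open>q\<close> and of
  its variations can be subtracted.\<close>

lemma nrg_eq_ennreal:
  fixes q :: "real \<Rightarrow> real ^ 'n"
  assumes s: "0 < s" "s < 1" and q: "continuous_on UNIV q" and g: "\<And>i. gag s (\<lambda>x. q x $ i) < \<infinity>"
    and V: "\<And>v. V v \<le> 0" and i: "integrable lborel (\<lambda>x. V (q x))"
  shows "nrg s V q = ennreal (c_s s / 2 * (\<Sum>i\<in>UNIV. cform s (\<lambda>x. q x $ i) (\<lambda>x. q x $ i)) - (LBINT x. V (q x)))"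
proof -
  have c: "c_s s > 0" by (rule c_s_pos[OF s])
  have qi: "continuous_on UNIV (\<lambda>x. q x $ i)" for i using q by (intro continuous_intros)
  note cf = gag_eq_cform[OF qi g]
  let ?S = "\<Sum>i\<in>UNIV. cform s (\<lambda>x. q x $ i) (\<lambda>x. q x $ i)"
  have "gagliardo_sq s q = ennreal (c_s s) * ennreal ?S"
    unfolding gagliardo_sq_eq_gag[OF q] cf(1) by (simp add: sum_ennreal cf(2))
  then have 1: "gagliardo_sq s q / 2 = ennreal (c_s s / 2 * ?S)"
    using c by (simp add: ennreal_mult[symmetric] divide_ennreal[of _ 2, simplified] cf(2) sum_nonneg)
  have "(\<integral>\<^sup>+ x. ennreal (- V (q x)) \<partial>lborel) = ennreal (LBINT x. - V (q x))"
    using i V by (intro nn_integral_eq_integral) auto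
  then have 2: "(\<integral>\<^sup>+ x. ennreal (- V (q x)) \<partial>lborel) = ennreal (- (LBINT x. V (q x)))" by simp
  have "(LBINT x. V (q x)) \<le> 0"
    using Bochner_Integration.integral_nonneg[of lborel "\<lambda>x. - V (q x)"] V by simp
  then show ?thesis unfolding nrg_def 1 2 using c
    by (simp add: ennreal_plus[symmetric] cf(2) sum_nonneg del: ennreal_plus)
qed

text \<open>Only \<open>t > 0\<close> is used, which gives an inequality; \<open>- \<phi>\<close>
  then gives the opposite one. The competitor moves the single component \<open>i\<close> by
  \<open>t * \<phi>\<close>, and \<open>\<phi> a = 0\<close> preserves the constraint.\<close>

lemma first_variation_nonneg:
  fixes V :: "real ^ 'n \<Rightarrow> real" and q :: "real \<Rightarrow> real ^ 'n"
  assumes s: "0 < s" "s < 1" and VC1: "C1 V" and V: "\<And>v. V v \<le> 0"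
    and q: "continuous_on UNIV q" "q a = q\<^sub>0" and bd: "\<And>x. norm (q x) \<le> B"
    and g: "\<And>i. gag s (\<lambda>x. q x $ i) < \<infinity>" and Vint: "integrable lborel (\<lambda>x. V (q x))"
    and min: "\<And>p. p \<in> Gam s a q\<^sub>0 \<Longrightarrow> nrg s V q \<le> nrg s V p"
    and \<phi>: "admissible s \<phi>" "\<phi> a = 0"
  shows "0 \<le> c_s s * cform s (\<lambda>x. q x $ i) \<phi> - (LBINT x. grad V (q x) $ i * \<phi> x)"
proof -
  have c: "c_s s > 0" by (rule c_s_pos[OF s])
  have \<phi>c: "continuous_on UNIV \<phi>" and \<phi>g: "gag s \<phi> < \<infinity>" and \<phi>i: "integrable lborel \<phi>"
    using \<phi> by (auto simp: admissible_def)
  obtain P where P: "\<And>x. \<bar>\<phi> x\<bar> \<le> P" using \<phi> by (auto simp: admissible_def bounded_iff)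
  have Vc: "continuous_on UNIV V" by (rule C1_continuous[OF VC1])
  have qi: "continuous_on UNIV (\<lambda>x. q x $ j)" for j using q by (intro continuous_intros)
  have gc: "continuous_on UNIV (\<lambda>x. grad V (q x))"
    using VC1 continuous_on_compose2[OF _ q(1), of UNIV "grad V"] by (simp add: C1_def)
  have [measurable]: "\<phi> \<in> borel_measurable borel" by (rule borel_measurable_continuous_onI[OF \<phi>c])
  define p where "p t x = q x + axis i (t * \<phi> x)" for t x
  have pc: "continuous_on UNIV (p t)" for t
  proof -
    have "continuous_on UNIV (\<lambda>x. axis i (t * \<phi> x) :: real ^ 'n)"
      unfolding axis_def
    proof (rule continuous_on_vec_lambda)
      fix j show "continuous_on UNIV (\<lambda>x. if j = i then t * \<phi> x else 0)"
        by (cases "j = i") (auto intro!: continuous_intros \<phi>c)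
    qed
    then show ?thesis unfolding p_def [abs_def] by (intro continuous_intros q)
  qed
  have norm_axis: "norm (axis i c :: real ^ 'n) = \<bar>c\<bar>" for c
  proof -
    have "(axis i c :: real ^ 'n) = c *\<^sub>R axis i 1" by (simp add: axis_def vec_eq_iff)
    then show ?thesis by simp
  qed
  have pn: "p t x $ j = (if j = i then q x $ i + t * \<phi> x else q x $ j)" for t x j
    by (simp add: p_def axis_def)
  have pg: "gag s (\<lambda>x. p t x $ j) < \<infinity>" for t j
    using g gag_add_scale_finite[OF qi g \<phi>c \<phi>g, of i t] by (cases "j = i") (simp_all add: pn)
  \<comment> \<open>For times at most 1 the varied curves stay in the ball of radius
    \<open>B + P\<close>.\<close>
  obtain M where M: "M \<ge> 0" "\<And>u v. norm u \<le> B + P \<Longrightarrow> norm v \<le> B + P \<Longrightarrow> \<bar>V u - V v\<bar> \<le> M * norm (u - v)"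
    using C1_lipschitz_on_ball[OF VC1] by blast
  have VL: "\<bar>V (p t x) - V (q x)\<bar> \<le> M * (t * \<bar>\<phi> x\<bar>)" if "0 \<le> t" "t \<le> 1" for t x
  proof -
    have n: "norm (p t x - q x) = t * \<bar>\<phi> x\<bar>" using that by (simp add: p_def norm_axis abs_mult)
    have "t * \<bar>\<phi> x\<bar> \<le> 1 * P" using that P[of x] by (intro mult_mono) auto
    then have "norm (p t x) \<le> B + P" using norm_triangle_ineq[of "q x" "p t x - q x"] bd[of x] n by simp
    moreover have "norm (q x) \<le> B + P" using bd[of x] P[of x] by simp
    ultimately have "\<bar>V (p t x) - V (q x)\<bar> \<le> M * norm (p t x - q x)" by (rule M(2))
    then show ?thesis by (simp only: n)
  qed
  have pi: "integrable lborel (\<lambda>x. V (p t x))" if "0 \<le> t" "t \<le> 1" for t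
  proof -
    have "integrable lborel (\<lambda>x. V (p t x) - V (q x))"
    proof (rule Bochner_Integration.integrable_bound)
      show "integrable lborel (\<lambda>x. M * (t * \<bar>\<phi> x\<bar>))" using \<phi>i by simp
      show "AE x in lborel. norm (V (p t x) - V (q x)) \<le> norm (M * (t * \<bar>\<phi> x\<bar>))"
        using VL[OF that] M(1) that by (intro AE_I2) (auto simp: abs_mult)
      have "continuous_on UNIV (\<lambda>x. V (p t x) - V (q x))"
        using continuous_on_compose2[OF Vc pc[of t]] continuous_on_compose2[OF Vc q(1)] by (intro continuous_intros) auto
      then show "(\<lambda>x. V (p t x) - V (q x)) \<in> borel_measurable lborel" by (simp add: borel_measurable_continuous_onI)
    qed
    from Bochner_Integration.integrable_add[OF this Vint] show ?thesis by simp
  qed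
  have ineq: "(LBINT x. (V (p t x) - V (q x)) / t) \<le> c_s s * cform s (\<lambda>x. q x $ i) \<phi> + t * (c_s s / 2 * cform s \<phi> \<phi>)"
    if t: "0 < t" "t \<le> 1" for t
  proof -
    have t': "0 \<le> t" "t \<le> 1" using t by auto
    have "p t \<in> Gam s a q\<^sub>0"
    proof -
      have "gagliardo_sq s (p t) < \<infinity>"
        unfolding gagliardo_sq_eq_gag[OF pc] using pg by (simp add: ennreal_mult_less_top)
      then have "p t \<in> Ds2 s" by (rule continuous_in_Ds2[OF pc])
      moreover have "p t a = q\<^sub>0" using \<phi>(2) q(2) by (simp add: p_def axis_def vec_eq_iff)
      ultimately show ?thesis using pc[of t] by (auto simp: Gam_def has_point_value_def)
    qed
    then have "c_s s / 2 * (\<Sum>j\<in>UNIV. cform s (\<lambda>x. q x $ j) (\<lambda>x. q x $ j)) - (LBINT x. V (q x))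
      \<le> c_s s / 2 * (\<Sum>j\<in>UNIV. cform s (\<lambda>x. p t x $ j) (\<lambda>x. p t x $ j)) - (LBINT x. V (p t x))"
    proof -
      \<comment> \<open>\<open>ennreal\<close> sends negative reals to 0, so the inequality between
        reals can be recovered only once the larger side is known to be nonnegative.\<close>
      have "0 \<le> c_s s / 2 * (\<Sum>j\<in>UNIV. cform s (\<lambda>x. p t x $ j) (\<lambda>x. p t x $ j)) - (LBINT x. V (p t x))"
      proof -
        have pij: "continuous_on UNIV (\<lambda>x. p t x $ j)" for j using pc by (intro continuous_intros)
        have "(LBINT x. V (p t x)) \<le> 0"
          using Bochner_Integration.integral_nonneg[of lborel "\<lambda>x. - V (p t x)"] V by simp
        moreover have "0 \<le> c_s s / 2 * (\<Sum>j\<in>UNIV. cform s (\<lambda>x. p t x $ j) (\<lambda>x. p t x $ j))"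
          using c gag_eq_cform(2)[OF pij pg] by (intro mult_nonneg_nonneg sum_nonneg) auto
        ultimately show ?thesis by simp
      qed
      then show ?thesis
        using min[OF \<open>p t \<in> Gam s a q\<^sub>0\<close>] unfolding nrg_eq_ennreal[OF s q(1) g V Vint] nrg_eq_ennreal[OF s pc pg V pi[OF t']]
        by (simp add: ennreal_le_iff)
    qed
    moreover have "(\<Sum>j\<in>UNIV. cform s (\<lambda>x. p t x $ j) (\<lambda>x. p t x $ j)) = (\<Sum>j\<in>UNIV. cform s (\<lambda>x. q x $ j) (\<lambda>x. q x $ j))
      + (2 * t * cform s (\<lambda>x. q x $ i) \<phi> + t\<^sup>2 * cform s \<phi> \<phi>)"
    proof -
      let ?u = "\<lambda>x. q x $ i"
      have uc: "continuous_on UNIV (\<lambda>x. ?u x + t * \<phi> x)" "gag s (\<lambda>x. ?u x + t * \<phi> x) < \<infinity>"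
        by (intro continuous_on_add continuous_on_mult_left qi \<phi>c) (rule gag_add_scale_finite[OF qi g \<phi>c \<phi>g])
      have "cform s (\<lambda>x. ?u x + t * \<phi> x) (\<lambda>x. ?u x + t * \<phi> x) = cform s ?u (\<lambda>x. ?u x + t * \<phi> x) + t * cform s \<phi> (\<lambda>x. ?u x + t * \<phi> x)"
        unfolding cform_add_scale[OF uc qi g \<phi>c \<phi>g] by (simp add: cform_commute)
      also have "\<dots> = cform s ?u ?u + (2 * t * cform s ?u \<phi> + t\<^sup>2 * cform s \<phi> \<phi>)"
        unfolding cform_add_scale[OF qi g qi g \<phi>c \<phi>g] cform_add_scale[OF \<phi>c \<phi>g qi g \<phi>c \<phi>g]
        by (simp add: cform_commute[of s \<phi> ?u] power2_eq_square algebra_simps)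
      finally have i: "cform s (\<lambda>x. p t x $ i) (\<lambda>x. p t x $ i) = cform s ?u ?u + (2 * t * cform s ?u \<phi> + t\<^sup>2 * cform s \<phi> \<phi>)"
        by (simp add: pn)
      have "(\<Sum>j\<in>UNIV - {i}. cform s (\<lambda>x. p t x $ j) (\<lambda>x. p t x $ j)) = (\<Sum>j\<in>UNIV - {i}. cform s (\<lambda>x. q x $ j) (\<lambda>x. q x $ j))"
        by (intro sum.cong) (auto simp: pn)
      then show ?thesis using i by (simp add: sum.remove[of UNIV i])
    qed
    ultimately have "(LBINT x. V (p t x)) - (LBINT x. V (q x)) \<le> t * (c_s s * cform s (\<lambda>x. q x $ i) \<phi> + t * (c_s s / 2 * cform s \<phi> \<phi>))"
      by (simp add: algebra_simps power2_eq_square)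
    moreover have "(LBINT x. (V (p t x) - V (q x)) / t) = ((LBINT x. V (p t x)) - (LBINT x. V (q x))) / t"
      using pi[OF t'] Vint by simp
    ultimately show ?thesis using t by (simp add: divide_le_eq mult.commute)
  qed
  define t where "t n = 1 / real (Suc n)" for n
  have t: "0 < t n" "t n \<le> 1" for n by (auto simp: t_def)
  have t0: "t \<longlonglongrightarrow> 0" unfolding t_def [abs_def] by (rule LIMSEQ_Suc[OF lim_1_over_n])
  \<comment> \<open>The difference quotients converge to the directional derivative of
    \<open>V\<close> and are dominated by a multiple of \<open>\<bar>\<phi> x\<bar>\<close>.\<close>
  have "(\<lambda>n. \<integral>x. (V (p (t n) x) - V (q x)) / t n \<partial>lborel) \<longlonglongrightarrow> (LBINT x. grad V (q x) $ i * \<phi> x)"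
  proof (rule integral_dominated_convergence[where w="\<lambda>x. M * \<bar>\<phi> x\<bar>"])
    show "AE x in lborel. (\<lambda>n. (V (p (t n) x) - V (q x)) / t n) \<longlonglongrightarrow> grad V (q x) $ i * \<phi> x"
    proof (rule AE_I2)
      fix x
      have "((\<lambda>r. V (q x + r *\<^sub>R axis i (\<phi> x))) has_derivative (\<lambda>h. (h *\<^sub>R axis i (\<phi> x)) \<bullet> grad V (q x))) (at 0)"
        using GDERIV_grad[OF VC1, of "q x"] unfolding gderiv_def
        by (intro has_derivative_compose[of "\<lambda>r. q x + r *\<^sub>R axis i (\<phi> x)" "\<lambda>h. h *\<^sub>R axis i (\<phi> x)" 0 UNIV V])
           (auto intro!: derivative_eq_intros)
      then have "((\<lambda>r. V (q x + r *\<^sub>R axis i (\<phi> x))) has_real_derivative (grad V (q x) $ i * \<phi> x)) (at 0)"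
        by (simp add: has_field_derivative_def inner_axis' mult_commute_abs mult_ac)
      then have "((\<lambda>h. (V (q x + (0 + h) *\<^sub>R axis i (\<phi> x)) - V (q x + 0 *\<^sub>R axis i (\<phi> x))) / h) \<longlongrightarrow> grad V (q x) $ i * \<phi> x) (at 0)"
        unfolding DERIV_def by simp
      then have "((\<lambda>h. (V (q x + h *\<^sub>R axis i (\<phi> x)) - V (q x)) / h) \<longlongrightarrow> grad V (q x) $ i * \<phi> x) (at 0)"
        by simp
      moreover have "filterlim t (at 0) sequentially"
        using t0 t(1) by (auto simp: filterlim_at intro!: always_eventually) (metis less_irrefl)
      ultimately have "(\<lambda>n. (V (q x + t n *\<^sub>R axis i (\<phi> x)) - V (q x)) / t n) \<longlonglongrightarrow> grad V (q x) $ i * \<phi> x"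
        by (rule filterlim_compose)
      moreover have "r *\<^sub>R axis i (\<phi> x) = axis i (r * \<phi> x)" for r by (simp add: axis_def vec_eq_iff)
      ultimately show "(\<lambda>n. (V (p (t n) x) - V (q x)) / t n) \<longlonglongrightarrow> grad V (q x) $ i * \<phi> x"
        by (simp add: p_def)
    qed
    show "AE x in lborel. norm ((V (p (t n) x) - V (q x)) / t n) \<le> M * \<bar>\<phi> x\<bar>" for n
      using VL[of "t n"] t[of n] by (intro AE_I2) (auto simp: divide_le_eq less_imp_le mult_ac)
    show "(\<lambda>x. (V (p (t n) x) - V (q x)) / t n) \<in> borel_measurable lborel" for n
      using borel_measurable_integrable[OF pi[of "t n"]] borel_measurable_integrable[OF Vint] t[of n] by (simp add: less_imp_le)
    show "(\<lambda>x. grad V (q x) $ i * \<phi> x) \<in> borel_measurable lborel"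
    proof -
      have "continuous_on UNIV (\<lambda>x. grad V (q x) $ i * \<phi> x)" using gc \<phi>c by (intro continuous_intros)
      then show ?thesis by (simp add: borel_measurable_continuous_onI)
    qed
  qed (use \<phi>i in simp)
  moreover have "(\<lambda>n. c_s s * cform s (\<lambda>x. q x $ i) \<phi> + t n * (c_s s / 2 * cform s \<phi> \<phi>)) \<longlonglongrightarrow> c_s s * cform s (\<lambda>x. q x $ i) \<phi> + 0 * (c_s s / 2 * cform s \<phi> \<phi>)"
    by (intro tendsto_intros t0)
  ultimately have "(LBINT x. grad V (q x) $ i * \<phi> x) \<le> c_s s * cform s (\<lambda>x. q x $ i) \<phi> + 0 * (c_s s / 2 * cform s \<phi> \<phi>)"
    by (rule LIMSEQ_le) (use ineq t in auto)
  then show ?thesis by simp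
qed

lemma integrable_bounded_mult:
  fixes f g :: "real \<Rightarrow> real"
  assumes f: "f \<in> borel_measurable borel" "\<And>x. \<bar>f x\<bar> \<le> M" and g: "integrable lborel g"
  shows "integrable lborel (\<lambda>x. f x * g x)"
proof (rule Bochner_Integration.integrable_bound)
  show "integrable lborel (\<lambda>x. M * \<bar>g x\<bar>)" using g by simp
  have "0 \<le> M" using f(2)[of 0] by simp
  then show "AE x in lborel. norm (f x * g x) \<le> norm (M * \<bar>g x\<bar>)"
    using f(2) by (intro AE_I2) (auto simp: abs_mult intro: mult_right_mono)
qed (use f borel_measurable_integrable[OF g] in simp)

lemma cform_uminus: "cform s u (\<lambda>x. - v x) = - cform s u v"
proof -
  have "cform s u (\<lambda>x. - v x) = (\<integral>z. - ((u (fst z) - u (snd z)) * (v (fst z) - v (snd z)) / \<bar>fst z - snd z\<bar> powr (1 + 2 * s)) \<partial>(lborel \<Otimes>\<^sub>M lborel))"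
    unfolding cform_def by (intro Bochner_Integration.integral_cong) (auto simp: algebra_simps minus_divide_left)
  then show ?thesis by (simp add: cform_def)
qed

text \<open>\<mu> is the Lagrange multiplier of the constraint at \<open>a\<close>. Subtracting
  \<open>\<phi> a\<close> times a fixed profile with value 1 at \<open>a\<close> leaves a test
  function vanishing there, and the defect of that profile in the equation is \<mu>. The equation
  thus reaches test functions that do not vanish at \<open>a\<close>, as derivatives of heat kernels
  in general do not.\<close>

lemma euler_lagrange:
  fixes V :: "real ^ 'n \<Rightarrow> real" and q :: "real \<Rightarrow> real ^ 'n"
  assumes s: "0 < s" "s < 1" and VC1: "C1 V" and V: "\<And>v. V v \<le> 0"
    and q: "continuous_on UNIV q" "q a = q\<^sub>0" and bd: "\<And>x. norm (q x) \<le> B"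
    and g: "\<And>i. gag s (\<lambda>x. q x $ i) < \<infinity>" and Vint: "integrable lborel (\<lambda>x. V (q x))"
    and min: "\<And>p. p \<in> Gam s a q\<^sub>0 \<Longrightarrow> nrg s V q \<le> nrg s V p"
  obtains \<mu> where "\<And>\<phi>. admissible s \<phi> \<Longrightarrow>
    c_s s * cform s (\<lambda>x. q x $ i) \<phi> = (LBINT x. grad V (q x) $ i * \<phi> x) + \<mu> * \<phi> a"
proof -
  let ?u = "\<lambda>x. q x $ i" and ?f = "\<lambda>x. grad V (q x) $ i"
  have uc: "continuous_on UNIV ?u" using q by (intro continuous_intros)
  have zero: "c_s s * cform s ?u \<phi> = (LBINT x. ?f x * \<phi> x)" if \<phi>: "admissible s \<phi>" "\<phi> a = 0" for \<phi>
  proof -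
    have 0: "admissible s (\<lambda>x. 0)" using \<phi> by (simp add: admissible_def gag_def)
    have "admissible s (\<lambda>x. - \<phi> x)" using admissible_add_scale[OF 0 \<phi>(1), of "-1"] by simp
    from first_variation_nonneg[OF s VC1 V q bd g Vint min this, of i] first_variation_nonneg[OF s VC1 V q bd g Vint min \<phi>, of i] \<phi>(2)
    show ?thesis by (simp add: cform_uminus)
  qed
  obtain F where F: "\<And>x. \<bar>?f x\<bar> \<le> F"
  proof -
    obtain F where F: "\<And>x. norm x \<le> B \<Longrightarrow> norm (grad V x) \<le> F"
      using C1_grad_bounded[OF VC1] by blast
    have "\<bar>?f x\<bar> \<le> F" for x
      using F[of "q x"] bd[of x] component_le_norm_cart[of "grad V (q x)" i] by simp
    then show thesis by (rule that)
  qed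
  have fc: "continuous_on UNIV ?f"
    using VC1 continuous_on_compose2[OF _ q(1), of UNIV "grad V"] by (intro continuous_intros) (simp add: C1_def)
  define b where "b x = 1 / (1 + (x - a)\<^sup>2)" for x
  have b: "admissible s b"
    unfolding b_def [abs_def]
    by (rule admissible_of_decay[OF s bump_decay(1), where A=1 and b=a])
      (simp add: add_nonneg_nonneg, use bump_decay(2)[where c=1 and b=a] in simp)
  define \<mu> where "\<mu> = c_s s * cform s ?u b - (LBINT x. ?f x * b x)"
  have "c_s s * cform s ?u \<phi> = (LBINT x. ?f x * \<phi> x) + \<mu> * \<phi> a" if \<phi>: "admissible s \<phi>" for \<phi>
  proof -
    let ?\<psi> = "\<lambda>x. \<phi> x + (- \<phi> a) * b x"
    have "c_s s * cform s ?u ?\<psi> = (LBINT x. ?f x * ?\<psi> x)"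
      by (rule zero[OF admissible_add_scale[OF \<phi> b]]) (simp add: b_def)
    also have "cform s ?u ?\<psi> = cform s ?u \<phi> + (- \<phi> a) * cform s ?u b"
      using uc g \<phi> b by (intro cform_add_scale) (auto simp: admissible_def)
    also have "(LBINT x. ?f x * ?\<psi> x) = (LBINT x. ?f x * \<phi> x + (- \<phi> a) * (?f x * b x))"
      by (simp add: algebra_simps)
    also have "\<dots> = (LBINT x. ?f x * \<phi> x) + (- \<phi> a) * (LBINT x. ?f x * b x)"
    proof -
      have "integrable lborel (\<lambda>x. ?f x * \<phi> x)" "integrable lborel (\<lambda>x. ?f x * b x)"
        using \<phi> b unfolding admissible_def
        by (blast intro: integrable_bounded_mult[OF borel_measurable_continuous_onI[OF fc] F])+
      then show ?thesis by simp
    qed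
    finally show ?thesis by (simp add: \<mu>_def algebra_simps)
  qed
  then show thesis by (rule that)
qed

section \<open>Heat kernels\<close>

text \<open>The centred Gaussian density of variance \<open>t\<close>, hence the kernel of
  \<open>u_t = u_xx / 2\<close>; the next two definitions are its space derivative and the time
  derivative of that.\<close>

definition heat :: "real \<Rightarrow> real \<Rightarrow> real" where
  "heat t y = exp (- y\<^sup>2 / (2 * t)) / sqrt (2 * pi * t)"

definition heat_x :: "real \<Rightarrow> real \<Rightarrow> real" where
  "heat_x t y = - (y / t) * heat t y"

definition heat_xt :: "real \<Rightarrow> real \<Rightarrow> real" where
  "heat_xt t y = (3 * y / (2 * t\<^sup>2) - y ^ 3 / (2 * t ^ 3)) * heat t y"

lemma heat_eq_normal_density: "t > 0 \<Longrightarrow> heat t y = normal_density 0 (sqrt t) y"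
  by (simp add: heat_def normal_density_def)

lemma heat_pos: "t > 0 \<Longrightarrow> heat t y > 0"
  by (simp add: heat_def)

lemma heat_even: "heat t (- y) = heat t y"
  by (simp add: heat_def)

text \<open>Parabolic scaling reduces estimates to time 1: a space derivative costs the factor
  \<open>1 / sqrt t\<close>, a time derivative the factor \<open>1 / t\<close>.\<close>

lemma heat_scale:
  assumes "t > 0"
  shows "heat t (sqrt t * z) = heat 1 z / sqrt t" and "heat_x t (sqrt t * z) = heat_x 1 z / t"
    and "heat_xt t (sqrt t * z) = heat_xt 1 z / t\<^sup>2"
proof -
  have sq: "(sqrt t * z)\<^sup>2 / (2 * t) = z\<^sup>2 / 2" "sqrt t * sqrt t = t" using assms by (simp_all add: power_mult_distrib)
  show 0: "heat t (sqrt t * z) = heat 1 z / sqrt t"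
    using sq by (simp add: heat_def real_sqrt_mult)
  have "sqrt t * z / t = z / sqrt t" using assms by (simp add: field_simps sq(2))
  then show "heat_x t (sqrt t * z) = heat_x 1 z / t"
    unfolding heat_x_def 0 using assms by (simp add: sq(2))
  have "3 * (sqrt t * z) / (2 * t\<^sup>2) - (sqrt t * z) ^ 3 / (2 * t ^ 3) = (3 * z / 2 - z ^ 3 / 2) * (sqrt t / t\<^sup>2)"
  proof -
    have "(sqrt t * z) ^ 3 = (sqrt t * sqrt t) * sqrt t * z ^ 3" by (simp only: power3_eq_cube mult_ac)
    then have "(sqrt t * z) ^ 3 = t * sqrt t * z ^ 3" by (simp only: sq(2))
    then show ?thesis using assms by (simp add: power2_eq_square power3_eq_cube field_simps)
  qed
  then show "heat_xt t (sqrt t * z) = heat_xt 1 z / t\<^sup>2"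
    unfolding heat_xt_def 0 using assms by simp
qed

lemma heat_measurable [measurable]:
  "case_prod heat \<in> borel_measurable (borel \<Otimes>\<^sub>M borel)"
  "case_prod heat_x \<in> borel_measurable (borel \<Otimes>\<^sub>M borel)"
  "case_prod heat_xt \<in> borel_measurable (borel \<Otimes>\<^sub>M borel)"
proof -
  show [measurable]: "case_prod heat \<in> borel_measurable (borel \<Otimes>\<^sub>M borel)"
    unfolding heat_def case_prod_unfold by measurable
  show "case_prod heat_x \<in> borel_measurable (borel \<Otimes>\<^sub>M borel)"
    unfolding heat_x_def case_prod_unfold by measurable
  show "case_prod heat_xt \<in> borel_measurable (borel \<Otimes>\<^sub>M borel)"
    unfolding heat_xt_def case_prod_unfold by measurable
qed

lemma heat_derivs:
  assumes "t > 0"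
  shows "(heat t has_real_derivative heat_x t y) (at y)"
    and "(heat_x t has_real_derivative (y\<^sup>2 / t\<^sup>2 - 1 / t) * heat t y) (at y)"
    and "((\<lambda>t. heat_x t y) has_real_derivative heat_xt t y) (at t)"
proof -
  show 1: "(heat t has_real_derivative heat_x t y) (at y)"
    unfolding heat_def [abs_def] heat_x_def
    using assms by (auto intro!: derivative_eq_intros simp: field_simps)
  show "(heat_x t has_real_derivative (y\<^sup>2 / t\<^sup>2 - 1 / t) * heat t y) (at y)"
    unfolding heat_x_def [abs_def]
    using assms by (auto intro!: derivative_eq_intros 1 simp: heat_x_def power2_eq_square field_simps)
  have s: "((\<lambda>t. sqrt (2 * pi * t)) has_real_derivative sqrt (2 * pi * t) / (2 * t)) (at t)"
  proof -
    have "((\<lambda>t. sqrt (2 * pi * t)) has_real_derivative (2 * pi) * (inverse (sqrt (2 * pi * t)) / 2)) (at t)"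
      using assms by (auto intro!: derivative_eq_intros simp: mult_less_0_iff)
    also have "(2 * pi) * (inverse (sqrt (2 * pi * t)) / 2) = sqrt (2 * pi * t) / (2 * t)"
      using assms by (simp add: field_simps real_sqrt_mult_self del: real_sqrt_mult)
    finally show ?thesis .
  qed
  have h: "((\<lambda>t. heat t y) has_real_derivative (y\<^sup>2 / (2 * t\<^sup>2) - 1 / (2 * t)) * heat t y) (at t)"
  proof -
    have e: "((\<lambda>t. exp (- y\<^sup>2 / (2 * t))) has_real_derivative exp (- y\<^sup>2 / (2 * t)) * (y\<^sup>2 / (2 * t\<^sup>2))) (at t)"
      using assms by (auto intro!: derivative_eq_intros simp: power2_eq_square)
    have "((\<lambda>t. heat t y) has_real_derivative
       (exp (- y\<^sup>2 / (2 * t)) * (y\<^sup>2 / (2 * t\<^sup>2)) * sqrt (2 * pi * t) - exp (- y\<^sup>2 / (2 * t)) * (sqrt (2 * pi * t) / (2 * t))) / (sqrt (2 * pi * t) * sqrt (2 * pi * t))) (at t)"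
      unfolding heat_def by (rule DERIV_divide[OF e s]) (use assms in simp)
    also have "(exp (- y\<^sup>2 / (2 * t)) * (y\<^sup>2 / (2 * t\<^sup>2)) * sqrt (2 * pi * t) - exp (- y\<^sup>2 / (2 * t)) * (sqrt (2 * pi * t) / (2 * t))) / (sqrt (2 * pi * t) * sqrt (2 * pi * t))
      = (y\<^sup>2 / (2 * t\<^sup>2) - 1 / (2 * t)) * heat t y"
    proof -
      have gen: "(E * Y * S - E * (S / T)) / (S * S) = (Y - 1 / T) * (E / S)" if "S \<noteq> 0" for E Y S T :: real
        using that by (simp add: diff_divide_distrib) (simp add: field_simps)
      show ?thesis unfolding heat_def by (rule gen) (use assms in simp)
    qed
    finally show ?thesis .
  qed
  have "((\<lambda>t. - (y / t) * heat t y) has_real_derivative (y / t\<^sup>2) * heat t y + (- (y / t)) * ((y\<^sup>2 / (2 * t\<^sup>2) - 1 / (2 * t)) * heat t y)) (at t)"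
  proof -
    have "((\<lambda>t. - (y / t)) has_real_derivative y / t\<^sup>2) (at t)"
      using assms by (auto intro!: derivative_eq_intros simp: power2_eq_square)
    from DERIV_mult[OF this h] show ?thesis by (simp add: mult.commute)
  qed
  also have "(y / t\<^sup>2) * heat t y + (- (y / t)) * ((y\<^sup>2 / (2 * t\<^sup>2) - 1 / (2 * t)) * heat t y) = heat_xt t y"
    unfolding heat_xt_def using assms by (simp add: power2_eq_square power3_eq_cube field_simps)
  finally show "((\<lambda>t. heat_x t y) has_real_derivative heat_xt t y) (at t)" by (simp add: heat_x_def)
qed

lemma heat_one: "heat 1 z = std_normal_density z"
  by (simp add: heat_def std_normal_density_def)

lemma heat_one_integrable:
  "integrable lborel (heat 1)" "integrable lborel (heat_x 1)" "integrable lborel (heat_xt 1)"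
proof -
  show "integrable lborel (heat 1)" using integrable_normal_density[of 1 0] by (simp add: heat_one [abs_def])
  have "integrable lborel (\<lambda>z. (-1) * (std_normal_density z * z ^ 1))"
    by (intro integrable_mult_right integrable_std_normal_moment)
  then show "integrable lborel (heat_x 1)" by (simp add: heat_x_def [abs_def] heat_one mult.commute)
  have "integrable lborel (\<lambda>z. (3 / 2) * (std_normal_density z * z ^ 1) - (1 / 2) * (std_normal_density z * z ^ 3))"
    by (intro Bochner_Integration.integrable_diff integrable_mult_right integrable_std_normal_moment)
  then show "integrable lborel (heat_xt 1)"
    by (rule Bochner_Integration.integrable_cong[THEN iffD1, rotated -1]) (auto simp: heat_xt_def heat_one algebra_simps)
qed

lemma integral_heat_one: "(LBINT z. heat 1 z) = 1"
  by (simp add: heat_one)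

section \<open>Rescaled convolutions\<close>

text \<open>The convolution of \<open>q\<close> with \<open>h\<close> rescaled to width \<open>sqrt t\<close>, in a form that is continuous up to \<open>t = 0\<close>.\<close>
definition smear :: "(real \<Rightarrow> real) \<Rightarrow> (real \<Rightarrow> real) \<Rightarrow> real \<Rightarrow> real \<Rightarrow> real" where
  "smear h q t x = (LBINT z. h z * q (x - sqrt t * z))"

text \<open>The substitution \<open>y = sqrt t * z\<close>, done once for the heat kernel and its
  two derivatives, which differ only in the power of \<open>t\<close> that plays the role of
  \<open>c\<close>.\<close>

lemma scaled_convolution:
  fixes k h q :: "real \<Rightarrow> real"
  assumes t: "t > 0" and k: "\<And>z. k (sqrt t * z) = h z / c" and "c \<noteq> 0"
    and h: "integrable lborel h" and q: "q \<in> borel_measurable borel" "\<And>x. \<bar>q x\<bar> \<le> M"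
  shows "integrable lborel k" and "(LBINT y. k y * q (x - y)) = sqrt t / c * smear h q t x"
    and "(LBINT y. k (x - y) * q y) = sqrt t / c * smear h q t x"
    and "(LBINT y. \<bar>k y\<bar>) = sqrt t / \<bar>c\<bar> * (LBINT z. \<bar>h z\<bar>)"
proof -
  have st: "sqrt t \<noteq> 0" using t by simp
  have kh: "k y = h (y / sqrt t) / c" for y using k[of "y / sqrt t"] t by simp
  have "integrable lborel (\<lambda>y. h (0 + (1 / sqrt t) * y))"
    by (rule lborel_integrable_real_affine[OF h]) (use t in simp)
  then show ik: "integrable lborel k" by (simp add: kh [abs_def])
  show 2: "(LBINT y. k y * q (x - y)) = sqrt t / c * smear h q t x"
    using lborel_integral_real_affine[OF st, of "\<lambda>y. k y * q (x - y)" 0] t k by (simp add: smear_def)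
  have "(LBINT y. k (x - y) * q y) = (LBINT y. k y * q (x - y))"
    using lborel_integral_real_affine[of "-1" "\<lambda>y. k (x - y) * q y" x] by simp
  with 2 show "(LBINT y. k (x - y) * q y) = sqrt t / c * smear h q t x" by simp
  show "(LBINT y. \<bar>k y\<bar>) = sqrt t / \<bar>c\<bar> * (LBINT z. \<bar>h z\<bar>)"
    using lborel_integral_real_affine[OF st, of "\<lambda>y. \<bar>k y\<bar>" 0] t k by (simp add: abs_divide)
qed

lemma heat_integrable:
  assumes "t > 0"
  shows "integrable lborel (heat t)" "integrable lborel (heat_x t)" "integrable lborel (heat_xt t)"
proof -
  have t: "sqrt t \<noteq> 0" "t \<noteq> 0" "t\<^sup>2 \<noteq> 0" using assms by auto
  show "integrable lborel (heat t)"
    by (rule scaled_convolution(1)[OF assms heat_scale(1)[OF assms] t(1) heat_one_integrable(1), of "\<lambda>_. 0" 0]) simp_all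
  show "integrable lborel (heat_x t)"
    by (rule scaled_convolution(1)[OF assms heat_scale(2)[OF assms] t(2) heat_one_integrable(2), of "\<lambda>_. 0" 0]) simp_all
  show "integrable lborel (heat_xt t)"
    by (rule scaled_convolution(1)[OF assms heat_scale(3)[OF assms] t(3) heat_one_integrable(3), of "\<lambda>_. 0" 0]) simp_all
qed

lemma smear_bound:
  assumes h: "integrable lborel h" and q: "q \<in> borel_measurable borel" "\<And>x. \<bar>q x\<bar> \<le> M"
  shows "\<bar>smear h q t x\<bar> \<le> M * (LBINT z. \<bar>h z\<bar>)"
proof -
  have [measurable]: "h \<in> borel_measurable borel" "q \<in> borel_measurable borel" using h q by auto
  have "integrable lborel (\<lambda>z. q (x - sqrt t * z) * h z)"
    by (rule integrable_bounded_mult[OF _ _ h, of _ M]) (use q in auto)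
  then have i: "integrable lborel (\<lambda>z. h z * q (x - sqrt t * z))" by (simp add: mult.commute)
  have "\<bar>smear h q t x\<bar> \<le> (LBINT z. \<bar>h z * q (x - sqrt t * z)\<bar>)"
    unfolding smear_def by (rule integral_abs_bound)
  also have "\<dots> \<le> (LBINT z. M * \<bar>h z\<bar>)"
  proof (rule integral_mono[OF integrable_abs[OF i] integrable_mult_right[OF integrable_abs[OF h]]])
    show "\<bar>h z * q (x - sqrt t * z)\<bar> \<le> M * \<bar>h z\<bar>" for z
      using mult_right_mono[OF q(2), of "\<bar>h z\<bar>"] by (simp add: abs_mult mult.commute)
  qed
  finally show ?thesis by simp
qed

text \<open>Centres and times vary together and the pointwise limit \<open>Q\<close> is left open,
  so limits at a point and limits with the centre escaping to infinity come from one dominated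
  convergence.\<close>

lemma smear_tendsto:
  assumes h: "integrable lborel h" and q: "continuous_on UNIV q" "\<And>x. \<bar>q x\<bar> \<le> M"
    and lim: "\<And>z. (\<lambda>n. q (X n - sqrt (T n) * z)) \<longlonglongrightarrow> Q z" and Q: "Q \<in> borel_measurable borel"
  shows "(\<lambda>n. smear h q (T n) (X n)) \<longlonglongrightarrow> (LBINT z. h z * Q z)"
  unfolding smear_def
proof (rule integral_dominated_convergence[where w="\<lambda>z. M * \<bar>h z\<bar>"])
  have [measurable]: "h \<in> borel_measurable borel" "q \<in> borel_measurable borel"
    using h q by (auto intro: borel_measurable_continuous_onI)
  show "(\<lambda>z. h z * q (X n - sqrt (T n) * z)) \<in> borel_measurable lborel" for n by measurable
  show "(\<lambda>z. h z * Q z) \<in> borel_measurable lborel" using Q by measurable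
  show "AE z in lborel. (\<lambda>n. h z * q (X n - sqrt (T n) * z)) \<longlonglongrightarrow> h z * Q z"
    by (intro AE_I2 tendsto_intros lim)
  show "AE z in lborel. norm (h z * q (X n - sqrt (T n) * z)) \<le> M * \<bar>h z\<bar>" for n
  proof (rule AE_I2)
    show "norm (h z * q (X n - sqrt (T n) * z)) \<le> M * \<bar>h z\<bar>" for z
      using mult_right_mono[OF q(2), of "\<bar>h z\<bar>"] by (simp add: abs_mult mult.commute)
  qed
qed (use h in simp)

lemma smear_tendsto_point:
  assumes h: "integrable lborel h" and q: "continuous_on UNIV q" "\<And>x. \<bar>q x\<bar> \<le> M"
    and X: "X \<longlonglongrightarrow> x" and T: "T \<longlonglongrightarrow> t"
  shows "(\<lambda>n. smear h q (T n) (X n)) \<longlonglongrightarrow> smear h q t x"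
proof -
  have "(\<lambda>n. q (X n - sqrt (T n) * z)) \<longlonglongrightarrow> q (x - sqrt t * z)" for z
    by (rule continuous_on_tendsto_compose[OF q(1)]) (auto intro!: tendsto_intros X T)
  moreover have "(\<lambda>z. q (x - sqrt t * z)) \<in> borel_measurable borel"
    using borel_measurable_continuous_onI[OF q(1)] by measurable
  ultimately show ?thesis using smear_tendsto[OF h q] by (simp add: smear_def)
qed

lemma smear_tendsto_infinity:
  assumes h: "integrable lborel h" and q: "continuous_on UNIV q" "\<And>x. \<bar>q x\<bar> \<le> M"
    and q0: "(q \<longlongrightarrow> 0) at_infinity"
    and X: "filterlim X at_infinity sequentially" and T: "T \<longlonglongrightarrow> t"
  shows "(\<lambda>n. smear h q (T n) (X n)) \<longlonglongrightarrow> 0"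
proof -
  have "(\<lambda>n. q (X n - sqrt (T n) * z)) \<longlonglongrightarrow> 0" for z
  proof (rule filterlim_compose[OF q0])
    have "(\<lambda>n. - (sqrt (T n) * z)) \<longlonglongrightarrow> - (sqrt t * z)" by (intro tendsto_intros T)
    from tendsto_add_filterlim_at_infinity[OF this X]
    show "filterlim (\<lambda>n. X n - sqrt (T n) * z) at_infinity sequentially" by simp
  qed
  from smear_tendsto[OF h q this] show ?thesis by simp
qed

lemma smear_measurable:
  assumes [measurable]: "h \<in> borel_measurable borel" "q \<in> borel_measurable borel" "T \<in> borel_measurable borel"
  shows "(\<lambda>t. smear h q (T t) x) \<in> borel_measurable borel"
proof -
  have "(\<lambda>t. \<integral>z. h z * q (x - sqrt (T t) * z) \<partial>lborel) \<in> borel_measurable borel"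
    by (rule lborel.borel_measurable_lebesgue_integral) measurable
  then show ?thesis by (simp add: smear_def)
qed

lemma smear_heat:
  assumes q: "q \<in> borel_measurable borel" "\<And>x. \<bar>q x\<bar> \<le> M" and t: "t > 0"
  shows "(LBINT y. heat t (x - y) * q y) = smear (heat 1) q t x"
    and "(LBINT y. heat_x t (x - y) * q y) = smear (heat_x 1) q t x / sqrt t"
    and "(LBINT y. heat_xt t (x - y) * q y) = smear (heat_xt 1) q t x / (t * sqrt t)"
proof -
  have tt: "sqrt t \<noteq> 0" "t \<noteq> 0" "t\<^sup>2 \<noteq> 0" using t by auto
  have e: "sqrt t / t = 1 / sqrt t" "sqrt t / t\<^sup>2 = 1 / (t * sqrt t)"
    using t by (simp_all add: field_simps power2_eq_square)
  show "(LBINT y. heat t (x - y) * q y) = smear (heat 1) q t x"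
    using scaled_convolution(3)[OF t heat_scale(1)[OF t] tt(1) heat_one_integrable(1) q] t by simp
  show "(LBINT y. heat_x t (x - y) * q y) = smear (heat_x 1) q t x / sqrt t"
    using scaled_convolution(3)[OF t heat_scale(2)[OF t] tt(2) heat_one_integrable(2) q] e by simp
  show "(LBINT y. heat_xt t (x - y) * q y) = smear (heat_xt 1) q t x / (t * sqrt t)"
    using scaled_convolution(3)[OF t heat_scale(3)[OF t] tt(3) heat_one_integrable(3) q] e by simp
qed

lemma integrable_shift_mult:
  fixes k q :: "real \<Rightarrow> real"
  assumes k: "integrable lborel k" and q: "q \<in> borel_measurable borel" "\<And>x. \<bar>q x\<bar> \<le> M"
  shows "integrable lborel (\<lambda>y. k (x - y) * q y)"
proof -
  have "integrable lborel (\<lambda>y. k (x - y))" using lborel_integrable_real_affine[OF k, of "-1" x] by simp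
  from integrable_bounded_mult[OF q this] show ?thesis by (simp add: mult.commute)
qed

lemma integral_abs_shift: "(LBINT y. \<bar>k (x - y)\<bar>) = (LBINT y. \<bar>k y\<bar>)" for k :: "real \<Rightarrow> real"
  using lborel_integral_real_affine[of "-1" "\<lambda>y. \<bar>k (x - y)\<bar>" x] by simp

section \<open>Fundamental theorems for the heat extension\<close>

text \<open>Both fundamental-theorem statements come from Fubini, differentiating the kernel and not \<open>q\<close>.\<close>
lemma integral_parametric_kernel:
  fixes K :: "real \<Rightarrow> real \<Rightarrow> real" and q :: "real \<Rightarrow> real"
  assumes K [measurable]: "case_prod K \<in> borel_measurable (borel \<Otimes>\<^sub>M borel)"
    and i: "\<And>r. r \<in> {a..b} \<Longrightarrow> integrable lborel (K r)"
    and bd: "\<And>r. r \<in> {a..b} \<Longrightarrow> (LBINT y. \<bar>K r y\<bar>) \<le> B"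
    and q [measurable]: "q \<in> borel_measurable borel" and qM: "\<And>x. \<bar>q x\<bar> \<le> M"
  shows "(LBINT r. indicator {a..b} r * (LBINT y. K r y * q y)) = (LBINT y. (LBINT r. K r y * indicator {a..b} r) * q y)"
proof -
  have M0: "M \<ge> 0" using qM[of 0] by linarith
  define F where "F r y = indicator {a..b} r * (K r y * q y)" for r y
  have [measurable]: "case_prod F \<in> borel_measurable (borel \<Otimes>\<^sub>M borel)"
  proof -
    have "case_prod F = (\<lambda>z. indicator {a..b} (fst z) * (case_prod K z * q (snd z)))"
      by (auto simp: F_def)
    then show ?thesis by simp
  qed
  have int: "integrable lborel (F r)" for r
  proof (cases "r \<in> {a..b}")
    case True
    have "integrable lborel (\<lambda>y. q y * K r y)" by (rule integrable_bounded_mult[OF q qM i[OF True]])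
    then show ?thesis using True by (simp add: F_def [abs_def] mult.commute)
  qed (simp add: F_def [abs_def])
  have "integrable (lborel \<Otimes>\<^sub>M lborel) (case_prod F)"
  proof (rule lborel_pair.Fubini_integrable)
    show "integrable lborel (\<lambda>r. \<integral>y. norm (case (r, y) of (r, y) \<Rightarrow> F r y) \<partial>lborel)"
    proof (rule Bochner_Integration.integrable_bound)
      show "integrable lborel (\<lambda>r. M * B * indicator {a..b} r)"
        by (intro integrable_mult_right integrable_real_indicator) (auto simp: emeasure_lborel_Icc_eq)
      have "(\<lambda>r. \<integral>y. norm (F r y) \<partial>lborel) \<in> borel_measurable borel"
        by (rule lborel.borel_measurable_lebesgue_integral) measurable
      then show "(\<lambda>r. \<integral>y. norm (case (r, y) of (r, y) \<Rightarrow> F r y) \<partial>lborel) \<in> borel_measurable lborel" by simp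
      show "AE r in lborel. norm (LBINT y. norm (case (r, y) of (r, y) \<Rightarrow> F r y)) \<le> norm (M * B * indicator {a..b} r)"
      proof (rule AE_I2)
        fix r :: real
        show "norm (LBINT y. norm (case (r, y) of (r, y) \<Rightarrow> F r y)) \<le> norm (M * B * indicator {a..b} r)"
        proof (cases "r \<in> {a..b}")
          case True
          have "(LBINT y. norm (F r y)) \<le> (LBINT y. M * \<bar>K r y\<bar>)"
          proof (rule integral_mono[OF integrable_norm[OF int] integrable_mult_right[OF integrable_abs[OF i[OF True]]]])
            show "norm (F r y) \<le> M * \<bar>K r y\<bar>" for y
              using True mult_right_mono[OF qM, of "\<bar>K r y\<bar>" y] by (simp add: F_def abs_mult mult.commute)
          qed
          also have "\<dots> \<le> M * B" using bd[OF True] M0 by (simp add: mult_left_mono)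
          finally have *: "(LBINT y. norm (F r y)) \<le> M * B" .
          have "0 \<le> (LBINT y. norm (F r y))" by simp
          with * show ?thesis using True by simp
        qed (simp add: F_def)
      qed
    qed
    show "AE r in lborel. integrable lborel (\<lambda>y. case (r, y) of (r, y) \<Rightarrow> F r y)" using int by simp
  qed simp
  from lborel_pair.Fubini_integral[OF this]
  have "(LBINT r. \<integral>y. F r y \<partial>lborel) = (LBINT y. \<integral>r. F r y \<partial>lborel)" by simp
  moreover have "(LBINT y. F r y) = indicator {a..b} r * (LBINT y. K r y * q y)" for r
    by (simp add: F_def)
  moreover have "(LBINT r. F r y) = (LBINT r. K r y * indicator {a..b} r) * q y" for y
  proof -
    have "(LBINT r. F r y) = (LBINT r. (K r y * indicator {a..b} r) * q y)"
      by (simp add: F_def mult_ac)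
    then show ?thesis by simp
  qed
  ultimately show ?thesis by simp
qed

lemma smear_heat_x_FTC:
  assumes q: "q \<in> borel_measurable borel" "\<And>x. \<bar>q x\<bar> \<le> M" and t: "0 < t1" "t1 \<le> t2"
  shows "(LBINT r. indicator {t1..t2} r * (smear (heat_xt 1) q r x / (r * sqrt r)))
     = smear (heat_x 1) q t2 x / sqrt t2 - smear (heat_x 1) q t1 x / sqrt t1"
proof -
  have t2: "0 < t2" using t by simp
  have "(LBINT r. indicator {t1..t2} r * (smear (heat_xt 1) q r x / (r * sqrt r)))
    = (LBINT r. indicator {t1..t2} r * (LBINT y. heat_xt r (x - y) * q y))"
    using t by (intro Bochner_Integration.integral_cong) (auto simp: indicator_def smear_heat[OF q])
  also have "\<dots> = (LBINT y. (LBINT r. heat_xt r (x - y) * indicator {t1..t2} r) * q y)"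
  \<comment> \<open>The integral of \<open>\<bar>heat_xt r\<bar>\<close> is proportional to
    \<open>1 / (r * sqrt r)\<close>, hence largest at the lower end \<open>t1\<close>.\<close>
  proof (rule integral_parametric_kernel[OF _ _ _ q, where B="(LBINT z. \<bar>heat_xt 1 z\<bar>) / (t1 * sqrt t1)"])
    fix r assume r: "r \<in> {t1..t2}"
    then have r0: "r > 0" using t by simp
    show "integrable lborel (\<lambda>y. heat_xt r (x - y))"
      using lborel_integrable_real_affine[OF heat_integrable(3)[OF r0], of "-1" x] by simp
    have "(LBINT y. \<bar>heat_xt r (x - y)\<bar>) = sqrt r / r\<^sup>2 * (LBINT z. \<bar>heat_xt 1 z\<bar>)"
      unfolding integral_abs_shift
      using scaled_convolution(4)[OF r0 heat_scale(3)[OF r0] _ heat_one_integrable(3), of "\<lambda>_. 0" 0] r0 by simp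
    also have "\<dots> = (LBINT z. \<bar>heat_xt 1 z\<bar>) / (r * sqrt r)"
      using r0 by (simp add: field_simps power2_eq_square)
    also have "\<dots> \<le> (LBINT z. \<bar>heat_xt 1 z\<bar>) / (t1 * sqrt t1)"
      using r r0 t by (intro divide_left_mono mult_mono mult_pos_pos) auto
    finally show "(LBINT y. \<bar>heat_xt r (x - y)\<bar>) \<le> (LBINT z. \<bar>heat_xt 1 z\<bar>) / (t1 * sqrt t1)" .
  qed simp
  also have "\<dots> = (LBINT y. (heat_x t2 (x - y) - heat_x t1 (x - y)) * q y)"
  proof -
    have "(LBINT r. heat_xt r (x - y) * indicator {t1..t2} r) = heat_x t2 (x - y) - heat_x t1 (x - y)" for y
    proof (rule integral_FTC_Icc_real[OF t(2)])
      fix r assume "t1 \<le> r" "r \<le> t2"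
      then show "((\<lambda>r. heat_x r (x - y)) has_real_derivative heat_xt r (x - y)) (at r)" using t heat_derivs(3)[of r "x - y"] by simp
    next
      fix r assume "t1 \<le> r" "r \<le> t2"
      then show "isCont (\<lambda>r. heat_xt r (x - y)) r"
        unfolding heat_xt_def heat_def using t by (intro continuous_intros) auto
    qed
    then show ?thesis by simp
  qed
  also have "\<dots> = (LBINT y. heat_x t2 (x - y) * q y - heat_x t1 (x - y) * q y)" by (simp add: left_diff_distrib)
  also have "\<dots> = (LBINT y. heat_x t2 (x - y) * q y) - (LBINT y. heat_x t1 (x - y) * q y)"
    using integrable_shift_mult[OF heat_integrable(2)[OF t2] q] integrable_shift_mult[OF heat_integrable(2)[OF t(1)] q] by simp
  finally show ?thesis by (simp add: smear_heat[OF q t2] smear_heat[OF q t(1)])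
qed

lemma smear_heat_FTC_space:
  assumes q: "q \<in> borel_measurable borel" "\<And>x. \<bar>q x\<bar> \<le> M" and t: "0 < t" and xy: "x \<le> y"
  shows "(LBINT r. indicator {x..y} r * (smear (heat_x 1) q t r / sqrt t))
     = smear (heat 1) q t y - smear (heat 1) q t x"
proof -
  have "(LBINT r. indicator {x..y} r * (smear (heat_x 1) q t r / sqrt t))
    = (LBINT r. indicator {x..y} r * (LBINT w. heat_x t (r - w) * q w))"
    by (simp add: smear_heat[OF q t])
  also have "\<dots> = (LBINT w. (LBINT r. heat_x t (r - w) * indicator {x..y} r) * q w)"
  proof (rule integral_parametric_kernel[OF _ _ _ q])
    fix r :: real
    show "integrable lborel (\<lambda>y. heat_x t (r - y))"
      using lborel_integrable_real_affine[OF heat_integrable(2)[OF t], of "-1" r] by simp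
    show "(LBINT y. \<bar>heat_x t (r - y)\<bar>) \<le> (LBINT y. \<bar>heat_x t y\<bar>)" by (simp add: integral_abs_shift)
  qed simp
  also have "\<dots> = (LBINT w. (heat t (y - w) - heat t (x - w)) * q w)"
  proof -
    have "(LBINT r. heat_x t (r - w) * indicator {x..y} r) = heat t (y - w) - heat t (x - w)" for w
    proof (rule integral_FTC_Icc_real[OF xy])
      fix r
      have "((\<lambda>r. heat t (r - w)) has_real_derivative heat_x t (r - w) * 1) (at r)"
        by (rule DERIV_chain2[OF heat_derivs(1)[OF t]]) (auto intro!: derivative_eq_intros)
      then show "((\<lambda>r. heat t (r - w)) has_real_derivative heat_x t (r - w)) (at r)" by simp
      show "isCont (\<lambda>r. heat_x t (r - w)) r"
        unfolding heat_x_def heat_def using t by (intro continuous_intros) auto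
    qed
    then show ?thesis by simp
  qed
  also have "\<dots> = (LBINT w. heat t (y - w) * q w - heat t (x - w) * q w)" by (simp add: left_diff_distrib)
  also have "\<dots> = (LBINT w. heat t (y - w) * q w) - (LBINT w. heat t (x - w) * q w)"
    using integrable_shift_mult[OF heat_integrable(1)[OF t] q] by simp
  finally show ?thesis by (simp add: smear_heat[OF q t])
qed

section \<open>Subordination\<close>

text \<open>The superposition integral of \<open>has_bochner_integral_heat_subordination\<close> at
  \<open>h = 1\<close>; scaling supplies all other \<open>h\<close>.\<close>

definition heat_mass :: "real \<Rightarrow> real" where
  "heat_mass s = (LBINT t. indicator {0<..} t * (heat t 1 * t powr (- 1 - s)))"

lemma heat_mass_integrable:
  assumes s: "0 < s" "s < 1"
  shows "integrable lborel (\<lambda>t. indicator {0<..} t * (heat t 1 * t powr (- 1 - s)))" and "heat_mass s > 0"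
proof -
  let ?f = "\<lambda>t. indicator {0<..} t * (heat t 1 * t powr (- 1 - s))"
  have [measurable]: "(\<lambda>t. heat t 1) \<in> borel_measurable borel" unfolding heat_def by measurable
  show i: "integrable lborel ?f"
  proof (rule Bochner_Integration.integrable_bound)
    show "integrable lborel (\<lambda>t. 8 * (indicator {0..1} t *\<^sub>R t powr (1 / 2 - s)) + indicator {1..} t *\<^sub>R t powr (- 1 - s))"
      using set_integrable_powr_Icc01[of "1 / 2 - s"] set_integrable_powr_Ici1[of "- 1 - s"] s
      unfolding set_integrable_def by (intro Bochner_Integration.integrable_add integrable_mult_right) auto
    show "AE t in lborel. norm (?f t) \<le> norm (8 * (indicator {0..1} t *\<^sub>R t powr (1 / 2 - s)) + indicator {1..} t *\<^sub>R t powr (- 1 - s))"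
    proof (rule AE_I2)
      fix t :: real
      show "norm (?f t) \<le> norm (8 * (indicator {0..1} t *\<^sub>R t powr (1 / 2 - s)) + indicator {1..} t *\<^sub>R t powr (- 1 - s))"
      proof (cases "t > 0")
        case True
        have st: "sqrt t \<le> sqrt (2 * pi * t)" using True pi_gt3 by (intro real_sqrt_le_mono) simp
        have h: "heat t 1 \<le> exp (- 1 / (2 * t)) / sqrt t"
        proof -
          have "heat t 1 = exp (- 1 / (2 * t)) / sqrt (2 * pi * t)" by (simp add: heat_def)
          also have "\<dots> \<le> exp (- 1 / (2 * t)) / sqrt t" using True st by (intro divide_left_mono) auto
          finally show ?thesis .
        qed
        show ?thesis
        proof (cases "t \<le> 1")
          case le: True
          \<comment> \<open>The quadratic Taylor term of the exponential is
            \<open>1 / (8 * t\<^sup>2)\<close>. Hence the Gaussian factor is at most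
            \<open>8 * t\<^sup>2\<close>, which beats the singularity of
            \<open>t powr (- 1 - s)\<close> at 0.\<close>
          have "1 + 1 / (2 * t) + (1 / (2 * t))\<^sup>2 / 2 \<le> exp (1 / (2 * t))"
            using True by (intro exp_lower_Taylor_quadratic) simp
          then have "1 / (8 * t\<^sup>2) \<le> exp (1 / (2 * t))" using True
            by (simp add: power2_eq_square) (smt (verit) divide_nonneg_pos)
          then have "exp (- 1 / (2 * t)) \<le> 8 * t\<^sup>2" using True
            by (simp add: exp_minus field_simps)
          then have "heat t 1 \<le> 8 * t\<^sup>2 / sqrt t" using h True by (meson divide_right_mono order_trans real_sqrt_ge_zero less_imp_le)
          then have "heat t 1 * t powr (- 1 - s) \<le> 8 * t\<^sup>2 / sqrt t * t powr (- 1 - s)" by (intro mult_right_mono) auto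
          also have "\<dots> = 8 * (t powr 2 * t powr (- (1 / 2)) * t powr (- 1 - s))"
            using True by (simp add: powr_minus powr_half_sqrt field_simps)
          also have "\<dots> = 8 * t powr (1 / 2 - s)" by (simp only: powr_add[symmetric]) simp
          finally show ?thesis using True le heat_pos[OF True, of 1] by (simp add: add_increasing2)
        next
          case gt: False
          have "exp (- 1 / (2 * t)) / sqrt t \<le> 1 / 1" using gt by (intro frac_le) auto
          then have "heat t 1 * t powr (- 1 - s) \<le> 1 * t powr (- 1 - s)" using h by (intro mult_right_mono) auto
          then show ?thesis using True gt heat_pos[OF True, of 1] by simp
        qed
      qed simp
    qed
  qed measurable
  have n: "?f t \<ge> 0" for t using heat_pos[of t 1] by (auto simp: indicator_def less_imp_le)
  have "heat_mass s \<noteq> 0"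
  proof
    assume "heat_mass s = 0"
    then have "AE t in lborel. ?f t = 0"
      using integral_nonneg_eq_0_iff_AE[OF i] n unfolding heat_mass_def by blast
    then have "AE t in lborel. t \<notin> {1<..<2::real}"
    proof (rule eventually_mono)
      fix t assume "?f t = 0"
      then show "t \<notin> {1<..<2}" using heat_pos[of t 1] by auto
    qed
    then have "emeasure lborel {1<..<2::real} = 0"
      by (subst (asm) AE_iff_measurable[where N = "{1<..<2}"]) auto
    then show False by simp
  qed
  moreover have "heat_mass s \<ge> 0" unfolding heat_mass_def using n by (rule Bochner_Integration.integral_nonneg)
  ultimately show "heat_mass s > 0" by linarith
qed

lemma heat_scale_time:
  assumes "t > 0" "h \<noteq> 0"
  shows "heat (h\<^sup>2 * t) h = heat t 1 / \<bar>h\<bar>"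
proof -
  have "sqrt (2 * pi * (h\<^sup>2 * t)) = \<bar>h\<bar> * sqrt (2 * pi * t)" by (simp add: real_sqrt_mult mult_ac)
  moreover have "- h\<^sup>2 / (2 * (h\<^sup>2 * t)) = - 1\<^sup>2 / (2 * t)" using assms by simp
  ultimately show ?thesis unfolding heat_def by simp
qed

text \<open>Replacing the time by \<open>h\<^sup>2 * t\<close> yields
  \<open>\<bar>h\<bar> powr (- 1)\<close> from the kernel,
  \<open>\<bar>h\<bar> powr (- 2 - 2 * s)\<close> from the weight and \<open>h\<^sup>2\<close> from
  the measure.\<close>

lemma has_bochner_integral_heat_subordination:
  assumes s: "0 < s" "s < 1" and h: "h \<noteq> 0"
  shows "has_bochner_integral lborel (\<lambda>t. indicator {0<..} t * (heat t h * t powr (- 1 - s))) (heat_mass s / \<bar>h\<bar> powr (1 + 2 * s))"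
proof -
  let ?f = "\<lambda>h t. indicator {0<..} t * (heat t h * t powr (- 1 - s))"
  have "has_bochner_integral lborel (?f 1) (heat_mass s)"
    unfolding heat_mass_def by (rule has_bochner_integral_integrable[OF heat_mass_integrable(1)[OF s]])
  then have "has_bochner_integral lborel (\<lambda>t. (\<bar>h\<bar> powr (- 3 - 2 * s)) * ?f 1 t) (\<bar>h\<bar> powr (- 3 - 2 * s) * heat_mass s)"
    by (rule has_bochner_integral_mult_right)
  moreover have "\<bar>h\<bar> powr (- 3 - 2 * s) * ?f 1 t = ?f h (0 + h\<^sup>2 * t)" for t
  proof (cases "t > 0")
    case True
    have "h\<^sup>2 = \<bar>h\<bar> powr 2" using h by simp
    then have "(h\<^sup>2 * t) powr (- 1 - s) = \<bar>h\<bar> powr (2 * (- 1 - s)) * t powr (- 1 - s)"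
      by (simp only: powr_mult powr_powr)
    then have "?f h (0 + h\<^sup>2 * t) = heat t 1 * t powr (- 1 - s) * (\<bar>h\<bar> powr (2 * (- 1 - s)) / \<bar>h\<bar>)"
      using True h by (simp add: heat_scale_time[OF True h])
    also have "\<bar>h\<bar> powr (2 * (- 1 - s)) / \<bar>h\<bar> = \<bar>h\<bar> powr (2 * (- 1 - s) - 1)"
      using h by (subst powr_diff) simp
    finally show ?thesis using True by (simp add: algebra_simps)
  qed (use h in \<open>auto simp: indicator_def zero_less_mult_iff\<close>)
  ultimately have "has_bochner_integral lborel (\<lambda>t. ?f h (0 + h\<^sup>2 * t)) (\<bar>h\<bar> powr (- 3 - 2 * s) * heat_mass s)" by simp
  also have "\<bar>h\<bar> powr (- 3 - 2 * s) * heat_mass s = (heat_mass s / \<bar>h\<bar> powr (1 + 2 * s)) /\<^sub>R \<bar>h\<^sup>2\<bar>"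
  proof -
    have "\<bar>h\<bar> powr (- 3 - 2 * s) = inverse (\<bar>h\<bar> powr (1 + 2 * s)) * \<bar>h\<bar> powr (- 2)"
      by (simp only: powr_minus[symmetric] powr_add[symmetric]) simp
    also have "\<bar>h\<bar> powr (- 2) = 1 / h\<^sup>2" using h by (simp add: powr_minus divide_inverse)
    finally show ?thesis by (simp add: divide_inverse)
  qed
  finally show ?thesis
    using h by (subst lborel_has_bochner_integral_real_affine_iff[of "h\<^sup>2" _ _ 0]) auto
qed

section \<open>Gaussian products and the heat semigroup\<close>

lemma heat_product:
  assumes \<tau>: "\<tau> > 0" and t: "t > 0"
  shows "heat \<tau> (x0 - y) * heat t (x - y) = heat (\<tau> + t) (x0 - x) *
    normal_density ((t * x0 + \<tau> * x) / (\<tau> + t)) (sqrt (\<tau> * t / (\<tau> + t))) y"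
proof -
  have p: "\<tau> + t > 0" "\<tau> * t / (\<tau> + t) > 0" using assms by auto
  \<comment> \<open>Completing the square in \<open>y\<close>: mean and variance are those of the
    Gaussian bridge from \<open>x0\<close> to \<open>x\<close> at time \<tau>.\<close>
  have e: "- (x0 - y)\<^sup>2 / (2 * \<tau>) + - (x - y)\<^sup>2 / (2 * t) = - (x0 - x)\<^sup>2 / (2 * (\<tau> + t))
      + - (y - (t * x0 + \<tau> * x) / (\<tau> + t))\<^sup>2 / (2 * (\<tau> * t / (\<tau> + t)))"
    using assms p(1) by (simp add: divide_simps) (simp add: power2_eq_square algebra_simps)
  have r: "sqrt (2 * pi * \<tau>) * sqrt (2 * pi * t) = sqrt (2 * pi * (\<tau> + t)) * sqrt (2 * pi * (\<tau> * t / (\<tau> + t)))"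
    using p(1) by (simp only: real_sqrt_mult[symmetric]) (simp add: field_simps)
  have "heat \<tau> (x0 - y) * heat t (x - y) = exp (- (x0 - y)\<^sup>2 / (2 * \<tau>) + - (x - y)\<^sup>2 / (2 * t)) / (sqrt (2 * pi * \<tau>) * sqrt (2 * pi * t))"
    by (simp only: heat_def exp_add times_divide_times_eq)
  also have "\<dots> = heat (\<tau> + t) (x0 - x) * (exp (- (y - (t * x0 + \<tau> * x) / (\<tau> + t))\<^sup>2 / (2 * (\<tau> * t / (\<tau> + t)))) / sqrt (2 * pi * (\<tau> * t / (\<tau> + t))))"
    unfolding e r by (simp only: heat_def exp_add times_divide_times_eq)
  also have "exp (- (y - (t * x0 + \<tau> * x) / (\<tau> + t))\<^sup>2 / (2 * (\<tau> * t / (\<tau> + t)))) / sqrt (2 * pi * (\<tau> * t / (\<tau> + t)))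
     = normal_density ((t * x0 + \<tau> * x) / (\<tau> + t)) (sqrt (\<tau> * t / (\<tau> + t))) y"
    using p(2) unfolding normal_density_def by simp
  finally show ?thesis .
qed

text \<open>As \<open>heat_x\<close> is a linear factor times \<open>heat\<close>, only the mean of
  the Gaussian in \<open>heat_product\<close> enters. A further heat step applied to the test
  function thus becomes a shift of its time parameter.\<close>

lemma heat_x_convolution:
  assumes \<tau>: "\<tau> > 0" and t: "t > 0"
  shows "(LBINT y. heat_x \<tau> (x0 - y) * heat t (x - y)) = heat_x (\<tau> + t) (x0 - x)"
proof -
  define m where "m = (t * x0 + \<tau> * x) / (\<tau> + t)"
  define \<sigma> where "\<sigma> = sqrt (\<tau> * t / (\<tau> + t))"
  have \<sigma>: "\<sigma> > 0" using assms by (simp add: \<sigma>_def)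
  have "(LBINT y. heat_x \<tau> (x0 - y) * heat t (x - y)) = (LBINT y. (heat (\<tau> + t) (x0 - x) / \<tau>) * (normal_density m \<sigma> y * y - x0 * normal_density m \<sigma> y))"
  proof (intro Bochner_Integration.integral_cong refl)
    fix y
    have "heat_x \<tau> (x0 - y) * heat t (x - y) = - ((x0 - y) / \<tau>) * (heat \<tau> (x0 - y) * heat t (x - y))"
      by (simp add: heat_x_def)
    also have "\<dots> = - ((x0 - y) / \<tau>) * (heat (\<tau> + t) (x0 - x) * normal_density m \<sigma> y)"
      unfolding heat_product[OF assms] m_def \<sigma>_def ..
    finally show "heat_x \<tau> (x0 - y) * heat t (x - y) = (heat (\<tau> + t) (x0 - x) / \<tau>) * (normal_density m \<sigma> y * y - x0 * normal_density m \<sigma> y)"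
      using \<tau> by (simp add: field_simps)
  qed
  also have "\<dots> = (heat (\<tau> + t) (x0 - x) / \<tau>) * (m - x0)"
    using \<sigma> integral_normal_moment_nz_1[OF \<sigma>, of m] integrable_normal_moment_nz_1[OF \<sigma>, of m] by simp
  also have "(heat (\<tau> + t) (x0 - x) / \<tau>) * (m - x0) = heat_x (\<tau> + t) (x0 - x)"
  proof -
    have "m - x0 = - (\<tau> * (x0 - x) / (\<tau> + t))"
      using assms unfolding m_def by (simp add: field_simps)
    then show ?thesis using \<tau> by (simp add: heat_x_def)
  qed
  finally show ?thesis .
qed

lemma integrable_convolution_pair:
  fixes f k :: "real \<Rightarrow> real"
  assumes f: "integrable lborel f" and k: "integrable lborel k"
  shows "integrable (lborel \<Otimes>\<^sub>M lborel) (\<lambda>(x, y). f x * k (x - y))"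
proof (rule lborel_pair.Fubini_integrable)
  have [measurable]: "f \<in> borel_measurable borel" "k \<in> borel_measurable borel" using f k by auto
  show "(\<lambda>(x, y). f x * k (x - y)) \<in> borel_measurable (lborel \<Otimes>\<^sub>M lborel)" by measurable
  have "(LBINT y. norm (case (x, y) of (x, y) \<Rightarrow> f x * k (x - y))) = \<bar>f x\<bar> * (LBINT y. \<bar>k y\<bar>)" for x
    by (simp add: abs_mult integral_abs_shift)
  then show "integrable lborel (\<lambda>x. \<integral>y. norm (case (x, y) of (x, y) \<Rightarrow> f x * k (x - y)) \<partial>lborel)"
    using f by simp
  show "AE x in lborel. integrable lborel (\<lambda>y. case (x, y) of (x, y) \<Rightarrow> f x * k (x - y))"
    using lborel_integrable_real_affine[OF k, of "-1"] by simp
qed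

text \<open>Of the four terms of the expanded product, the two diagonal ones equal the integral of
  \<open>\<phi> * q\<close> because \<open>k\<close> has mass 1, and the two cross terms agree
  because \<open>k\<close> is even. As \<open>q\<close> is merely bounded, each term takes its
  integrability from \<phi> and \<open>k\<close>.\<close>

lemma bilinear_even_kernel:
  fixes q \<phi> k :: "real \<Rightarrow> real"
  assumes q: "q \<in> borel_measurable borel" "\<And>x. \<bar>q x\<bar> \<le> M" and \<phi>: "integrable lborel \<phi>"
    and k: "integrable lborel k" "\<And>h. k (- h) = k h" "(LBINT h. k h) = 1"
  shows "(\<integral>z. (q (fst z) - q (snd z)) * (\<phi> (fst z) - \<phi> (snd z)) * k (fst z - snd z) \<partial>(lborel \<Otimes>\<^sub>M lborel))
    = 2 * ((LBINT x. \<phi> x * q x) - (LBINT x. (LBINT y. \<phi> y * k (x - y)) * q x))"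
proof -
  have [measurable]: "q \<in> borel_measurable borel" "\<phi> \<in> borel_measurable borel" "k \<in> borel_measurable borel"
    using q \<phi> k by auto
  let ?M = "lborel \<Otimes>\<^sub>M lborel :: (real \<times> real) measure"
  have sym: "k (x - y) = k (y - x)" for x y using k(2)[of "x - y"] by simp
  have f: "integrable lborel (\<lambda>x. \<phi> x * q x)"
    using integrable_bounded_mult[OF q \<phi>] by (simp add: mult.commute)
  have ksh: "(LBINT y. k (x - y)) = 1" for x
    using lborel_integral_real_affine[of "-1" "\<lambda>y. k (x - y)" x] k(3) by simp
  have bm: "integrable ?M (\<lambda>z. g z * h z)" if "integrable ?M h" "g \<in> borel_measurable ?M" "\<And>z. \<bar>g z\<bar> \<le> M" for g h
  proof (rule Bochner_Integration.integrable_bound)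
    show "integrable ?M (\<lambda>z. M * h z)" using that by simp
    have "M \<ge> 0" using q(2)[of 0] by linarith
    then show "AE z in ?M. norm (g z * h z) \<le> norm (M * h z)"
      using that(3) by (intro AE_I2) (auto simp: abs_mult intro: mult_right_mono)
  qed (use that in simp)
  note i1 = integrable_convolution_pair[OF f k(1)]
  note i2 = integrable_convolution_pair[OF \<phi> k(1)]
  note i1' = lborel_pair.integrable_product_swap[OF i1]
  note i2' = lborel_pair.integrable_product_swap[OF i2]
  have I1: "integrable ?M (\<lambda>(x, y). \<phi> x * q x * k (x - y))" using i1 by simp
  have I4: "integrable ?M (\<lambda>(x, y). \<phi> y * q y * k (x - y))" using i1' by (simp add: sym[of "fst _"] case_prod_unfold)
  have I2: "integrable ?M (\<lambda>(x, y). q x * (\<phi> y * k (x - y)))"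
  proof -
    have "integrable ?M (\<lambda>z. \<phi> (snd z) * k (fst z - snd z))" using i2' by (simp add: case_prod_unfold) (simp add: sym)
    from bm[OF this, of "\<lambda>z. q (fst z)"] q show ?thesis by (simp add: case_prod_unfold)
  qed
  have I3: "integrable ?M (\<lambda>(x, y). q y * (\<phi> x * k (x - y)))"
  proof -
    have "integrable ?M (\<lambda>z. \<phi> (fst z) * k (fst z - snd z))" using i2 by (simp add: case_prod_unfold)
    from bm[OF this, of "\<lambda>z. q (snd z)"] q show ?thesis by (simp add: case_prod_unfold)
  qed
  have v1: "(\<integral>z. (case z of (x, y) \<Rightarrow> \<phi> x * q x * k (x - y)) \<partial>?M) = (LBINT x. \<phi> x * q x)"
    using lborel_pair.integral_fst[OF I1] by (simp add: ksh)
  have v4: "(\<integral>z. (case z of (x, y) \<Rightarrow> \<phi> y * q y * k (x - y)) \<partial>?M) = (LBINT x. \<phi> x * q x)"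
    using lborel_pair.integral_snd[OF I4] by (simp add: sym ksh)
  have v2: "(\<integral>z. (case z of (x, y) \<Rightarrow> q x * (\<phi> y * k (x - y))) \<partial>?M) = (LBINT x. (LBINT y. \<phi> y * k (x - y)) * q x)"
    using lborel_pair.integral_fst[OF I2] by (simp add: mult.commute)
  have v3: "(\<integral>z. (case z of (x, y) \<Rightarrow> q y * (\<phi> x * k (x - y))) \<partial>?M) = (LBINT x. (LBINT y. \<phi> y * k (x - y)) * q x)"
    using lborel_pair.integral_snd[OF I3] by (simp add: mult.commute sym)
  have "(\<integral>z. (q (fst z) - q (snd z)) * (\<phi> (fst z) - \<phi> (snd z)) * k (fst z - snd z) \<partial>?M)
    = (\<integral>z. ((case z of (x, y) \<Rightarrow> \<phi> x * q x * k (x - y)) + (case z of (x, y) \<Rightarrow> \<phi> y * q y * k (x - y)))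
      - ((case z of (x, y) \<Rightarrow> q x * (\<phi> y * k (x - y))) + (case z of (x, y) \<Rightarrow> q y * (\<phi> x * k (x - y)))) \<partial>?M)"
    by (intro Bochner_Integration.integral_cong) (auto simp: algebra_simps)
  also have "\<dots> = ((LBINT x. \<phi> x * q x) + (LBINT x. \<phi> x * q x))
      - ((LBINT x. (LBINT y. \<phi> y * k (x - y)) * q x) + (LBINT x. (LBINT y. \<phi> y * k (x - y)) * q x))"
    using I1 I2 I3 I4 by (simp add: v1 v2 v3 v4 del: split_beta)
  finally show ?thesis by simp
qed

text \<open>With the singular kernel written as a superposition of heat kernels and the integrals
  exchanged, each heat time \<open>t\<close> contributes twice the decrease of \<open>P\<close> from
  \<tau> to \<tau> + t, by the semigroup property. The right-hand side is the Marchaud derivative of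
  \<open>P\<close> in time, up to a constant.\<close>

lemma marchaud_equation:
  fixes q :: "real \<Rightarrow> real"
  assumes s: "0 < s" "s < 1" and q: "continuous_on UNIV q" "\<And>x. \<bar>q x\<bar> \<le> M" "gag s q < \<infinity>"
    and \<phi>: "admissible s (\<lambda>y. heat_x \<tau> (x - y))" and \<tau>: "\<tau> > 0"
  defines "P \<equiv> \<lambda>t. smear (heat_x 1) q t x / sqrt t"
  shows "heat_mass s * cform s q (\<lambda>y. heat_x \<tau> (x - y)) = 2 * (LBINT t. indicator {0<..} t * ((P \<tau> - P (\<tau> + t)) * t powr (- 1 - s)))"
proof -
  define \<phi> where "\<phi> y = heat_x \<tau> (x - y)" for y
  have qm [measurable]: "q \<in> borel_measurable borel" by (rule borel_measurable_continuous_onI[OF q(1)])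
  have \<phi>c: "continuous_on UNIV \<phi>" "gag s \<phi> < \<infinity>" "integrable lborel \<phi>"
    using \<phi> by (auto simp: admissible_def \<phi>_def [abs_def])
  have [measurable]: "\<phi> \<in> borel_measurable borel" using \<phi>c by (intro borel_measurable_continuous_onI)
  define D where "D z = (q (fst z) - q (snd z)) * (\<phi> (fst z) - \<phi> (snd z))" for z :: "real \<times> real"
  define m where "m = heat_mass s"
  define W where "W z t = D z * (indicator {0<..} t * (heat t (fst z - snd z) * t powr (- 1 - s)))" for z t
  have [measurable]: "D \<in> borel_measurable (borel \<Otimes>\<^sub>M borel)" unfolding D_def [abs_def] by measurable
  have [measurable]: "(\<lambda>(z, t). W z t) \<in> borel_measurable (borel \<Otimes>\<^sub>M borel)"
    unfolding W_def heat_def by (simp add: borel_prod[symmetric], measurable)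
  have inner: "has_bochner_integral lborel (W z) (m * (D z / \<bar>fst z - snd z\<bar> powr (1 + 2 * s)))"
    and inner_abs: "(LBINT t. norm (W z t)) = m * norm (D z / \<bar>fst z - snd z\<bar> powr (1 + 2 * s))" for z
  proof -
    have *: "has_bochner_integral lborel (W z) (m * (D z / \<bar>fst z - snd z\<bar> powr (1 + 2 * s))) \<and>
      (LBINT t. norm (W z t)) = m * norm (D z / \<bar>fst z - snd z\<bar> powr (1 + 2 * s))"
    \<comment> \<open>On the diagonal \<open>D z = 0\<close>, so both claims read 0 = 0.\<close>
    proof (cases "fst z = snd z")
      case False
      then have h: "fst z - snd z \<noteq> 0" by simp
      note hb = has_bochner_integral_heat_subordination[OF s h]
      have 1: "has_bochner_integral lborel (W z) (D z * (m / \<bar>fst z - snd z\<bar> powr (1 + 2 * s)))"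
        unfolding W_def [abs_def] m_def by (intro has_bochner_integral_mult_right hb)
      have "(LBINT t. norm (W z t)) = (LBINT t. \<bar>D z\<bar> * (indicator {0<..} t * (heat t (fst z - snd z) * t powr (- 1 - s))))"
        by (intro Bochner_Integration.integral_cong) (auto simp: W_def abs_mult indicator_def abs_of_pos[OF heat_pos])
      also have "\<dots> = \<bar>D z\<bar> * (m / \<bar>fst z - snd z\<bar> powr (1 + 2 * s))"
        by (simp only: integral_mult_right_zero has_bochner_integral_integral_eq[OF hb] m_def)
      finally show ?thesis using 1 by (simp add: mult_ac abs_divide)
    qed (simp add: D_def W_def [abs_def] has_bochner_integral_zero)
    then show "has_bochner_integral lborel (W z) (m * (D z / \<bar>fst z - snd z\<bar> powr (1 + 2 * s)))"
      "(LBINT t. norm (W z t)) = m * norm (D z / \<bar>fst z - snd z\<bar> powr (1 + 2 * s))" by auto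
  qed
  have Dint: "integrable lborel (\<lambda>z::real \<times> real. D z / \<bar>fst z - snd z\<bar> powr (1 + 2 * s))"
    using cform_integrable[OF q(1,3) \<phi>c(1,2)] by (simp add: D_def lborel_prod)
  \<comment> \<open>Positivity of the heat kernel makes the absolute inner integrals reproduce the
    singular kernel, so integrability is that of the integrand of \<open>cform\<close>.\<close>
  have hint: "integrable (lborel \<Otimes>\<^sub>M lborel) (\<lambda>(z, t). W z t)"
  proof (rule lborel_pair.Fubini_integrable)
    show "integrable lborel (\<lambda>z. \<integral>t. norm (case (z, t) of (z, t) \<Rightarrow> W z t) \<partial>lborel)"
      using integrable_norm[OF Dint] by (simp only: prod.case inner_abs) (rule integrable_mult_right)
    show "AE z in lborel. integrable lborel (\<lambda>t. case (z, t) of (z, t) \<Rightarrow> W z t)"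
      using inner by (auto simp: has_bochner_integral_iff)
  qed (simp add: measurable_lborel1)
  have "m * cform s q \<phi> = (LBINT z. \<integral>t. W z t \<partial>lborel)"
    unfolding cform_def lborel_prod by (simp add: has_bochner_integral_integral_eq[OF inner] D_def del: times_divide_eq_right)
  also have "\<dots> = (LBINT t. \<integral>z. W z t \<partial>lborel)"
    using lborel_pair.Fubini_integral[OF hint] by simp
  also have "\<dots> = (LBINT t. 2 * (indicator {0<..} t * ((P \<tau> - P (\<tau> + t)) * t powr (- 1 - s))))"
  proof (intro Bochner_Integration.integral_cong refl)
    fix t :: real
    show "(LBINT z. W z t) = 2 * (indicator {0<..} t * ((P \<tau> - P (\<tau> + t)) * t powr (- 1 - s)))"
    proof (cases "t > 0")
      case True
      have "(LBINT z. W z t) = (\<integral>z. t powr (- 1 - s) * (D z * heat t (fst z - snd z)) \<partial>(lborel \<Otimes>\<^sub>M lborel))"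
        using True by (simp add: W_def lborel_prod mult_ac)
      also have "\<dots> = t powr (- 1 - s) * (\<integral>z. D z * heat t (fst z - snd z) \<partial>(lborel \<Otimes>\<^sub>M lborel))" by simp
      also have "(\<integral>z. D z * heat t (fst z - snd z) \<partial>(lborel \<Otimes>\<^sub>M lborel)) = 2 * ((LBINT x. \<phi> x * q x) - (LBINT x. (LBINT y. \<phi> y * heat t (x - y)) * q x))"
        unfolding D_def
      proof (rule bilinear_even_kernel[OF qm q(2) \<phi>c(3) heat_integrable(1)[OF True] heat_even])
        show "(LBINT h. heat t h) = 1"
          using True integral_normal_density[of "sqrt t" 0] by (simp add: heat_eq_normal_density[OF True])
      qed
      also have "(LBINT x. \<phi> x * q x) = P \<tau>"
        unfolding \<phi>_def P_def by (rule smear_heat(2)[OF qm q(2) \<tau>])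
      also have "(LBINT x. (LBINT y. \<phi> y * heat t (x - y)) * q x) = P (\<tau> + t)"
        unfolding \<phi>_def heat_x_convolution[OF \<tau> True] P_def using \<tau> True by (intro smear_heat(2)[OF qm q(2)]) simp
      finally show ?thesis using True by simp
    qed (simp add: W_def)
  qed
  finally show ?thesis by (simp add: m_def \<phi>_def [abs_def])
qed

section \<open>Inversion of the Marchaud derivative\<close>

text \<open>The exponents \<open>s - 1\<close> and \<open>- s\<close> add up to \<open>- 1\<close>,
  which the length of the interval compensates; that the value is free of \<sigma> is what makes the
  Marchaud derivative invertible by a power weight.\<close>

lemma has_bochner_integral_Beta_scaled:
  fixes s \<sigma> :: real
  assumes s: "0 < s" "s < 1" and \<sigma>: "\<sigma> > 0"
  shows "has_bochner_integral lborel (\<lambda>\<tau>. indicator {0<..<\<sigma>} \<tau> * (\<tau> powr (s - 1) * (\<sigma> - \<tau>) powr (- s))) (Beta s (1 - s))"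
proof -
  let ?f = "\<lambda>\<sigma> \<tau>. indicator {0<..<\<sigma>} \<tau> * (\<tau> powr (s - 1) * (\<sigma> - \<tau>) powr (- s))"
  have B: "Beta s (1 - s) \<ge> 0" using s by (simp add: Beta_def Gamma_real_pos less_imp_le)
  have "((\<lambda>t. t powr (s - 1) * (1 - t) powr (1 - s - 1)) has_integral Beta s (1 - s)) {0..1}"
    using s by (intro has_integral_Beta_real) auto
  then have "((\<lambda>t. t powr (s - 1) * (1 - t) powr (- s)) has_integral Beta s (1 - s)) {0<..<1}"
    by (simp add: has_integral_Icc_iff_Ioo)
  then have "((\<lambda>t. if t \<in> {0<..<1} then t powr (s - 1) * (1 - t) powr (- s) else 0) has_integral Beta s (1 - s)) UNIV"
    by (simp only: has_integral_restrict_UNIV)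
  also have "(\<lambda>t. if t \<in> {0<..<1} then t powr (s - 1) * (1 - t) powr (- s) else 0) = ?f 1"
    by (auto simp: fun_eq_iff indicator_def)
  finally have "(\<integral>\<^sup>+ t. ennreal (?f 1 t) \<partial>lborel) = ennreal (Beta s (1 - s))"
    by (intro nn_integral_has_integral_lborel) (auto simp: indicator_def)
  then have "has_bochner_integral lborel (?f 1) (Beta s (1 - s))"
    using B by (intro has_bochner_integral_nn_integral) auto
  then have "has_bochner_integral lborel (\<lambda>t. (1 / \<sigma>) * ?f 1 t) ((1 / \<sigma>) * Beta s (1 - s))"
    by (rule has_bochner_integral_mult_right)
  moreover have "(1 / \<sigma>) * ?f 1 t = ?f \<sigma> (0 + \<sigma> * t)" for t
  proof (cases "0 < t \<and> t < 1")
    case True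
    have "\<sigma> - \<sigma> * t = \<sigma> * (1 - t)" by (simp add: algebra_simps)
    then have "?f \<sigma> (0 + \<sigma> * t) = (\<sigma> powr (s - 1) * \<sigma> powr (- s)) * (t powr (s - 1) * (1 - t) powr (- s))"
      using True \<sigma> by (simp add: powr_mult mult_ac)
    also have "\<sigma> powr (s - 1) * \<sigma> powr (- s) = \<sigma> powr (- 1)" by (simp add: powr_add[symmetric])
    also have "\<dots> = 1 / \<sigma>" using \<sigma> by (simp add: powr_minus divide_inverse)
    finally show ?thesis using True by simp
  next
    case False
    then have "\<not> (0 < \<sigma> * t \<and> \<sigma> * t < \<sigma>)" using \<sigma> by (auto simp: zero_less_mult_iff)
    then show ?thesis using False by (auto simp: indicator_def)
  qed
  ultimately have "has_bochner_integral lborel (\<lambda>t. ?f \<sigma> (0 + \<sigma> * t)) (Beta s (1 - s) /\<^sub>R \<bar>\<sigma>\<bar>)"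
    using \<sigma> by (simp add: divide_inverse mult.commute)
  then show ?thesis using \<sigma> by (subst lborel_has_bochner_integral_real_affine_iff[of \<sigma> _ _ 0]) auto
qed

definition marchaud_const :: "real \<Rightarrow> real" where
  "marchaud_const s = Beta s (1 - s) / s"

text \<open>\<open>(\<sigma> - \<tau>) powr (- s) / s\<close> is the integral of
  \<open>t powr (- 1 - s)\<close> beyond \<open>\<sigma> - \<tau>\<close>. The cut at 1 reflects
  that only times \<tau> below 1 enter the inversion; for \<open>\<sigma> \<le> 1\<close> it is not
  felt.\<close>

definition marchaud_weight :: "real \<Rightarrow> real \<Rightarrow> real" where
  "marchaud_weight s \<sigma> = (LBINT \<tau>. indicator {0<..<min 1 \<sigma>} \<tau> * (\<tau> powr (s - 1) * ((\<sigma> - \<tau>) powr (- s) / s)))"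

lemma marchaud_weight_props:
  assumes s: "0 < s" "s < 1" and \<sigma>: "\<sigma> > 0"
  shows "integrable lborel (\<lambda>\<tau>. indicator {0<..<min 1 \<sigma>} \<tau> * (\<tau> powr (s - 1) * ((\<sigma> - \<tau>) powr (- s) / s)))"
    and "0 \<le> marchaud_weight s \<sigma>" and "marchaud_weight s \<sigma> \<le> marchaud_const s"
    and "\<sigma> \<le> 1 \<Longrightarrow> marchaud_weight s \<sigma> = marchaud_const s"
proof -
  let ?f = "\<lambda>\<tau>. indicator {0<..<min 1 \<sigma>} \<tau> * (\<tau> powr (s - 1) * ((\<sigma> - \<tau>) powr (- s) / s))"
  let ?g = "\<lambda>\<tau>. (1 / s) * (indicator {0<..<\<sigma>} \<tau> * (\<tau> powr (s - 1) * (\<sigma> - \<tau>) powr (- s)))"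
  have g: "has_bochner_integral lborel ?g (marchaud_const s)"
    unfolding marchaud_const_def using has_bochner_integral_mult_right[OF has_bochner_integral_Beta_scaled[OF assms], of "1 / s"] by simp
  have fg: "0 \<le> ?f \<tau>" "?f \<tau> \<le> ?g \<tau>" for \<tau> using s by (auto simp: indicator_def)
  show f: "integrable lborel ?f"
  proof (rule Bochner_Integration.integrable_bound)
    show "integrable lborel ?g" using g by (simp add: has_bochner_integral_iff)
    show "AE \<tau> in lborel. norm (?f \<tau>) \<le> norm (?g \<tau>)"
      using fg by (intro AE_I2) (metis abs_of_nonneg order_trans real_norm_def)
  qed measurable
  show "0 \<le> marchaud_weight s \<sigma>" unfolding marchaud_weight_def by (rule Bochner_Integration.integral_nonneg[OF fg(1)])
  show "marchaud_weight s \<sigma> \<le> marchaud_const s"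
    unfolding marchaud_weight_def has_bochner_integral_integral_eq[OF g, symmetric]
    by (rule integral_mono[OF f _ fg(2)]) (use g in \<open>auto simp: has_bochner_integral_iff\<close>)
  show "marchaud_weight s \<sigma> = marchaud_const s" if "\<sigma> \<le> 1"
    unfolding marchaud_weight_def has_bochner_integral_integral_eq[OF g, symmetric]
    using that by (intro Bochner_Integration.integral_cong) (auto simp: min_def)
qed

lemma marchaud_const_pos: "0 < s \<Longrightarrow> s < 1 \<Longrightarrow> marchaud_const s > 0"
  by (simp add: marchaud_const_def Beta_def Gamma_real_pos)

lemma nn_integral_powr_tail:
  assumes s: "0 < s" and e: "e > (0::real)"
  shows "(\<integral>\<^sup>+ t. ennreal (indicator {e..} t * t powr (- 1 - s)) \<partial>lborel) = ennreal (e powr (- s) / s)"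
proof -
  have "((\<lambda>t. t powr (- 1 - s)) has_integral - (e powr (- 1 - s + 1)) / (- 1 - s + 1)) {e..}"
    using s e by (intro has_integral_powr_to_inf) auto
  then have "((\<lambda>t. t powr (- 1 - s)) has_integral e powr (- s) / s) {e..}" by simp
  then have "((\<lambda>t. if t \<in> {e..} then t powr (- 1 - s) else 0) has_integral e powr (- s) / s) UNIV"
    by (simp only: has_integral_restrict_UNIV)
  also have "(\<lambda>t. if t \<in> {e..} then t powr (- 1 - s) else 0) = (\<lambda>t. indicator {e..} t * t powr (- 1 - s))"
    by (auto simp: fun_eq_iff indicator_def)
  finally show ?thesis by (intro nn_integral_has_integral_lborel) (auto simp: indicator_def)
qed

definition marchaud_kernel :: "real \<Rightarrow> real \<Rightarrow> real \<Rightarrow> real" where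
  "marchaud_kernel s \<tau> t = indicator {0<..<1} \<tau> * indicator {0<..} t * (\<tau> powr (s - 1) * t powr (- 1 - s))"

text \<open>For fixed \<sigma> the pairs counted are those whose interval from \<tau> to \<tau> + t
  contains \<sigma>; the value is the total coefficient that \<open>p' \<sigma>\<close> receives
  when the increments of \<open>p\<close> are written as integrals.\<close>

lemma marchaud_kernel_slice:
  assumes s: "0 < s" "s < 1" and \<sigma>: "\<sigma> > 0"
  shows "has_bochner_integral lborel (\<lambda>z::real \<times> real. marchaud_kernel s (fst z) (snd z) * indicator {fst z<..fst z + snd z} \<sigma>) (marchaud_weight s \<sigma>)"
proof (rule has_bochner_integral_nn_integral)
  let ?F = "\<lambda>z::real \<times> real. marchaud_kernel s (fst z) (snd z) * indicator {fst z<..fst z + snd z} \<sigma>"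
  have F: "?F = (\<lambda>z. indicator {0<..<1} (fst z) * indicator {0<..} (snd z) * (fst z powr (s - 1) * snd z powr (- 1 - s)) * (if fst z < \<sigma> \<and> \<sigma> \<le> fst z + snd z then 1 else 0))"
    by (auto simp: marchaud_kernel_def fun_eq_iff)
  show meas: "?F \<in> borel_measurable lborel"
    unfolding F lborel_prod[symmetric] by measurable
  have nn: "?F z \<ge> 0" for z by (auto simp: marchaud_kernel_def)
  then show "AE z in lborel. 0 \<le> ?F z" by simp
  show "0 \<le> marchaud_weight s \<sigma>" by (rule marchaud_weight_props(2)[OF assms])
  have "(\<integral>\<^sup>+ z. ennreal (?F z) \<partial>lborel) = (\<integral>\<^sup>+ \<tau>. \<integral>\<^sup>+ t. ennreal (?F (\<tau>, t)) \<partial>lborel \<partial>lborel)"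
    using meas unfolding lborel_prod[symmetric] by (subst lborel.nn_integral_fst[symmetric]) auto
  also have "\<dots> = (\<integral>\<^sup>+ \<tau>. ennreal (indicator {0<..<min 1 \<sigma>} \<tau> * (\<tau> powr (s - 1) * ((\<sigma> - \<tau>) powr (- s) / s))) \<partial>lborel)"
  proof (rule nn_integral_cong)
    fix \<tau> :: real
    show "(\<integral>\<^sup>+ t. ennreal (?F (\<tau>, t)) \<partial>lborel) = ennreal (indicator {0<..<min 1 \<sigma>} \<tau> * (\<tau> powr (s - 1) * ((\<sigma> - \<tau>) powr (- s) / s)))"
    proof (cases "\<tau> \<in> {0<..<min 1 \<sigma>}")
      case True
      then have "(\<integral>\<^sup>+ t. ennreal (?F (\<tau>, t)) \<partial>lborel) = (\<integral>\<^sup>+ t. ennreal (\<tau> powr (s - 1)) * ennreal (indicator {\<sigma> - \<tau>..} t * t powr (- 1 - s)) \<partial>lborel)"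
        by (intro nn_integral_cong) (auto simp: marchaud_kernel_def indicator_def ennreal_mult[symmetric])
      also have "\<dots> = ennreal (\<tau> powr (s - 1)) * ennreal ((\<sigma> - \<tau>) powr (- s) / s)"
        using True s by (subst nn_integral_cmult) (auto simp: nn_integral_powr_tail)
      finally show ?thesis using True s by (simp add: ennreal_mult[symmetric])
    next
      case False
      then have "?F (\<tau>, t) = 0" for t by (auto simp: marchaud_kernel_def indicator_def)
      then show ?thesis using False by (simp only:) simp
    qed
  qed
  also have "\<dots> = ennreal (marchaud_weight s \<sigma>)"
    unfolding marchaud_weight_def using s by (intro nn_integral_eq_integral marchaud_weight_props(1)[OF assms]) auto
  finally show "(\<integral>\<^sup>+ z. ennreal (?F z) \<partial>lborel) = ennreal (marchaud_weight s \<sigma>)" .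
qed

text \<open>Inverting the Marchaud derivative: integrating it against \<open>\<tau>\<^sup>s\<^sup>-\<^sup>1\<close> and exchanging the order of
  integration, \<open>p'\<close> gets multiplied by \<open>marchaud_weight\<close>, which is constant on \<open>(0, 1]\<close>.\<close>
lemma marchaud_inversion:
  fixes p p' H :: "real \<Rightarrow> real"
  assumes s: "0 < s" "s < 1" and m [measurable]: "p' \<in> borel_measurable borel"
    and int: "integrable lborel (\<lambda>\<sigma>. indicator {0<..} \<sigma> * p' \<sigma>)"
    and ftc: "\<And>t1 t2. 0 \<le> t1 \<Longrightarrow> t1 \<le> t2 \<Longrightarrow> (LBINT r. indicator {t1<..t2} r * p' r) = p t2 - p t1"
    and eq: "\<And>\<tau>. \<tau> > 0 \<Longrightarrow> (LBINT t. indicator {0<..} t * ((p \<tau> - p (\<tau> + t)) * t powr (- 1 - s))) = H \<tau>"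
  shows "(LBINT \<tau>. indicator {0<..<1} \<tau> * (\<tau> powr (s - 1) * H \<tau>))
    = marchaud_const s * (p 0 - p 1) - (LBINT \<sigma>. indicator {1<..} \<sigma> * (p' \<sigma> * marchaud_weight s \<sigma>))"
proof -
  let ?N = "marchaud_weight s" and ?K = "marchaud_const s"
  \<comment> \<open>The increment of \<open>p\<close> between \<tau> and \<tau> + t is spread out as
    an integral of \<open>p'\<close>; the resulting function of three variables is integrated in
    both orders.\<close>
  define F where "F \<sigma> z = (indicator {0<..} \<sigma> * p' \<sigma>) * (marchaud_kernel s (fst z) (snd z) * indicator {fst z<..fst z + snd z} \<sigma>)" for \<sigma> and z :: "real \<times> real"
  have kern: "marchaud_kernel s (fst z) (snd z) * indicator {fst z<..fst z + snd z} \<sigma> = indicator {0<..<1} (fst z) * indicator {0<..} (snd z) * (fst z powr (s - 1) * snd z powr (- 1 - s)) * (if fst z < \<sigma> \<and> \<sigma> \<le> fst z + snd z then 1 else 0)" for \<sigma> and z :: "real \<times> real"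
    by (auto simp: marchaud_kernel_def)
  have Fm [measurable]: "case_prod F \<in> borel_measurable (borel \<Otimes>\<^sub>M borel)"
    unfolding F_def kern by (simp add: borel_prod[symmetric], measurable)
  have slice: "has_bochner_integral lborel (F \<sigma>) (indicator {0<..} \<sigma> * p' \<sigma> * ?N \<sigma>)"
    and slice_abs: "(LBINT z. norm (F \<sigma> z)) = \<bar>indicator {0<..} \<sigma> * p' \<sigma>\<bar> * (indicator {0<..} \<sigma> * ?N \<sigma>)" for \<sigma>
  proof -
    have "has_bochner_integral lborel (F \<sigma>) (indicator {0<..} \<sigma> * p' \<sigma> * ?N \<sigma>) \<and>
      (LBINT z. norm (F \<sigma> z)) = \<bar>indicator {0<..} \<sigma> * p' \<sigma>\<bar> * (indicator {0<..} \<sigma> * ?N \<sigma>)"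
    proof (cases "\<sigma> > 0")
      case True
      note k = marchaud_kernel_slice[OF s True]
      have 1: "has_bochner_integral lborel (F \<sigma>) (indicator {0<..} \<sigma> * p' \<sigma> * ?N \<sigma>)"
        unfolding F_def [abs_def] by (intro has_bochner_integral_mult_right k)
      have "(LBINT z. norm (F \<sigma> z)) = (LBINT z. \<bar>indicator {0<..} \<sigma> * p' \<sigma>\<bar> * (marchaud_kernel s (fst z) (snd z) * indicator {fst z<..fst z + snd z} \<sigma>))"
        by (intro Bochner_Integration.integral_cong) (auto simp: F_def abs_mult marchaud_kernel_def)
      also have "\<dots> = \<bar>indicator {0<..} \<sigma> * p' \<sigma>\<bar> * ?N \<sigma>"
        by (simp only: integral_mult_right_zero has_bochner_integral_integral_eq[OF k])
      finally show ?thesis using 1 True by simp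
    qed (simp add: F_def [abs_def] has_bochner_integral_zero)
    then show "has_bochner_integral lborel (F \<sigma>) (indicator {0<..} \<sigma> * p' \<sigma> * ?N \<sigma>)"
      "(LBINT z. norm (F \<sigma> z)) = \<bar>indicator {0<..} \<sigma> * p' \<sigma>\<bar> * (indicator {0<..} \<sigma> * ?N \<sigma>)" by auto
  qed
  have FI: "integrable (lborel \<Otimes>\<^sub>M lborel) (case_prod F)"
  proof (rule lborel_pair.Fubini_integrable)
    show "integrable lborel (\<lambda>\<sigma>. \<integral>z. norm (case (\<sigma>, z) of (\<sigma>, z) \<Rightarrow> F \<sigma> z) \<partial>lborel)"
    proof (rule Bochner_Integration.integrable_bound)
      show "integrable lborel (\<lambda>\<sigma>. ?K * \<bar>indicator {0<..} \<sigma> * p' \<sigma>\<bar>)" using integrable_abs[OF int] by (rule integrable_mult_right)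
      have "(\<lambda>\<sigma>. \<integral>z. norm (F \<sigma> z) \<partial>lborel) \<in> borel_measurable borel"
        by (rule lborel.borel_measurable_lebesgue_integral) measurable
      then show "(\<lambda>\<sigma>. \<integral>z. norm (case (\<sigma>, z) of (\<sigma>, z) \<Rightarrow> F \<sigma> z) \<partial>lborel) \<in> borel_measurable lborel" by simp
      show "AE \<sigma> in lborel. norm (LBINT z. norm (case (\<sigma>, z) of (\<sigma>, z) \<Rightarrow> F \<sigma> z)) \<le> norm (?K * \<bar>indicator {0<..} \<sigma> * p' \<sigma>\<bar>)"
      proof (rule AE_I2)
        fix \<sigma> :: real
        show "norm (LBINT z. norm (case (\<sigma>, z) of (\<sigma>, z) \<Rightarrow> F \<sigma> z)) \<le> norm (?K * \<bar>indicator {0<..} \<sigma> * p' \<sigma>\<bar>)"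
        proof (cases "\<sigma> > 0")
          case True
          have "\<bar>p' \<sigma>\<bar> * ?N \<sigma> \<le> \<bar>p' \<sigma>\<bar> * ?K"
            using marchaud_weight_props(3)[OF s True] by (intro mult_left_mono) auto
          then show ?thesis using True marchaud_weight_props(2)[OF s True] marchaud_const_pos[OF s]
            unfolding prod.case slice_abs by (simp add: abs_mult mult.commute)
        qed (simp only: prod.case slice_abs, simp)
      qed
    qed
    show "AE \<sigma> in lborel. integrable lborel (\<lambda>z. case (\<sigma>, z) of (\<sigma>, z) \<Rightarrow> F \<sigma> z)"
      using slice by (auto simp: has_bochner_integral_iff)
  qed simp
  define G where "G \<tau> t = marchaud_kernel s \<tau> t * (p (\<tau> + t) - p \<tau>)" for \<tau> t
  have Fz: "(LBINT \<sigma>. F \<sigma> z) = G (fst z) (snd z)" for z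
  proof (cases "fst z > 0 \<and> snd z > 0")
    case True
    have "(LBINT \<sigma>. F \<sigma> z) = (LBINT \<sigma>. marchaud_kernel s (fst z) (snd z) * (indicator {fst z<..fst z + snd z} \<sigma> * p' \<sigma>))"
      using True by (intro Bochner_Integration.integral_cong) (auto simp: F_def indicator_def)
    then show ?thesis using True ftc[of "fst z" "fst z + snd z"] by (simp add: G_def)
  qed (auto simp: F_def G_def marchaud_kernel_def)
  have GI: "integrable (lborel \<Otimes>\<^sub>M lborel) (\<lambda>(\<tau>, t). G \<tau> t)"
    using lborel_pair.integrable_snd[OF FI] by (simp add: Fz lborel_prod case_prod_unfold)
  have "(LBINT \<sigma>. indicator {0<..} \<sigma> * p' \<sigma> * ?N \<sigma>) = (LBINT \<sigma>. \<integral>z. F \<sigma> z \<partial>lborel)"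
    by (simp add: has_bochner_integral_integral_eq[OF slice])
  also have "\<dots> = (LBINT z. \<integral>\<sigma>. F \<sigma> z \<partial>lborel)"
    using lborel_pair.Fubini_integral[OF FI] by simp
  also have "\<dots> = (LBINT \<tau>. \<integral>t. G \<tau> t \<partial>lborel)"
    using lborel_pair.integral_fst[OF GI] by (simp add: Fz lborel_prod case_prod_unfold)
  also have "\<dots> = (LBINT \<tau>. - (indicator {0<..<1} \<tau> * (\<tau> powr (s - 1) * H \<tau>)))"
  proof (intro Bochner_Integration.integral_cong refl)
    fix \<tau> :: real
    show "(LBINT t. G \<tau> t) = - (indicator {0<..<1} \<tau> * (\<tau> powr (s - 1) * H \<tau>))"
    proof (cases "0 < \<tau> \<and> \<tau> < 1")
      case True
      then have "(LBINT t. G \<tau> t) = (LBINT t. (- (\<tau> powr (s - 1))) * (indicator {0<..} t * ((p \<tau> - p (\<tau> + t)) * t powr (- 1 - s))))"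
        by (intro Bochner_Integration.integral_cong) (auto simp: G_def marchaud_kernel_def algebra_simps)
      then show ?thesis using True eq[of \<tau>] by simp
    qed (auto simp: G_def marchaud_kernel_def)
  qed
  finally have main: "(LBINT \<tau>. indicator {0<..<1} \<tau> * (\<tau> powr (s - 1) * H \<tau>)) = - (LBINT \<sigma>. indicator {0<..} \<sigma> * p' \<sigma> * ?N \<sigma>)"
    by simp
  have iN: "integrable lborel (\<lambda>\<sigma>. indicator {0<..} \<sigma> * p' \<sigma> * ?N \<sigma>)"
    using lborel_pair.integrable_fst[OF FI] by (simp add: has_bochner_integral_integral_eq[OF slice])
  have i1: "integrable lborel (\<lambda>\<sigma>. indicator {1<..} \<sigma> * (p' \<sigma> * ?N \<sigma>))"
    using integrable_real_mult_indicator[OF _ iN, of "{1<..}"]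
    by (rule Bochner_Integration.integrable_cong[THEN iffD1, rotated -1]) (auto simp: indicator_def)
  have i2: "integrable lborel (\<lambda>\<sigma>. ?K * (indicator {0<..1} \<sigma> * p' \<sigma>))"
  proof (rule integrable_mult_right)
    show "integrable lborel (\<lambda>\<sigma>. indicator {0<..1} \<sigma> * p' \<sigma>)"
      using integrable_real_mult_indicator[OF _ int, of "{0<..1}"]
      by (rule Bochner_Integration.integrable_cong[THEN iffD1, rotated -1]) (auto simp: indicator_def)
  qed
  \<comment> \<open>Split at 1: below it the weight is constant and \<open>p'\<close> integrates to
    \<open>p 1 - p 0\<close>.\<close>
  have "(LBINT \<sigma>. indicator {0<..} \<sigma> * p' \<sigma> * ?N \<sigma>) = (LBINT \<sigma>. ?K * (indicator {0<..1} \<sigma> * p' \<sigma>) + indicator {1<..} \<sigma> * (p' \<sigma> * ?N \<sigma>))"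
    by (intro Bochner_Integration.integral_cong) (auto simp: indicator_def marchaud_weight_props(4)[OF s])
  also have "\<dots> = ?K * (p 1 - p 0) + (LBINT \<sigma>. indicator {1<..} \<sigma> * (p' \<sigma> * ?N \<sigma>))"
    using i1 i2 ftc[of 0 1] by simp
  finally show ?thesis using main by (simp add: algebra_simps)
qed

text \<open>The bound is free of \<open>t\<close> because, by scaling,
  \<open>heat_x t y * y\<^sup>2\<close> depends only on \<open>y / sqrt t\<close>. It controls the
  point source away from \<open>a\<close> down to time 0.\<close>

lemma heat_x_bound:
  assumes t: "t > 0" and y: "y \<noteq> 0"
  shows "\<bar>heat_x t y\<bar> \<le> 8 / y\<^sup>2"
proof -
  have one: "\<bar>heat_x 1 z\<bar> * z\<^sup>2 \<le> 8" for z
  proof -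
    \<comment> \<open>The last term is \<open>z ^ 4 / 8\<close>, whence the constant 8.\<close>
    have e: "1 + z\<^sup>2 / 2 + (z\<^sup>2 / 2)\<^sup>2 / 2 \<le> exp (z\<^sup>2 / 2)" by (rule exp_lower_Taylor_quadratic) simp
    have "\<bar>z\<bar> ^ 3 \<le> 1 + z ^ 4"
    proof (cases "\<bar>z\<bar> \<le> 1")
      case True
      then have "\<bar>z\<bar> ^ 3 \<le> 1" by (simp add: power_le_one)
      moreover have "0 \<le> z ^ 4" by simp
      ultimately show ?thesis by linarith
    next
      case False
      then have "\<bar>z\<bar> ^ 3 \<le> \<bar>z\<bar> ^ 4" by (intro power_increasing) auto
      then show ?thesis by simp
    qed
    also have "\<dots> \<le> 8 * (1 + z\<^sup>2 / 2 + (z\<^sup>2 / 2)\<^sup>2 / 2)"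
      by (simp add: power_divide power_mult[symmetric])
    also have "\<dots> \<le> 8 * exp (z\<^sup>2 / 2)" using e by simp
    finally have "\<bar>z\<bar> ^ 3 * exp (- z\<^sup>2 / 2) \<le> 8" by (simp add: exp_minus field_simps)
    moreover have "sqrt (2 * pi) \<ge> 1" using pi_gt3 by simp
    moreover have "\<bar>heat_x 1 z\<bar> * z\<^sup>2 = \<bar>z\<bar> ^ 3 * exp (- z\<^sup>2 / 2) / sqrt (2 * pi)"
      by (simp add: heat_x_def heat_def abs_mult power3_eq_cube power2_eq_square) 
    moreover have "\<bar>z\<bar> ^ 3 * exp (- z\<^sup>2 / 2) / sqrt (2 * pi) \<le> \<bar>z\<bar> ^ 3 * exp (- z\<^sup>2 / 2) / 1"
      using calculation(2) by (intro divide_left_mono) auto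
    ultimately show ?thesis by simp
  qed
  have "heat_x t y = heat_x 1 (y / sqrt t) / t" using heat_scale(2)[OF t, of "y / sqrt t"] t by simp
  then have "\<bar>heat_x t y\<bar> * y\<^sup>2 = \<bar>heat_x 1 (y / sqrt t)\<bar> * (y / sqrt t)\<^sup>2"
    using t by (simp add: abs_divide power_divide)
  also have "\<dots> \<le> 8" by (rule one)
  finally show ?thesis using y by (simp add: pos_le_divide_eq)
qed

text \<open>Decay of \<open>heat_x\<close> and its space derivative in the form that
  \<open>admissible_of_decay\<close> asks for, with a constant depending on
  \<open>t\<close>.\<close>

lemma heat_x_decay:
  assumes t: "t > 0"
  obtains A where "\<And>z. \<bar>heat_x t z\<bar> \<le> A / (1 + z\<^sup>2)" "\<And>z. \<bar>(z\<^sup>2 / t\<^sup>2 - 1 / t) * heat t z\<bar> \<le> A / (1 + z\<^sup>2)"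
proof -
  define A0 where "A0 = (2 + 8 * t) / t / sqrt (2 * pi * t)"
  define A where "A = (1 + t) * A0"
  have A0: "A0 \<ge> 0" using t by (simp add: A0_def)
  have main: "(z\<^sup>2 / t\<^sup>2 + 1 / t) * heat t z * (1 + z\<^sup>2) \<le> A0" for z
  proof -
    define w where "w = z\<^sup>2 / (2 * t)"
    have w: "w \<ge> 0" "z\<^sup>2 = 2 * t * w" using t by (auto simp: w_def)
    have "1 + w + w\<^sup>2 / 2 \<le> exp w" by (rule exp_lower_Taylor_quadratic[OF w(1)])
    \<comment> \<open>With the constant \<open>2 + 8 * t\<close>, the difference of the two sides
      has only nonnegative terms.\<close>
    moreover have "(1 + 2 * t * w) * (2 * w + 1) \<le> (2 + 8 * t) * (1 + w + w\<^sup>2 / 2)"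
    proof -
      have "(2 + 8 * t) * (1 + w + w\<^sup>2 / 2) - (1 + 2 * t * w) * (2 * w + 1) = 1 + 8 * t + 6 * (t * w) + w\<^sup>2"
        by (simp add: power2_eq_square algebra_simps)
      moreover have "0 \<le> 1 + 8 * t + 6 * (t * w) + w\<^sup>2" using t w by (intro add_nonneg_nonneg) auto
      ultimately show ?thesis by linarith
    qed
    moreover have "(2 + 8 * t) * (1 + w + w\<^sup>2 / 2) \<le> (2 + 8 * t) * exp w"
      using t calculation(1) by (intro mult_left_mono) auto
    ultimately have "(1 + 2 * t * w) * (2 * w + 1) \<le> (2 + 8 * t) * exp w" by linarith
    then have "(1 + 2 * t * w) * (2 * w + 1) * exp (- w) \<le> 2 + 8 * t" by (simp add: exp_minus field_simps)
    then have "(1 + 2 * t * w) * (2 * w + 1) * exp (- w) / (t * sqrt (2 * pi * t)) \<le> (2 + 8 * t) / (t * sqrt (2 * pi * t))"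
      using t by (intro divide_right_mono) auto
    moreover have "(z\<^sup>2 / t\<^sup>2 + 1 / t) * heat t z * (1 + z\<^sup>2) = (1 + 2 * t * w) * (2 * w + 1) * exp (- w) / (t * sqrt (2 * pi * t))"
    proof -
      have "z\<^sup>2 / t\<^sup>2 = 2 * w / t" using t unfolding w(2) by (simp add: power2_eq_square)
      then have "z\<^sup>2 / t\<^sup>2 + 1 / t = (2 * w + 1) / t" by (simp add: add_divide_distrib)
      moreover have "heat t z = exp (- w) / sqrt (2 * pi * t)" by (simp add: heat_def w_def)
      ultimately show ?thesis by (simp add: w(2) mult_ac)
    qed
    ultimately show ?thesis by (simp add: A0_def)
  qed
  have pos: "1 + z\<^sup>2 > 0" for z :: real by (simp add: add_pos_nonneg)
  have bd: "c * heat t z \<le> A / (1 + z\<^sup>2)" if "c \<le> (1 + t) * (z\<^sup>2 / t\<^sup>2 + 1 / t)" for c z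
  proof -
    have "c * heat t z * (1 + z\<^sup>2) \<le> (1 + t) * (z\<^sup>2 / t\<^sup>2 + 1 / t) * heat t z * (1 + z\<^sup>2)"
      using that heat_pos[OF t, of z] by (intro mult_right_mono) auto
    also have "\<dots> = (1 + t) * ((z\<^sup>2 / t\<^sup>2 + 1 / t) * heat t z * (1 + z\<^sup>2))" by (simp only: mult.assoc)
    also have "\<dots> \<le> A" unfolding A_def using main[of z] t by (intro mult_left_mono) auto
    finally show ?thesis using pos[of z] by (simp add: pos_le_divide_eq)
  qed
  show thesis
  proof (rule that[of A])
    fix z
    \<comment> \<open>The factor \<open>1 + t\<close> absorbs the constant 1 left over by
      \<open>2 * r \<le> r\<^sup>2 + 1\<close> for \<open>r = \<bar>z\<bar> / t\<close>.\<close>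
    have "\<bar>z\<bar> / t \<le> (1 + t) * (z\<^sup>2 / t\<^sup>2 + 1 / t)"
    proof -
      have "0 \<le> (\<bar>z\<bar> / t - 1)\<^sup>2" by simp
      then have "2 * (\<bar>z\<bar> / t) \<le> z\<^sup>2 / t\<^sup>2 + 1" by (simp add: power2_diff power_divide)
      moreover have "0 \<le> \<bar>z\<bar> / t" using t by simp
      ultimately have "\<bar>z\<bar> / t \<le> z\<^sup>2 / t\<^sup>2 + 1" by linarith
      also have "\<dots> \<le> (1 + t) * (z\<^sup>2 / t\<^sup>2 + 1 / t)"
      proof -
        have "(1 + t) * (X + Y) = (X + t * Y) + (Y + t * X)" for X Y by (simp add: algebra_simps)
        then show ?thesis using t by simp
      qed
      finally show ?thesis .
    qed
    from bd[OF this] show "\<bar>heat_x t z\<bar> \<le> A / (1 + z\<^sup>2)"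
      using heat_pos[OF t, of z] t by (simp add: heat_x_def abs_mult abs_divide)
    have n: "0 \<le> z\<^sup>2 / t\<^sup>2" "0 \<le> 1 / t" using t by auto
    have "\<bar>X - Y\<bar> \<le> X + Y" if "0 \<le> X" "0 \<le> Y" for X Y :: real using that by linarith
    from this[OF n] have "\<bar>z\<^sup>2 / t\<^sup>2 - 1 / t\<bar> \<le> z\<^sup>2 / t\<^sup>2 + 1 / t" .
    also have "\<dots> \<le> (1 + t) * (z\<^sup>2 / t\<^sup>2 + 1 / t)"
      using mult_right_mono[of 1 "1 + t" "z\<^sup>2 / t\<^sup>2 + 1 / t"] n t by simp
    finally have "\<bar>z\<^sup>2 / t\<^sup>2 - 1 / t\<bar> \<le> (1 + t) * (z\<^sup>2 / t\<^sup>2 + 1 / t)" .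
    from bd[OF this] show "\<bar>(z\<^sup>2 / t\<^sup>2 - 1 / t) * heat t z\<bar> \<le> A / (1 + z\<^sup>2)"
      using heat_pos[OF t, of z] by (simp add: abs_mult)
  qed
qed

lemma admissible_heat_x:
  assumes s: "0 < s" "s < 1" and t: "t > 0"
  shows "admissible s (\<lambda>y. heat_x t (x - y))"
proof -
  obtain A where A: "\<And>z. \<bar>heat_x t z\<bar> \<le> A / (1 + z\<^sup>2)" "\<And>z. \<bar>(z\<^sup>2 / t\<^sup>2 - 1 / t) * heat t z\<bar> \<le> A / (1 + z\<^sup>2)"
    using heat_x_decay[OF t] by blast
  show ?thesis
  proof (rule admissible_of_decay[OF s, where b=x and A=A])
    show "((\<lambda>y. heat_x t (x - y)) has_real_derivative ((x - y)\<^sup>2 / t\<^sup>2 - 1 / t) * heat t (x - y) * (- 1)) (at y)" for y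
      by (rule DERIV_chain2[OF heat_derivs(2)[OF t]]) (auto intro!: derivative_eq_intros)
    show "\<bar>heat_x t (x - y)\<bar> \<le> A / (1 + (y - x)\<^sup>2)" for y using A(1)[of "x - y"] by (simp add: power2_commute)
    show "\<bar>((x - y)\<^sup>2 / t\<^sup>2 - 1 / t) * heat t (x - y) * (- 1)\<bar> \<le> A / (1 + (y - x)\<^sup>2)" for y
      using A(2)[of "x - y"] by (simp add: power2_commute[of y x])
  qed
qed

section \<open>Regularity away from the point\<close>

lemma marchaud_weight_measurable [measurable]: "marchaud_weight s \<in> borel_measurable borel"
proof -
  have "(\<lambda>\<sigma>. \<integral>\<tau>. (if 0 < \<tau> \<and> \<tau> < min 1 \<sigma> then 1 else 0) * (\<tau> powr (s - 1) * ((\<sigma> - \<tau>) powr (- s) / s)) \<partial>lborel) \<in> borel_measurable borel"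
    by (rule lborel.borel_measurable_lebesgue_integral) measurable
  also have "(\<lambda>\<sigma>. \<integral>\<tau>. (if 0 < \<tau> \<and> \<tau> < min 1 \<sigma> then 1 else 0) * (\<tau> powr (s - 1) * ((\<sigma> - \<tau>) powr (- s) / s)) \<partial>lborel) = marchaud_weight s"
    unfolding marchaud_weight_def fun_eq_iff
    by (intro allI Bochner_Integration.integral_cong) (auto simp: indicator_def)
  finally show ?thesis .
qed

text \<open>If \<open>g\<close> is not integrable, its integral is 0 by convention and the bound
  holds because \<open>w\<close> is nonnegative.\<close>

lemma integral_abs_le:
  fixes g w :: "real \<Rightarrow> real"
  assumes "integrable lborel w" "\<And>x. \<bar>g x\<bar> \<le> w x"
  shows "\<bar>\<integral>x. g x \<partial>lborel\<bar> \<le> (LBINT x. w x)"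
proof -
  have "\<bar>\<integral>x. g x \<partial>lborel\<bar> \<le> (LBINT x. \<bar>g x\<bar>)" by (rule integral_abs_bound)
  also have "\<dots> \<le> (LBINT x. w x)"
    using assms order_trans[OF abs_ge_zero assms(2)] by (intro integral_mono') auto
  finally show ?thesis .
qed

lemma powr_three_halves: "\<sigma> > 0 \<Longrightarrow> \<sigma> powr (- 3 / 2) = 1 / (\<sigma> * sqrt \<sigma>)" for \<sigma> :: real
proof -
  assume \<sigma>: "\<sigma> > 0"
  have "\<sigma> powr (- 3 / 2) = \<sigma> powr (- 1 + - (1 / 2))" by simp
  also have "\<dots> = \<sigma> powr (- 1) * \<sigma> powr (- (1 / 2))" by (rule powr_add)
  also have "\<sigma> powr (- 1) = inverse \<sigma>" using \<sigma> powr_minus[of \<sigma> 1] by simp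
  also have "\<sigma> powr (- (1 / 2)) = inverse (sqrt \<sigma>)" using \<sigma> powr_minus[of \<sigma> "1 / 2"] powr_half_sqrt[of \<sigma>] by simp
  also have "inverse \<sigma> * inverse (sqrt \<sigma>) = 1 / (\<sigma> * sqrt \<sigma>)" by (simp add: divide_inverse)
  finally show ?thesis .
qed

text \<open>Regularity away from \<open>a\<close> of a solution of \<open>(-\<Delta>)\<^sup>s q = f + \<mu> \<delta>\<^sub>a\<close>, tested with derivatives of heat
  kernels. As \<open>2 s > 1\<close>, the function \<open>\<tau>\<^sup>s\<^sup>-\<^sup>3\<^sup>/\<^sup>2\<close> is integrable at \<open>0\<close>, so inverting the Marchaud derivative
  bounds the derivative of the heat regularization of \<open>q\<close> uniformly in the regularization parameter.\<close>
locale point_source_equation =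
  fixes s C a \<mu> M F :: real and q f :: "real \<Rightarrow> real"
  assumes s: "1 / 2 < s" "s < 1" and C: "C > 0"
    and q: "continuous_on UNIV q" "\<And>x. \<bar>q x\<bar> \<le> M"
    and f: "continuous_on UNIV f" "\<And>x. \<bar>f x\<bar> \<le> F"
    and eq: "\<And>\<tau> x. \<tau> > 0 \<Longrightarrow>
      C * (LBINT t. indicator {0<..} t * ((smear (heat_x 1) q \<tau> x / sqrt \<tau> - smear (heat_x 1) q (\<tau> + t) x / sqrt (\<tau> + t)) * t powr (- 1 - s)))
      = smear (heat_x 1) f \<tau> x / sqrt \<tau> + \<mu> * heat_x \<tau> (x - a)"
begin

definition P where "P t x = smear (heat_x 1) q t x / sqrt t"
definition P' where "P' t x = smear (heat_xt 1) q t x / (t * sqrt t)"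
definition H where "H t x = smear (heat_x 1) f t x / sqrt t + \<mu> * heat_x t (x - a)"
text \<open>The inversion formula solved for \<open>P r x\<close>. Unlike \<open>P 0 x\<close>,
  which is 0 through division by zero, \<open>Z 0 x\<close> is meaningful and turns out to be the
  derivative of \<open>q\<close> at \<open>x \<noteq> a\<close>.\<close>

definition Z where "Z r x = P (r + 1) x
  + 1 / marchaud_const s * (LBINT \<sigma>. indicator {1<..} \<sigma> * (P' (r + \<sigma>) x * marchaud_weight s \<sigma>))
  + 1 / (C * marchaud_const s) * (LBINT \<tau>. indicator {0<..<1} \<tau> * (\<tau> powr (s - 1) * H (r + \<tau>) x))"

lemma s': "0 < s" "s < 1" using s by auto

lemma qm [measurable]: "q \<in> borel_measurable borel" by (rule borel_measurable_continuous_onI[OF q(1)])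
lemma fm [measurable]: "f \<in> borel_measurable borel" by (rule borel_measurable_continuous_onI[OF f(1)])

lemma hm [measurable]: "heat_x 1 \<in> borel_measurable borel" "heat_xt 1 \<in> borel_measurable borel"
  using heat_one_integrable by auto

lemma P'_measurable [measurable]: "(\<lambda>\<sigma>. P' (r + \<sigma>) x) \<in> borel_measurable borel"
  unfolding P'_def by (intro borel_measurable_divide smear_measurable) measurable

lemma H_measurable [measurable]: "(\<lambda>\<tau>. H (r + \<tau>) x) \<in> borel_measurable borel"
  unfolding H_def
proof (intro borel_measurable_add borel_measurable_divide smear_measurable borel_measurable_times)
  show "(\<lambda>\<tau>. heat_x (r + \<tau>) (x - a)) \<in> borel_measurable borel"
    unfolding heat_x_def heat_def by measurable
qed measurable

section \<open>Bounds uniform in the regularization time\<close>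

definition c1 where "c1 = M * (LBINT z. \<bar>heat_x 1 z\<bar>)"
definition c3 where "c3 = M * (LBINT z. \<bar>heat_xt 1 z\<bar>)"
definition c4 where "c4 = F * (LBINT z. \<bar>heat_x 1 z\<bar>)"

lemma smear_bounds:
  "\<bar>smear (heat_x 1) q t x\<bar> \<le> c1" "\<bar>smear (heat_xt 1) q t x\<bar> \<le> c3" "\<bar>smear (heat_x 1) f t x\<bar> \<le> c4"
  unfolding c1_def c3_def c4_def
  by (rule smear_bound[OF heat_one_integrable(2) qm q(2)] smear_bound[OF heat_one_integrable(3) qm q(2)]
      smear_bound[OF heat_one_integrable(2) fm f(2)])+

lemma c_nonneg: "c1 \<ge> 0" "c3 \<ge> 0" "c4 \<ge> 0"
  using smear_bounds[of 0 0] by linarith+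

lemma P'_bound:
  assumes "0 < \<sigma>" "\<sigma> \<le> t"
  shows "\<bar>P' t x\<bar> \<le> c3 / (\<sigma> * sqrt \<sigma>)"
proof -
  have "\<bar>P' t x\<bar> = \<bar>smear (heat_xt 1) q t x\<bar> / (t * sqrt t)" using assms by (simp add: P'_def abs_divide abs_mult)
  also have "\<dots> \<le> c3 / (\<sigma> * sqrt \<sigma>)"
    using assms smear_bounds(2) c_nonneg(2) by (intro frac_le mult_mono mult_pos_pos) auto
  finally show ?thesis .
qed

text \<open>\<open>w2\<close> and \<open>w3\<close> dominate the two integrands of
  \<open>Z r x\<close> for all \<open>r \<ge> 0\<close>, since the bounds are no worse at later
  times. The power \<open>s - 3 / 2\<close> in \<open>w3\<close> is integrable at 0 because
  \<open>s > 1 / 2\<close>.\<close>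

definition w2 where "w2 \<sigma> = c3 * marchaud_const s * (indicator {1..} \<sigma> *\<^sub>R \<sigma> powr (- 3 / 2))"
definition w3 where "w3 d \<tau> = c4 * (indicator {0..1} \<tau> *\<^sub>R \<tau> powr (s - 3 / 2)) + \<bar>\<mu>\<bar> * 8 / d\<^sup>2 * (indicator {0..1} \<tau> *\<^sub>R \<tau> powr (s - 1))"

lemma w_integrable: "integrable lborel w2" "integrable lborel (w3 d)"
proof -
  show "integrable lborel w2" unfolding w2_def [abs_def]
    using set_integrable_powr_Ici1[of "- 3 / 2"] by (intro integrable_mult_right) (simp add: set_integrable_def)
  show "integrable lborel (w3 d)" unfolding w3_def [abs_def]
    using set_integrable_powr_Icc01[of "s - 3 / 2"] set_integrable_powr_Icc01[of "s - 1"] s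
    by (intro Bochner_Integration.integrable_add integrable_mult_right) (simp_all add: set_integrable_def)
qed

lemma dom2:
  assumes r: "r \<ge> 0"
  shows "\<bar>indicator {1<..} \<sigma> * (P' (r + \<sigma>) x * marchaud_weight s \<sigma>)\<bar> \<le> w2 \<sigma>"
proof (cases "\<sigma> > 1")
  case True
  have "\<bar>P' (r + \<sigma>) x * marchaud_weight s \<sigma>\<bar> \<le> c3 / (\<sigma> * sqrt \<sigma>) * marchaud_const s"
    unfolding abs_mult using True r marchaud_weight_props(2,3)[OF s', of \<sigma>] c_nonneg
    by (intro mult_mono P'_bound) auto
  then show ?thesis using True powr_three_halves[of \<sigma>] by (simp add: w2_def mult_ac)
next
  case False
  then show ?thesis using c_nonneg marchaud_const_pos[OF s'] by (simp add: w2_def)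
qed

lemma dom3:
  assumes r: "r \<ge> 0" and d: "d > 0" "d \<le> \<bar>x - a\<bar>"
  shows "\<bar>indicator {0<..<1} \<tau> * (\<tau> powr (s - 1) * H (r + \<tau>) x)\<bar> \<le> w3 d \<tau>"
proof (cases "0 < \<tau> \<and> \<tau> < 1")
  case True
  have "\<bar>smear (heat_x 1) f (r + \<tau>) x / sqrt (r + \<tau>)\<bar> \<le> c4 / sqrt \<tau>"
    unfolding abs_divide using True r smear_bounds(3) c_nonneg by (intro frac_le) auto
  moreover have "\<bar>heat_x (r + \<tau>) (x - a)\<bar> \<le> 8 / d\<^sup>2"
  proof -
    have "\<bar>heat_x (r + \<tau>) (x - a)\<bar> \<le> 8 / (x - a)\<^sup>2" using True r d by (intro heat_x_bound) auto
    also have "\<dots> \<le> 8 / d\<^sup>2"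
      using d by (intro divide_left_mono mult_pos_pos) (auto simp: abs_le_square_iff[symmetric])
    finally show ?thesis .
  qed
  then have "\<bar>\<mu> * heat_x (r + \<tau>) (x - a)\<bar> \<le> \<bar>\<mu>\<bar> * (8 / d\<^sup>2)" unfolding abs_mult by (intro mult_left_mono) auto
  ultimately have "\<bar>H (r + \<tau>) x\<bar> \<le> c4 / sqrt \<tau> + \<bar>\<mu>\<bar> * (8 / d\<^sup>2)" unfolding H_def by linarith
  then have "\<tau> powr (s - 1) * \<bar>H (r + \<tau>) x\<bar> \<le> \<tau> powr (s - 1) * (c4 / sqrt \<tau> + \<bar>\<mu>\<bar> * (8 / d\<^sup>2))"
    by (intro mult_left_mono) auto
  also have "\<dots> = c4 * (\<tau> powr (s - 1) / sqrt \<tau>) + \<bar>\<mu>\<bar> * 8 / d\<^sup>2 * \<tau> powr (s - 1)" by (simp add: algebra_simps)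
  also have "\<tau> powr (s - 1) / sqrt \<tau> = \<tau> powr (s - 3 / 2)"
    using True by (simp add: powr_half_sqrt[symmetric] powr_diff[symmetric])
  finally show ?thesis using True by (simp add: w3_def abs_mult)
next
  case False
  then show ?thesis using c_nonneg by (auto simp: w3_def)
qed

text \<open>Inversion applied to \<open>\<lambda>\<sigma>. P (r + \<sigma>) x\<close>. The shift by
  \<open>r > 0\<close> makes the derivative integrable at 0, where the available bound would
  otherwise be of order \<open>\<sigma> powr (- 3 / 2)\<close>.\<close>

lemma representation:
  assumes r: "r > 0"
  shows "P r x = Z r x"
proof -
  have "(LBINT \<tau>. indicator {0<..<1} \<tau> * (\<tau> powr (s - 1) * (H (r + \<tau>) x / C)))
    = marchaud_const s * (P (r + 0) x - P (r + 1) x) - (LBINT \<sigma>. indicator {1<..} \<sigma> * (P' (r + \<sigma>) x * marchaud_weight s \<sigma>))"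
  proof (rule marchaud_inversion[OF s'])
    show "integrable lborel (\<lambda>\<sigma>. indicator {0<..} \<sigma> * P' (r + \<sigma>) x)"
    proof (rule Bochner_Integration.integrable_bound)
      show "integrable lborel (\<lambda>\<sigma>. c3 / (r * sqrt r) * indicator {0..1} \<sigma> + c3 * (indicator {1..} \<sigma> *\<^sub>R \<sigma> powr (- 3 / 2)))"
        using set_integrable_powr_Ici1[of "- 3 / 2"]
        by (intro Bochner_Integration.integrable_add integrable_mult_right) (simp_all add: set_integrable_def)
      show "AE \<sigma> in lborel. norm (indicator {0<..} \<sigma> * P' (r + \<sigma>) x) \<le> norm (c3 / (r * sqrt r) * indicator {0..1} \<sigma> + c3 * (indicator {1..} \<sigma> *\<^sub>R \<sigma> powr (- 3 / 2)))"
      proof (rule AE_I2)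
        fix \<sigma> :: real
        have n: "0 \<le> c3 / (r * sqrt r)" using r c_nonneg by simp
        consider "\<sigma> \<le> 0" | "0 < \<sigma>" "\<sigma> \<le> 1" | "1 < \<sigma>" by linarith
        then show "norm (indicator {0<..} \<sigma> * P' (r + \<sigma>) x) \<le> norm (c3 / (r * sqrt r) * indicator {0..1} \<sigma> + c3 * (indicator {1..} \<sigma> *\<^sub>R \<sigma> powr (- 3 / 2)))"
        proof cases
          case 2
          have "\<bar>P' (r + \<sigma>) x\<bar> \<le> c3 / (r * sqrt r)" using r 2 by (intro P'_bound) auto
          moreover have "0 \<le> c3 * (indicator {1..} \<sigma> *\<^sub>R \<sigma> powr (- 3 / 2))" using c_nonneg by simp
          ultimately show ?thesis using 2 n by (simp del: real_scaleR_def)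
        next
          case 3
          have "\<bar>P' (r + \<sigma>) x\<bar> \<le> c3 / (\<sigma> * sqrt \<sigma>)" using r 3 by (intro P'_bound) auto
          then show ?thesis using 3 powr_three_halves[of \<sigma>] c_nonneg by simp
        qed simp
      qed
    qed measurable
    show "(LBINT t. indicator {t1<..t2} t * P' (r + t) x) = P (r + t2) x - P (r + t1) x"
      if t: "0 \<le> t1" "t1 \<le> t2" for t1 t2
    proof -
      have "(LBINT t. indicator {t1<..t2} t * P' (r + t) x) = (LBINT t. indicator {t1..t2} t * P' (r + t) x)"
      proof (rule integral_cong_AE)
        have "AE t in lborel. t \<noteq> t1" by (rule AE_lborel_singleton)
        then show "AE t in lborel. indicator {t1<..t2} t * P' (r + t) x = indicator {t1..t2} t * P' (r + t) x"
          by (rule eventually_mono) (auto simp: indicator_def)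
      qed measurable
      also have "\<dots> = (LBINT t. indicator {r + t1..r + t2} (r + 1 * t) * P' (r + 1 * t) x)"
        by (intro Bochner_Integration.integral_cong) (auto simp: indicator_def)
      also have "\<dots> = (LBINT t. indicator {r + t1..r + t2} t * P' t x)"
        using lborel_integral_real_affine[of 1 "\<lambda>t. indicator {r + t1..r + t2} t * P' t x" r] by simp
      also have "\<dots> = P (r + t2) x - P (r + t1) x"
        unfolding P_def P'_def using r t by (intro smear_heat_x_FTC[OF qm q(2)]) auto
      finally show ?thesis .
    qed
    show "(LBINT t. indicator {0<..} t * ((P (r + \<tau>) x - P (r + (\<tau> + t)) x) * t powr (- 1 - s))) = H (r + \<tau>) x / C"
      if "\<tau> > 0" for \<tau>
      using eq[of "r + \<tau>" x] r that C by (simp add: P_def H_def add.assoc field_simps)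
  qed measurable
  also have "(LBINT \<tau>. indicator {0<..<1} \<tau> * (\<tau> powr (s - 1) * (H (r + \<tau>) x / C)))
     = 1 / C * (LBINT \<tau>. indicator {0<..<1} \<tau> * (\<tau> powr (s - 1) * H (r + \<tau>) x))"
    by (simp add: integral_mult_right_zero[symmetric] mult_ac del: integral_mult_right_zero)
  finally have "marchaud_const s * P r x = marchaud_const s * P (r + 1) x + (LBINT \<sigma>. indicator {1<..} \<sigma> * (P' (r + \<sigma>) x * marchaud_weight s \<sigma>))
    + 1 / C * (LBINT \<tau>. indicator {0<..<1} \<tau> * (\<tau> powr (s - 1) * H (r + \<tau>) x))"
    by (simp add: algebra_simps)
  moreover have "p = p1 + 1 / K * I + 1 / (C * K) * J" if "K * p = K * p1 + I + 1 / C * J" "K > 0" for K p p1 I J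
    using that C by (simp add: field_simps)
  ultimately show ?thesis unfolding Z_def using marchaud_const_pos[OF s'] by blast
qed

lemma Z_bounded:
  assumes d: "d > 0"
  obtains B where "\<And>r x :: real. r \<ge> 0 \<Longrightarrow> d \<le> \<bar>x - a\<bar> \<Longrightarrow> \<bar>Z r x\<bar> \<le> B"
proof (rule that)
  fix r x :: real assume r: "r \<ge> 0" and x: "d \<le> \<bar>x - a\<bar>"
  have K: "marchaud_const s > 0" by (rule marchaud_const_pos[OF s'])
  have "\<bar>P (r + 1) x\<bar> \<le> c1 / 1"
    unfolding P_def abs_divide using r smear_bounds(1) c_nonneg by (intro frac_le) auto
  moreover have "\<bar>1 / marchaud_const s * (LBINT \<sigma>. indicator {1<..} \<sigma> * (P' (r + \<sigma>) x * marchaud_weight s \<sigma>))\<bar>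
    \<le> 1 / marchaud_const s * (LBINT \<sigma>. w2 \<sigma>)"
    unfolding abs_mult using K integral_abs_le[OF w_integrable(1) dom2[OF r]] by (intro mult_mono) auto
  moreover have "\<bar>1 / (C * marchaud_const s) * (LBINT \<tau>. indicator {0<..<1} \<tau> * (\<tau> powr (s - 1) * H (r + \<tau>) x))\<bar>
    \<le> 1 / (C * marchaud_const s) * (LBINT \<tau>. w3 d \<tau>)"
    unfolding abs_mult using K C integral_abs_le[OF w_integrable(2) dom3[OF r d x]] by (intro mult_mono) auto
  ultimately show "\<bar>Z r x\<bar> \<le> c1 + 1 / marchaud_const s * (LBINT \<sigma>. w2 \<sigma>) + 1 / (C * marchaud_const s) * (LBINT \<tau>. w3 d \<tau>)"
    unfolding Z_def by linarith
qed

text \<open>The limits of the ingredients are parameters, so convergence at a point and convergence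
  at infinity are two instances; the distance \<open>d\<close> from \<open>a\<close> supplies the
  domination.\<close>

lemma Z_tendsto:
  assumes T: "T \<longlonglongrightarrow> 0" "\<And>n. T n \<ge> 0" and d: "d > 0" "\<And>n. d \<le> \<bar>X n - a\<bar>"
    and L1: "(\<lambda>n. smear (heat_x 1) q (T n + 1) (X n)) \<longlonglongrightarrow> L1"
    and L2: "\<And>\<sigma>. (\<lambda>n. smear (heat_xt 1) q (T n + \<sigma>) (X n)) \<longlonglongrightarrow> L2 \<sigma>"
    and L3: "\<And>\<tau>. (\<lambda>n. smear (heat_x 1) f (T n + \<tau>) (X n)) \<longlonglongrightarrow> L3 \<tau>"
    and G: "\<And>\<tau>. \<tau> > 0 \<Longrightarrow> (\<lambda>n. heat_x (T n + \<tau>) (X n - a)) \<longlonglongrightarrow> G \<tau>"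
  shows "(\<lambda>n. Z (T n) (X n)) \<longlonglongrightarrow> L1 / sqrt 1
    + 1 / marchaud_const s * (LBINT \<sigma>. indicator {1<..} \<sigma> * (L2 \<sigma> / (\<sigma> * sqrt \<sigma>) * marchaud_weight s \<sigma>))
    + 1 / (C * marchaud_const s) * (LBINT \<tau>. indicator {0<..<1} \<tau> * (\<tau> powr (s - 1) * (L3 \<tau> / sqrt \<tau> + \<mu> * G \<tau>)))"
proof -
  have Ts: "(\<lambda>n. T n + \<sigma>) \<longlonglongrightarrow> \<sigma>" for \<sigma> using tendsto_add[OF T(1) tendsto_const[of \<sigma>]] by simp
  have p1: "(\<lambda>n. P (T n + 1) (X n)) \<longlonglongrightarrow> L1 / sqrt 1"
    unfolding P_def by (intro tendsto_divide L1 tendsto_real_sqrt Ts) auto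
  have p2: "(\<lambda>n. indicator {1<..} \<sigma> * (P' (T n + \<sigma>) (X n) * marchaud_weight s \<sigma>)) \<longlonglongrightarrow> indicator {1<..} \<sigma> * (L2 \<sigma> / (\<sigma> * sqrt \<sigma>) * marchaud_weight s \<sigma>)" for \<sigma> :: real
  proof (cases "\<sigma> > 1")
    case True
    show ?thesis unfolding P'_def using True by (intro tendsto_intros L2 Ts) auto
  qed simp
  have p3: "(\<lambda>n. indicator {0<..<1} \<tau> * (\<tau> powr (s - 1) * H (T n + \<tau>) (X n))) \<longlonglongrightarrow> indicator {0<..<1} \<tau> * (\<tau> powr (s - 1) * (L3 \<tau> / sqrt \<tau> + \<mu> * G \<tau>))" for \<tau> :: real
  proof (cases "0 < \<tau> \<and> \<tau> < 1")
    case True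
    show ?thesis unfolding H_def using True by (intro tendsto_mult tendsto_const tendsto_add tendsto_divide L3 G tendsto_real_sqrt Ts) auto
  qed auto
  have "(\<lambda>n. \<integral>\<sigma>. indicator {1<..} \<sigma> * (P' (T n + \<sigma>) (X n) * marchaud_weight s \<sigma>) \<partial>lborel) \<longlonglongrightarrow> (LBINT \<sigma>. indicator {1<..} \<sigma> * (L2 \<sigma> / (\<sigma> * sqrt \<sigma>) * marchaud_weight s \<sigma>))"
  proof (rule integral_dominated_convergence[where w=w2])
    show m: "(\<lambda>\<sigma>. indicator {1<..} \<sigma> * (P' (T n + \<sigma>) (X n) * marchaud_weight s \<sigma>)) \<in> borel_measurable lborel" for n by measurable
    show "(\<lambda>\<sigma>. indicator {1<..} \<sigma> * (L2 \<sigma> / (\<sigma> * sqrt \<sigma>) * marchaud_weight s \<sigma>)) \<in> borel_measurable lborel"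
      by (rule borel_measurable_LIMSEQ_metric[OF m p2])
  qed (use p2 dom2 T w_integrable in auto)
  moreover have "(\<lambda>n. \<integral>\<tau>. indicator {0<..<1} \<tau> * (\<tau> powr (s - 1) * H (T n + \<tau>) (X n)) \<partial>lborel) \<longlonglongrightarrow> (LBINT \<tau>. indicator {0<..<1} \<tau> * (\<tau> powr (s - 1) * (L3 \<tau> / sqrt \<tau> + \<mu> * G \<tau>)))"
  proof (rule integral_dominated_convergence[where w="w3 d"])
    show m: "(\<lambda>\<tau>. indicator {0<..<1} \<tau> * (\<tau> powr (s - 1) * H (T n + \<tau>) (X n))) \<in> borel_measurable lborel" for n by measurable
    show "(\<lambda>\<tau>. indicator {0<..<1} \<tau> * (\<tau> powr (s - 1) * (L3 \<tau> / sqrt \<tau> + \<mu> * G \<tau>))) \<in> borel_measurable lborel"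
      by (rule borel_measurable_LIMSEQ_metric[OF m p3])
  qed (use p3 dom3[OF T(2) d] w_integrable in auto)
  ultimately show ?thesis unfolding Z_def using p1 by (intro tendsto_add tendsto_mult tendsto_const)
qed

lemma Z_tendsto_point:
  assumes T: "T \<longlonglongrightarrow> 0" "\<And>n. T n \<ge> 0" and X: "X \<longlonglongrightarrow> x" and x: "x \<noteq> a"
  shows "(\<lambda>n. Z (T n) (X n)) \<longlonglongrightarrow> Z 0 x"
proof -
  define d where "d = \<bar>x - a\<bar> / 2"
  have d: "d > 0" using x by (simp add: d_def)
  have "(\<lambda>n. \<bar>X n - a\<bar>) \<longlonglongrightarrow> \<bar>x - a\<bar>" by (intro tendsto_intros X)
  then have "\<forall>\<^sub>F n in sequentially. d < \<bar>X n - a\<bar>" by (rule order_tendstoD(1)) (use x in \<open>simp add: d_def\<close>)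
  then obtain N where "\<forall>n\<ge>N. d < \<bar>X n - a\<bar>" by (auto simp: eventually_sequentially)
  then have N: "d \<le> \<bar>X n - a\<bar>" if "n \<ge> N" for n using that by (simp add: less_imp_le)
  \<comment> \<open>Dropping \<open>N\<close> terms puts the whole sequence at distance at least
    \<open>d\<close> from \<open>a\<close>, as the domination requires.\<close>
  define T' where "T' n = T (n + N)" for n
  define X' where "X' n = X (n + N)" for n
  have T': "T' \<longlonglongrightarrow> 0" unfolding T'_def using T(1) by (rule LIMSEQ_ignore_initial_segment)
  have X': "X' \<longlonglongrightarrow> x" unfolding X'_def using X by (rule LIMSEQ_ignore_initial_segment)
  have Ts: "(\<lambda>n. T' n + \<sigma>) \<longlonglongrightarrow> \<sigma>" for \<sigma> using tendsto_add[OF T' tendsto_const[of \<sigma>]] by simp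
  have "(\<lambda>n. Z (T' n) (X' n)) \<longlonglongrightarrow> smear (heat_x 1) q 1 x / sqrt 1
    + 1 / marchaud_const s * (LBINT \<sigma>. indicator {1<..} \<sigma> * (smear (heat_xt 1) q \<sigma> x / (\<sigma> * sqrt \<sigma>) * marchaud_weight s \<sigma>))
    + 1 / (C * marchaud_const s) * (LBINT \<tau>. indicator {0<..<1} \<tau> * (\<tau> powr (s - 1) * (smear (heat_x 1) f \<tau> x / sqrt \<tau> + \<mu> * heat_x \<tau> (x - a))))"
  proof (rule Z_tendsto[OF T' _ d])
    show "T' n \<ge> 0" "d \<le> \<bar>X' n - a\<bar>" for n using T(2) N by (auto simp: T'_def X'_def)
    show "(\<lambda>n. heat_x (T' n + \<tau>) (X' n - a)) \<longlonglongrightarrow> heat_x \<tau> (x - a)" if "\<tau> > 0" for \<tau>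
      unfolding heat_x_def heat_def using that by (intro tendsto_intros Ts X') auto
  qed (rule smear_tendsto_point[OF heat_one_integrable(2) q X' Ts] smear_tendsto_point[OF heat_one_integrable(3) q X' Ts]
      smear_tendsto_point[OF heat_one_integrable(2) f X' Ts])+
  also have "smear (heat_x 1) q 1 x / sqrt 1
    + 1 / marchaud_const s * (LBINT \<sigma>. indicator {1<..} \<sigma> * (smear (heat_xt 1) q \<sigma> x / (\<sigma> * sqrt \<sigma>) * marchaud_weight s \<sigma>))
    + 1 / (C * marchaud_const s) * (LBINT \<tau>. indicator {0<..<1} \<tau> * (\<tau> powr (s - 1) * (smear (heat_x 1) f \<tau> x / sqrt \<tau> + \<mu> * heat_x \<tau> (x - a)))) = Z 0 x"
    by (simp add: Z_def P_def P'_def H_def)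
  finally show ?thesis unfolding T'_def X'_def by (rule LIMSEQ_offset)
qed

text \<open>Centred further and further out, the convolutions see only the vanishing ends of
  \<open>q\<close> and \<open>f\<close>, and the source term decays with the heat kernel; all limits
  fed into \<open>Z_tendsto\<close> are therefore 0.\<close>

lemma Z_tendsto_infinity:
  assumes q0: "(q \<longlongrightarrow> 0) at_infinity" and f0: "(f \<longlongrightarrow> 0) at_infinity" and X: "filterlim X at_infinity sequentially"
  shows "(\<lambda>n. Z 0 (X n)) \<longlonglongrightarrow> 0"
proof -
  have Xa: "filterlim (\<lambda>n. X n - a) at_infinity sequentially"
    using tendsto_add_filterlim_at_infinity[OF tendsto_const[of "- a"] X] by simp
  then have "\<forall>\<^sub>F n in sequentially. 1 \<le> norm (X n - a)"
    unfolding filterlim_at_infinity[OF order_refl] by auto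
  then obtain N where N: "\<And>n. n \<ge> N \<Longrightarrow> 1 \<le> \<bar>X n - a\<bar>" by (auto simp: eventually_sequentially)
  define X' where "X' n = X (n + N)" for n
  have sh: "filterlim (\<lambda>n. n + N) sequentially sequentially" by (rule filterlim_add_const_nat_at_top)
  have X': "filterlim X' at_infinity sequentially" unfolding X'_def by (rule filterlim_compose[OF X sh])
  have X'a: "filterlim (\<lambda>n. X' n - a) at_infinity sequentially" unfolding X'_def by (rule filterlim_compose[OF Xa sh])
  have "(\<lambda>n. Z ((\<lambda>n. 0) n) (X' n)) \<longlonglongrightarrow> 0 / sqrt 1
    + 1 / marchaud_const s * (LBINT \<sigma>. indicator {1<..} \<sigma> * (0 / (\<sigma> * sqrt \<sigma>) * marchaud_weight s \<sigma>))
    + 1 / (C * marchaud_const s) * (LBINT \<tau>. indicator {0<..<1} \<tau> * (\<tau> powr (s - 1) * (0 / sqrt \<tau> + \<mu> * 0)))"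
  proof (rule Z_tendsto[where d=1])
    show "1 \<le> \<bar>X' n - a\<bar>" for n using N by (simp add: X'_def)
    show "(\<lambda>n. heat_x (0 + \<tau>) (X' n - a)) \<longlonglongrightarrow> 0" if "\<tau> > 0" for \<tau>
    proof -
      obtain A where A: "\<And>z. \<bar>heat_x \<tau> z\<bar> \<le> A / (1 + z\<^sup>2)" by (rule heat_x_decay[OF \<open>\<tau> > 0\<close>]) blast
      have "filterlim (\<lambda>n. (X' n - a)\<^sup>2) at_top sequentially"
      proof -
        have "filterlim (\<lambda>n. norm (X' n - a)) at_top sequentially" using X'a by (rule filterlim_at_infinity_imp_norm_at_top)
        from filterlim_at_top_mult_at_top[OF this this] show ?thesis by (simp add: power2_eq_square)
      qed
      then have "filterlim (\<lambda>n. 1 + (X' n - a)\<^sup>2) at_infinity sequentially"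
        by (intro filterlim_at_top_imp_at_infinity filterlim_tendsto_add_at_top[OF tendsto_const])
      then have lim: "(\<lambda>n. A / (1 + (X' n - a)\<^sup>2)) \<longlonglongrightarrow> 0" by (rule tendsto_divide_0[OF tendsto_const])
      show ?thesis by (rule tendsto_rabs_zero_cancel, rule tendsto_sandwich[OF _ _ tendsto_const lim]) (use A in auto)
    qed
  qed (simp, simp, simp, (rule smear_tendsto_infinity[OF heat_one_integrable(2) q q0 X' tendsto_const]
      smear_tendsto_infinity[OF heat_one_integrable(3) q q0 X' tendsto_const]
      smear_tendsto_infinity[OF heat_one_integrable(2) f f0 X' tendsto_const])+)
  then have "(\<lambda>n. Z 0 (X (n + N))) \<longlonglongrightarrow> 0" by (simp add: X'_def)
  then show ?thesis by (rule LIMSEQ_offset)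
qed

lemma Z_continuous: "x \<noteq> a \<Longrightarrow> isCont (Z 0) x"
  unfolding continuous_at_sequentially comp_def
  using Z_tendsto_point[of "\<lambda>_. 0"] by simp

text \<open>At a positive time this is the fundamental theorem for the heat extension, whose
  derivative is \<open>Z (T n)\<close> by \<open>representation\<close>. The bound on
  \<open>Z\<close> away from \<open>a\<close> lets the time tend to 0.\<close>

lemma integral_Z:
  assumes xy: "x \<le> y" and a: "a \<notin> {x..y}"
  shows "q y - q x = integral {x..y} (Z 0)"
proof -
  obtain d where d: "d > 0" "\<And>z. z \<in> {x..y} \<Longrightarrow> d \<le> \<bar>z - a\<bar>"
  proof (cases "a < x")
    case True
    then show thesis by (intro that[of "x - a"]) auto
  next
    case False
    then show thesis using a by (intro that[of "a - y"]) auto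
  qed
  obtain B where B: "\<And>r z. r \<ge> 0 \<Longrightarrow> d \<le> \<bar>z - a\<bar> \<Longrightarrow> \<bar>Z r z\<bar> \<le> B" using Z_bounded[OF d(1)] by blast
  have cont: "continuous_on {x..y} (Z 0)"
    using a by (intro continuous_at_imp_continuous_on ballI Z_continuous) auto
  have Zc: "set_integrable lborel {x..y} (Z 0)" by (rule borel_integrable_atLeastAtMost'[OF cont])
  define T where "T n = 1 / real (Suc n)" for n
  have T: "T n > 0" for n by (simp add: T_def)
  have T0: "T \<longlonglongrightarrow> 0" unfolding T_def [abs_def] by (rule LIMSEQ_Suc[OF lim_1_over_n])
  have step: "smear (heat 1) q (T n) y - smear (heat 1) q (T n) x = (LBINT z. indicator {x..y} z * Z (T n) z)" for n
    using smear_heat_FTC_space[OF qm q(2) T xy, of n] unfolding representation[OF T, unfolded P_def] by simp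
  have "(\<lambda>n. \<integral>z. indicator {x..y} z * Z (T n) z \<partial>lborel) \<longlonglongrightarrow> (LBINT z. indicator {x..y} z * Z 0 z)"
  proof (rule integral_dominated_convergence[where w="\<lambda>z. B * indicator {x..y} z"])
    show "integrable lborel (\<lambda>z. B * indicator {x..y} z)"
      by (intro integrable_mult_right integrable_real_indicator) (auto simp: emeasure_lborel_Icc_eq)
    show "(\<lambda>z. indicator {x..y} z * Z 0 z) \<in> borel_measurable lborel"
      using Zc by (simp add: set_integrable_def)
    show "(\<lambda>z. indicator {x..y} z * Z (T n) z) \<in> borel_measurable lborel" for n
    proof -
      have "smear (heat_x 1) q (T n) \<in> borel_measurable borel"
        unfolding smear_def [abs_def] by (rule lborel.borel_measurable_lebesgue_integral) measurable
      then have "Z (T n) \<in> borel_measurable borel"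
        using representation[OF T, of n, symmetric] by (simp add: P_def [abs_def] cong: measurable_cong)
      then show ?thesis by measurable
    qed
    show "AE z in lborel. (\<lambda>n. indicator {x..y} z * Z (T n) z) \<longlonglongrightarrow> indicator {x..y} z * Z 0 z"
    proof (rule AE_I2)
      fix z
      show "(\<lambda>n. indicator {x..y} z * Z (T n) z) \<longlonglongrightarrow> indicator {x..y} z * Z 0 z"
      proof (cases "z \<in> {x..y}")
        case True
        then have "z \<noteq> a" using a by auto
        then show ?thesis using T by (intro tendsto_mult tendsto_const Z_tendsto_point[OF T0]) (auto simp: less_imp_le)
      qed simp
    qed
    show "AE z in lborel. norm (indicator {x..y} z * Z (T n) z) \<le> B * indicator {x..y} z" for n
      using B[of "T n"] d(2) T[of n] by (intro AE_I2) (auto simp: indicator_def less_imp_le)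
  qed
  then have 1: "(\<lambda>n. smear (heat 1) q (T n) y - smear (heat 1) q (T n) x) \<longlonglongrightarrow> (LBINT z. indicator {x..y} z * Z 0 z)"
    by (simp add: step)
  have "(\<lambda>n. smear (heat 1) q (T n) y - smear (heat 1) q (T n) x) \<longlonglongrightarrow> smear (heat 1) q 0 y - smear (heat 1) q 0 x"
    by (intro tendsto_diff smear_tendsto_point[OF heat_one_integrable(1) q tendsto_const T0])
  \<comment> \<open>At time 0 the argument of \<open>q\<close> is frozen at \<open>z\<close>, and
    the Gaussian has mass 1.\<close>
  moreover have "smear (heat 1) q 0 z = q z" for z by (simp add: smear_def integral_heat_one)
  ultimately have "q y - q x = (LBINT z. indicator {x..y} z * Z 0 z)"
    using LIMSEQ_unique[OF 1] by simp
  also have "\<dots> = integral {x..y} (Z 0)"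
    using set_borel_integral_eq_integral(2)[OF Zc] by (simp add: set_lebesgue_integral_def)
  finally show ?thesis .
qed

text \<open>Around \<open>x\<close>, on an interval avoiding \<open>a\<close>, \<open>q\<close> is a
  constant plus an integral of the continuous function \<open>Z 0\<close>.\<close>

lemma has_derivative_Z:
  assumes x: "x \<noteq> a"
  shows "(q has_real_derivative Z 0 x) (at x)"
proof -
  define d where "d = \<bar>x - a\<bar> / 2"
  have d: "d > 0" using x by (simp add: d_def)
  have a: "a \<notin> {x - d..x + d}"
  proof
    assume "a \<in> {x - d..x + d}"
    then have "\<bar>x - a\<bar> \<le> d" by (simp add: abs_le_iff)
    then show False using d by (simp add: d_def)
  qed
  have cont: "continuous_on {x - d..x + d} (Z 0)"
    using a by (intro continuous_at_imp_continuous_on ballI Z_continuous) auto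
  have "((\<lambda>u. integral {x - d..u} (Z 0)) has_real_derivative Z 0 x) (at x within {x - d..x + d})"
    using d by (intro integral_has_real_derivative[OF cont]) auto
  then have "((\<lambda>u. integral {x - d..u} (Z 0)) has_real_derivative Z 0 x) (at x)"
    using d by (simp add: at_within_Icc_at)
  then have "((\<lambda>u. q (x - d) + integral {x - d..u} (Z 0)) has_real_derivative Z 0 x) (at x)"
    by (auto intro!: derivative_eq_intros)
  then show ?thesis
  proof (rule has_field_derivative_transform_within_open[where S="{x - d<..<x + d}"])
    fix u assume u: "u \<in> {x - d<..<x + d}"
    then have "q u - q (x - d) = integral {x - d..u} (Z 0)" using a by (intro integral_Z) auto
    then show "q (x - d) + integral {x - d..u} (Z 0) = q u" by simp
  qed (use d in auto)
qed

lemma derivative_decay: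
  assumes "(q \<longlongrightarrow> 0) at_infinity" "(f \<longlongrightarrow> 0) at_infinity"
  shows "(Z 0 \<longlongrightarrow> 0) at_top" and "(Z 0 \<longlongrightarrow> 0) at_bot"
proof -
  show "(Z 0 \<longlongrightarrow> 0) at_top"
  proof (rule tendsto_at_topI_sequentially)
    fix X :: "nat \<Rightarrow> real" assume "filterlim X at_top sequentially"
    then show "(\<lambda>n. Z 0 (X n)) \<longlonglongrightarrow> 0"
      by (intro Z_tendsto_infinity assms filterlim_at_top_imp_at_infinity)
  qed
  have "((\<lambda>x. Z 0 (- x)) \<longlongrightarrow> 0) at_top"
  proof (rule tendsto_at_topI_sequentially)
    fix X :: "nat \<Rightarrow> real" assume "filterlim X at_top sequentially"
    then have "filterlim (\<lambda>n. - X n) at_bot sequentially" by (simp add: filterlim_uminus_at_bot)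
    then show "(\<lambda>n. Z 0 (- X n)) \<longlonglongrightarrow> 0"
      by (intro Z_tendsto_infinity[of "\<lambda>n. - X n"] assms filterlim_at_bot_imp_at_infinity)
  qed
  then show "(Z 0 \<longlongrightarrow> 0) at_bot" by (simp add: filterlim_at_bot_mirror)
qed

end

section \<open>Symmetric minimizers and their properties\<close>

text \<open>The competitor is \<open>q\<^sub>0\<close> times a bump centred at \<open>a\<close>. Its
  energy bound does not see \<open>a\<close>, so \<open>E\<close>, and with it the final constant,
  is fixed before \<open>a\<close>. The potential part is finite because \<open>V 0 = 0\<close> and
  \<open>V\<close> is Lipschitz on the ball of radius \<open>norm q\<^sub>0\<close>.\<close>

lemma competitor_energy_bound:
  fixes V :: "real ^ 'n \<Rightarrow> real" and q\<^sub>0 :: "real ^ 'n"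
  assumes s: "0 < s" "s < 1" and V: "C1 V" "V 0 = 0"
  obtains E where "E \<ge> 0" "\<And>a. \<exists>p \<in> Gam s a q\<^sub>0. nrg s V p \<le> ennreal E"
proof -
  obtain L where L: "L \<ge> 0" "\<And>u v. norm u \<le> norm q\<^sub>0 \<Longrightarrow> norm v \<le> norm q\<^sub>0 \<Longrightarrow> \<bar>V u - V v\<bar> \<le> L * norm (u - v)"
    using C1_lipschitz_on_ball[OF V(1)] by blast
  have c: "c_s s > 0" by (rule c_s_pos[OF s])
  define J where "J = (LBINT x. 1 / (1 + (x :: real)\<^sup>2))"
  have J: "J \<ge> 0" unfolding J_def by (rule Bochner_Integration.integral_nonneg) simp
  have gc: "gag_const s \<ge> 0" unfolding gag_const_def J_def[symmetric]
    using J by (intro mult_nonneg_nonneg Bochner_Integration.integral_nonneg) auto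
  define S where "S = (\<Sum>i\<in>UNIV. \<bar>q\<^sub>0 $ i\<bar>\<^sup>2 * gag_const s)"
  have S: "S \<ge> 0" unfolding S_def using gc by (intro sum_nonneg) auto
  show thesis
  proof (rule that[of "c_s s * S + L * norm q\<^sub>0 * J"])
    show "0 \<le> c_s s * S + L * norm q\<^sub>0 * J" using c S L J by simp
    fix a :: real
    define p where "p x = (1 / (1 + (x - a)\<^sup>2)) *\<^sub>R q\<^sub>0" for x
    have pos: "1 + (x - a)\<^sup>2 > 0" for x by (simp add: add_pos_nonneg)
    have pc: "continuous_on UNIV p"
      unfolding p_def [abs_def] using pos by (intro continuous_intros) (simp add: less_imp_neq[symmetric])
    have pi: "(\<lambda>x. p x $ i) = (\<lambda>x. (q\<^sub>0 $ i) / (1 + (x - a)\<^sup>2))" for i by (simp add: p_def fun_eq_iff)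
    have gi: "gag s (\<lambda>x. p x $ i) \<le> ennreal (\<bar>q\<^sub>0 $ i\<bar>\<^sup>2 * gag_const s)" for i
      unfolding pi
    proof (rule gag_le_of_decay[OF s bump_decay(1), where b=a])
      show "\<bar>q\<^sub>0 $ i / (1 + (x - a)\<^sup>2)\<bar> \<le> \<bar>q\<^sub>0 $ i\<bar> / (1 + (x - a)\<^sup>2)" for x
        using pos[of x] by (simp add: abs_divide)
    qed (rule bump_decay(2))
    have "gagliardo_sq s p / 2 \<le> gagliardo_sq s p"
      by (cases "gagliardo_sq s p") (auto simp: divide_ennreal[of _ 2, simplified] ennreal_leI)
    also have "\<dots> \<le> ennreal (c_s s) * (\<Sum>i\<in>UNIV. ennreal (\<bar>q\<^sub>0 $ i\<bar>\<^sup>2 * gag_const s))"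
      unfolding gagliardo_sq_eq_gag[OF pc] by (intro mult_left_mono sum_mono gi) auto
    also have "\<dots> = ennreal (c_s s * S)"
    proof -
      have "(\<Sum>i\<in>UNIV. ennreal (\<bar>q\<^sub>0 $ i\<bar>\<^sup>2 * gag_const s)) = ennreal S"
        unfolding S_def using gc by (intro sum_ennreal) auto
      then show ?thesis using c S by (simp only: ennreal_mult less_imp_le)
    qed
    finally have 1: "gagliardo_sq s p / 2 \<le> ennreal (c_s s * S)" .
    have "(\<integral>\<^sup>+ x. ennreal (- V (p x)) \<partial>lborel) \<le> (\<integral>\<^sup>+ x. ennreal (L * norm q\<^sub>0) * ennreal (1 / (1 + (x - a)\<^sup>2)) \<partial>lborel)"
    proof (rule nn_integral_mono)
      fix x
      have n: "norm (p x) = norm q\<^sub>0 * (1 / (1 + (x - a)\<^sup>2))" using pos[of x] by (simp add: p_def)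
      also have "\<dots> \<le> norm q\<^sub>0 * 1" using pos[of x] by (intro mult_left_mono) (auto simp: divide_le_eq)
      finally have "\<bar>V (p x) - V 0\<bar> \<le> L * norm (p x - 0)" by (intro L(2)) auto
      then have "- V (p x) \<le> L * norm q\<^sub>0 * (1 / (1 + (x - a)\<^sup>2))" using V(2) n by simp
      then show "ennreal (- V (p x)) \<le> ennreal (L * norm q\<^sub>0) * ennreal (1 / (1 + (x - a)\<^sup>2))"
        using L(1) by (subst ennreal_mult[symmetric]) (auto intro!: ennreal_leI)
    qed
    also have "\<dots> = ennreal (L * norm q\<^sub>0) * (\<integral>\<^sup>+ x. ennreal (1 / (1 + (x - a)\<^sup>2)) \<partial>lborel)"
      by (rule nn_integral_cmult) measurable
    also have "(\<integral>\<^sup>+ x. ennreal (1 / (1 + (x - a)\<^sup>2)) \<partial>lborel) = (\<integral>\<^sup>+ x. ennreal (1 / (1 + x\<^sup>2)) \<partial>lborel)"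
      using nn_integral_real_affine[of "\<lambda>x. ennreal (1 / (1 + (x - a)\<^sup>2))" 1 a] by simp
    also have "\<dots> = ennreal J"
      unfolding J_def by (intro nn_integral_eq_integral integrable_inverse_one_plus_square) auto
    also have "ennreal (L * norm q\<^sub>0) * ennreal J = ennreal (L * norm q\<^sub>0 * J)"
      using L(1) J by (simp add: ennreal_mult[symmetric])
    finally have 2: "(\<integral>\<^sup>+ x. ennreal (- V (p x)) \<partial>lborel) \<le> ennreal (L * norm q\<^sub>0 * J)" .
    have "nrg s V p \<le> ennreal (c_s s * S) + ennreal (L * norm q\<^sub>0 * J)"
      unfolding nrg_def by (rule add_mono[OF 1 2])
    also have "\<dots> = ennreal (c_s s * S + L * norm q\<^sub>0 * J)" using c S L J by simp
    finally have 3: "nrg s V p \<le> ennreal (c_s s * S + L * norm q\<^sub>0 * J)" .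
    have "gagliardo_sq s p < \<infinity>"
      unfolding gagliardo_sq_eq_gag[OF pc] using le_less_trans[OF gi] by (simp add: ennreal_mult_less_top)
    from continuous_in_Ds2[OF pc this] have "p \<in> Gam s a q\<^sub>0"
      using pc by (auto simp: Gam_def has_point_value_def p_def)
    with 3 show "\<exists>p \<in> Gam s a q\<^sub>0. nrg s V p \<le> ennreal (c_s s * S + L * norm q\<^sub>0 * J)" by blast
  qed
qed

text \<open>The potential terms add up exactly, as the two reflections together visit each half line
  twice; the inequality stems from the seminorms.\<close>

lemma nrg_reflect:
  fixes q :: "real \<Rightarrow> real ^ 'n"
  assumes s: "0 < s" and q: "continuous_on UNIV q" and V: "continuous_on UNIV V"
  shows "nrg s V (\<lambda>x. q (a - \<bar>x - a\<bar>)) + nrg s V (\<lambda>x. q (a + \<bar>x - a\<bar>)) \<le> 2 * nrg s V q"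
proof -
  let ?r1 = "\<lambda>x. q (a - \<bar>x - a\<bar>)" and ?r2 = "\<lambda>x. q (a + \<bar>x - a\<bar>)"
  have rc: "continuous_on UNIV ?r1" "continuous_on UNIV ?r2"
    by (auto intro!: continuous_on_compose2[OF q] continuous_intros)
  have [measurable]: "q \<in> borel_measurable borel" "V \<in> borel_measurable borel"
    using q V by (auto intro: borel_measurable_continuous_onI)
  have "(\<Sum>i\<in>UNIV. gag s (\<lambda>x. ?r1 x $ i)) + (\<Sum>i\<in>UNIV. gag s (\<lambda>x. ?r2 x $ i)) \<le> (\<Sum>i\<in>UNIV. 2 * gag s (\<lambda>x. q x $ i))"
    unfolding sum.distrib[symmetric]
    using q by (intro sum_mono gag_reflect[OF s, of "\<lambda>x. q x $ _"] borel_measurable_continuous_onI continuous_intros)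
  then have "(\<Sum>i\<in>UNIV. gag s (\<lambda>x. ?r1 x $ i)) + (\<Sum>i\<in>UNIV. gag s (\<lambda>x. ?r2 x $ i)) \<le> 2 * (\<Sum>i\<in>UNIV. gag s (\<lambda>x. q x $ i))"
    by (simp only: sum_distrib_left)
  then have g: "gagliardo_sq s ?r1 + gagliardo_sq s ?r2 \<le> 2 * gagliardo_sq s q"
    unfolding gagliardo_sq_eq_gag[OF rc(1)] gagliardo_sq_eq_gag[OF rc(2)] gagliardo_sq_eq_gag[OF q]
      distrib_left[symmetric] mult.left_commute[of 2] by (rule mult_left_mono) simp
  let ?U = "\<lambda>q x. ennreal (- V (q x :: real ^ 'n))"
  have "(\<integral>\<^sup>+ x. ?U ?r1 x \<partial>lborel) + (\<integral>\<^sup>+ x. ?U ?r2 x \<partial>lborel)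
     = (\<integral>\<^sup>+ x. (?U ?r1 (a + x) + ?U ?r1 (a - x)) * indicator {0<..} x + (?U ?r2 (a + x) + ?U ?r2 (a - x)) * indicator {0<..} x \<partial>lborel)"
    by (subst (1 2) nn_integral_fold[where a=a], measurable) (rule nn_integral_add[symmetric], measurable)
  also have "\<dots> = (\<integral>\<^sup>+ x. 2 * ((?U q (a + x) + ?U q (a - x)) * indicator {0<..} x) \<partial>lborel)"
    by (intro nn_integral_cong) (auto simp: indicator_def mult_2 algebra_simps)
  also have "\<dots> = 2 * (\<integral>\<^sup>+ x. ?U q x \<partial>lborel)"
    using nn_integral_fold[of "?U q" a] by (simp add: nn_integral_cmult)
  finally have w: "(\<integral>\<^sup>+ x. ?U ?r1 x \<partial>lborel) + (\<integral>\<^sup>+ x. ?U ?r2 x \<partial>lborel) = 2 * (\<integral>\<^sup>+ x. ?U q x \<partial>lborel)" .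
  have "nrg s V ?r1 + nrg s V ?r2 = (gagliardo_sq s ?r1 + gagliardo_sq s ?r2) / 2 + ((\<integral>\<^sup>+ x. ?U ?r1 x \<partial>lborel) + (\<integral>\<^sup>+ x. ?U ?r2 x \<partial>lborel))"
    unfolding nrg_def by (simp add: divide_ennreal_def distrib_right add_ac)
  also have "\<dots> \<le> (2 * gagliardo_sq s q) / 2 + 2 * (\<integral>\<^sup>+ x. ?U q x \<partial>lborel)"
    unfolding w by (intro add_mono divide_right_mono_ennreal g order_refl)
  also have "\<dots> = 2 * nrg s V q"
    unfolding nrg_def by (simp add: divide_ennreal_def distrib_left mult_ac)
  finally show ?thesis .
qed

section \<open>Test functions, gradients at maxima and decay of minimizers\<close>

lemma compactly_supported_decay:
  fixes g :: "real \<Rightarrow> real"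
  assumes g: "continuous_on UNIV g" and K: "compact K" "\<And>x. x \<notin> K \<Longrightarrow> g x = 0"
  shows "\<exists>A\<ge>0. \<forall>x. \<bar>g x\<bar> \<le> A / (1 + x\<^sup>2)"
proof -
  have "continuous_on K (\<lambda>x. g x * (1 + x\<^sup>2))"
    using g by (auto intro!: continuous_intros intro: continuous_on_subset)
  from compact_imp_bounded[OF compact_continuous_image[OF this K(1)]]
  obtain A where A: "\<And>x. x \<in> K \<Longrightarrow> \<bar>g x * (1 + x\<^sup>2)\<bar> \<le> A" by (auto simp: bounded_iff)
  have pos: "1 + x\<^sup>2 > 0" for x :: real by (simp add: add_pos_nonneg)
  have "\<bar>g x\<bar> \<le> max A 0 / (1 + x\<^sup>2)" for x
  proof -
    have "\<bar>g x\<bar> * (1 + x\<^sup>2) \<le> max A 0"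
    proof (cases "x \<in> K")
      case True
      then show ?thesis using A[OF True] pos[of x] by (simp add: abs_mult)
    qed (simp add: K(2))
    then show ?thesis using pos[of x] by (simp add: pos_le_divide_eq)
  qed
  then show ?thesis by (intro exI[of _ "max A 0"]) auto
qed

lemma admissible_test_fun:
  assumes s: "0 < s" "s < 1" and \<phi>: "test_fun (UNIV - {a}) \<phi>"
  shows "admissible s \<phi>" and "\<phi> a = 0"
proof -
  let ?K = "closure {x. \<phi> x \<noteq> 0}"
  have d: "((deriv ^^ k) \<phi>) field_differentiable (at x)" for k x using \<phi> by (auto simp: test_fun_def)
  have K: "compact ?K" "?K \<subseteq> UNIV - {a}" using \<phi> by (auto simp: test_fun_def)
  have z: "\<phi> x = 0" if "x \<notin> ?K" for x using that closure_subset[of "{x. \<phi> x \<noteq> 0}"] by blast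
  show "\<phi> a = 0" by (rule z) (use K(2) in blast)
  have der: "(\<phi> has_real_derivative deriv \<phi> x) (at x)" for x
    using d[of 0 x] by (simp add: DERIV_deriv_iff_field_differentiable)
  have c0: "continuous_on UNIV \<phi>" using der by (meson DERIV_isCont continuous_at_imp_continuous_on)
  have c1: "continuous_on UNIV (deriv \<phi>)"
    using d[of 1] by (auto intro!: continuous_at_imp_continuous_on field_differentiable_imp_continuous_at)
  \<comment> \<open>The complement of the closed support is open, so \<phi> vanishes in a
    neighbourhood of each of its points.\<close>
  have z': "deriv \<phi> x = 0" if "x \<notin> ?K" for x
  proof -
    have "((\<lambda>_. 0) has_real_derivative 0) (at x)" by simp
    then have "(\<phi> has_real_derivative 0) (at x)"
    proof (rule has_field_derivative_transform_within_open[where S="- ?K"])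
      show "open (- ?K)" by (rule open_Compl[OF closed_closure])
      show "x \<in> - ?K" using that by blast
      show "0 = \<phi> y" if "y \<in> - ?K" for y by (rule z[symmetric]) (use that in blast)
    qed
    then show ?thesis by (rule DERIV_imp_deriv)
  qed
  obtain A where A: "A \<ge> 0" "\<And>x. \<bar>\<phi> x\<bar> \<le> A / (1 + x\<^sup>2)" using compactly_supported_decay[OF c0 K(1) z] by blast
  obtain B where B: "B \<ge> 0" "\<And>x. \<bar>deriv \<phi> x\<bar> \<le> B / (1 + x\<^sup>2)" using compactly_supported_decay[OF c1 K(1) z'] by blast
  have le: "A / (1 + x\<^sup>2) \<le> (A + B) / (1 + (x - 0)\<^sup>2)" "B / (1 + x\<^sup>2) \<le> (A + B) / (1 + (x - 0)\<^sup>2)" for x :: real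
    using A(1) B(1) by (auto intro!: divide_right_mono)
  show "admissible s \<phi>"
    by (rule admissible_of_decay[OF s der order_trans[OF A(2) le(1)] order_trans[OF B(2) le(2)]])
qed

text \<open>Yields \<open>grad V 0 = 0\<close>, so the right-hand side of the equation vanishes at
  infinity together with \<open>q\<close>.\<close>

lemma grad_at_max:
  fixes V :: "'a::real_inner \<Rightarrow> real"
  assumes V: "C1 V" and max: "\<And>v. V v \<le> V x"
  shows "grad V x = 0"
proof -
  have "(V has_derivative (\<lambda>h. h \<bullet> grad V x)) (at x)" using GDERIV_grad[OF V, of x] by (simp add: gderiv_def)
  then have "(\<lambda>h. h \<bullet> grad V x) = (\<lambda>h. 0)"
    by (rule differential_zero_maxmin[of x UNIV, rotated 2]) (use max in auto)
  then have "grad V x \<bullet> grad V x = 0" by metis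
  then show ?thesis by simp
qed

lemma has_vector_derivative_componentwise_vec:
  fixes q :: "real \<Rightarrow> real ^ 'n"
  assumes "\<And>i. ((\<lambda>x. q x $ i) has_real_derivative D $ i) (at x)"
  shows "(q has_vector_derivative D) (at x)"
  unfolding has_vector_derivative_def
proof (subst has_derivative_componentwise_within, rule ballI)
  fix b :: "real ^ 'n" assume "b \<in> Basis"
  then obtain i where b: "b = axis i 1" by (auto simp: Basis_vec_def)
  show "((\<lambda>x. q x \<bullet> b) has_derivative (\<lambda>h. (h *\<^sub>R D) \<bullet> b)) (at x)"
    using assms[of i] by (simp add: b inner_axis has_field_derivative_def mult.commute[of _ "D $ i"])
qed

lemma minimizer_decays:
  fixes V :: "real ^ 'n \<Rightarrow> real" and q :: "real \<Rightarrow> real ^ 'n"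
  assumes V: "continuous_on UNIV V" "V 0 = 0" "\<And>v. v \<noteq> 0 \<Longrightarrow> V v < 0"
    and q: "uniformly_continuous_on UNIV q" "\<And>x. norm (q x) \<le> B" and fin: "nrg s V q < \<infinity>"
  shows "integrable lborel (\<lambda>x. V (q x))" and "(q \<longlongrightarrow> 0) at_top" and "(q \<longlongrightarrow> 0) at_bot"
proof -
  have le: "V v \<le> 0" for v using V(2,3) by (cases "v = 0") (auto simp: less_imp_le)
  have "continuous_on UNIV (\<lambda>x. - V (q x))"
    using continuous_on_compose2[OF V(1) uniformly_continuous_imp_continuous[OF q(1)]] by (intro continuous_intros) auto
  from borel_measurable_continuous_onI[OF this] have m: "(\<lambda>x. - V (q x)) \<in> borel_measurable lborel"
    by simp
  have "(\<integral>\<^sup>+ x. ennreal (- V (q x)) \<partial>lborel) < \<infinity>"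
    using fin by (simp add: nrg_def)
  then have i: "integrable lborel (\<lambda>x. - V (q x))"
    using le by (intro integrableI_nonneg m) auto
  then show "integrable lborel (\<lambda>x. V (q x))" by simp
  have "continuous_on UNIV (\<lambda>v. - V v)" using V(1) by (intro continuous_intros)
  from tendsto_zero_of_integrable[OF q this _ _ i] le V(3)
  show "(q \<longlongrightarrow> 0) at_top" "(q \<longlongrightarrow> 0) at_bot" by simp_all
qed

text \<open>Each component solves a scalar equation with a point source, in which the gradient term
  figures as a bounded continuous function of \<open>x\<close> vanishing at infinity.\<close>

lemma derivative_of_minimizer:
  fixes V :: "real ^ 'n \<Rightarrow> real" and q :: "real \<Rightarrow> real ^ 'n"
  assumes s: "1 / 2 < s" "s < 1" and VC1: "C1 V" and V: "\<And>v. V v \<le> V 0" "V 0 = 0"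
    and q: "continuous_on UNIV q" "q a = q\<^sub>0" and bd: "\<And>x. norm (q x) \<le> B"
    and g: "\<And>i. gag s (\<lambda>x. q x $ i) < \<infinity>" and Vint: "integrable lborel (\<lambda>x. V (q x))"
    and min: "\<And>p. p \<in> Gam s a q\<^sub>0 \<Longrightarrow> nrg s V q \<le> nrg s V p"
    and lim: "(q \<longlongrightarrow> 0) at_top" "(q \<longlongrightarrow> 0) at_bot"
  obtains Z where "\<And>x. x \<noteq> a \<Longrightarrow> (q has_vector_derivative Z x) (at x)" "(Z \<longlongrightarrow> 0) at_top" "(Z \<longlongrightarrow> 0) at_bot"
proof -
  have s': "0 < s" "s < 1" using s by auto
  have V0: "V v \<le> 0" for v using V by simp
  have c: "c_s s > 0" by (rule c_s_pos[OF s'])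
  note m = heat_mass_integrable(2)[OF s']
  have gc: "continuous_on UNIV (grad V)" using VC1 by (simp add: C1_def)
  have "\<exists>Z. (\<forall>x. x \<noteq> a \<longrightarrow> ((\<lambda>x. q x $ i) has_real_derivative Z x) (at x)) \<and> (Z \<longlongrightarrow> 0) at_top \<and> (Z \<longlongrightarrow> 0) at_bot" for i
  proof -
    let ?u = "\<lambda>x. q x $ i" and ?f = "\<lambda>x. grad V (q x) $ i"
    obtain \<mu> where EL: "\<And>\<phi>. admissible s \<phi> \<Longrightarrow> c_s s * cform s ?u \<phi> = (LBINT x. ?f x * \<phi> x) + \<mu> * \<phi> a"
      by (rule euler_lagrange[OF s' VC1 V0 q bd g Vint min, where i=i]) (assumption | (rule that; assumption))+
    have uc: "continuous_on UNIV ?u" using q by (intro continuous_intros)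
    have ub: "\<bar>?u x\<bar> \<le> B" for x using bd[of x] component_le_norm_cart[of "q x" i] by simp
    have fc: "continuous_on UNIV ?f"
      using continuous_on_compose2[OF gc q(1)] by (intro continuous_intros) simp
    obtain F where fb: "\<And>x. \<bar>?f x\<bar> \<le> F"
    proof -
      obtain F where F: "\<And>x. norm x \<le> B \<Longrightarrow> norm (grad V x) \<le> F"
        using C1_grad_bounded[OF VC1] by blast
      have "\<bar>?f x\<bar> \<le> F" for x
        using F[of "q x"] bd[of x] component_le_norm_cart[of "grad V (q x)" i] by simp
      then show thesis by (rule that)
    qed
    \<comment> \<open>The constant combines \<open>c_s\<close> with the factor 2 and the
      normalization \<open>heat_mass s\<close> of \<open>marchaud_equation\<close>.\<close>
    interpret point_source_equation s "2 * c_s s / heat_mass s" a \<mu> B F ?u ?f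
    proof
      show "2 * c_s s / heat_mass s > 0" using c m by simp
      fix \<tau> x :: real assume \<tau>: "\<tau> > 0"
      note adm = admissible_heat_x[OF s' \<tau>, of x]
      let ?I = "\<integral>t. indicator {0<..} t * ((smear (heat_x 1) ?u \<tau> x / sqrt \<tau> - smear (heat_x 1) ?u (\<tau> + t) x / sqrt (\<tau> + t)) * t powr (- 1 - s)) \<partial>lborel"
      have "heat_mass s * cform s ?u (\<lambda>y. heat_x \<tau> (x - y)) = 2 * ?I"
        by (rule marchaud_equation[OF s' uc ub g adm \<tau>])
      then have "2 * c_s s / heat_mass s * ?I = c_s s * cform s ?u (\<lambda>y. heat_x \<tau> (x - y))"
        using m by (simp add: field_simps)
      also have "\<dots> = (LBINT y. ?f y * heat_x \<tau> (x - y)) + \<mu> * heat_x \<tau> (x - a)" by (rule EL[OF adm])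
      also have "(LBINT y. ?f y * heat_x \<tau> (x - y)) = smear (heat_x 1) ?f \<tau> x / sqrt \<tau>"
        using smear_heat(2)[OF borel_measurable_continuous_onI[OF fc] fb \<tau>, of x] by (simp add: mult.commute)
      finally show "2 * c_s s / heat_mass s * ?I = smear (heat_x 1) ?f \<tau> x / sqrt \<tau> + \<mu> * heat_x \<tau> (x - a)" .
    qed (use s uc ub fc fb in auto)
    have g0: "grad V 0 = 0" by (rule grad_at_max[OF VC1 V(1)])
    have lim_u: "(?u \<longlongrightarrow> 0) at_infinity" unfolding at_infinity_eq_at_top_bot
      using tendsto_vec_nth[OF lim(1), of i] tendsto_vec_nth[OF lim(2), of i] by (intro filterlim_sup) auto
    have gl: "(grad V \<longlongrightarrow> 0) (nhds 0)"
    proof -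
      have "isCont (grad V) 0" using gc by (simp add: continuous_on_eq_continuous_at)
      then have "(grad V \<longlongrightarrow> grad V 0) (nhds 0)" by (simp only: isCont_def tendsto_at_iff_tendsto_nhds)
      then show ?thesis by (simp add: g0)
    qed
    have lim_f: "(?f \<longlongrightarrow> 0) at_infinity" unfolding at_infinity_eq_at_top_bot
      using tendsto_vec_nth[OF filterlim_compose[OF gl lim(1)], of i] tendsto_vec_nth[OF filterlim_compose[OF gl lim(2)], of i]
      by (intro filterlim_sup) auto
    show ?thesis using has_derivative_Z derivative_decay[OF lim_u lim_f] by blast
  qed
  then obtain Z where Z: "\<And>i x. x \<noteq> a \<Longrightarrow> ((\<lambda>x. q x $ i) has_real_derivative Z i x) (at x)"
    "\<And>i. (Z i \<longlongrightarrow> 0) at_top" "\<And>i. (Z i \<longlongrightarrow> 0) at_bot" by metis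
  show thesis
  proof (rule that[of "\<lambda>x. \<chi> i. Z i x"])
    show "(q has_vector_derivative (\<chi> i. Z i x)) (at x)" if "x \<noteq> a" for x
      using Z(1)[OF that] by (intro has_vector_derivative_componentwise_vec) simp
    show "((\<lambda>x. \<chi> i. Z i x) \<longlongrightarrow> 0) at_top" "((\<lambda>x. \<chi> i. Z i x) \<longlongrightarrow> 0) at_bot"
      using Z(2,3) by (auto intro!: vec_tendstoI)
  qed
qed

lemma Hoelder_norm_le:
  assumes A: "\<And>x. norm (q x) \<le> A" and B: "\<And>x y. norm (q x - q y) \<le> B * \<bar>x - y\<bar> powr \<alpha>"
  shows "q \<in> Hoelder \<alpha>" and "Hoelder_norm \<alpha> q \<le> A + B"
proof -
  show "q \<in> Hoelder \<alpha>" using A B by (auto simp: Hoelder_def bounded_iff)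
  have "(SUP x. norm (q x)) \<le> A" by (rule cSUP_least) (use A in auto)
  moreover have "(SUP (x, y) \<in> {(x, y). x \<noteq> y}. norm (q x - q y) / \<bar>x - y\<bar> powr \<alpha>) \<le> B"
  proof (rule cSUP_least)
    have "(0, 1) \<in> {(x :: real, y). x \<noteq> y}" by simp
    then show "{(x :: real, y). x \<noteq> y} \<noteq> {}" by blast
    fix z :: "real \<times> real" assume "z \<in> {(x, y). x \<noteq> y}"
    then show "(case z of (x, y) \<Rightarrow> norm (q x - q y) / \<bar>x - y\<bar> powr \<alpha>) \<le> B"
      using B by (auto simp: pos_divide_le_eq)
  qed
  ultimately show "Hoelder_norm \<alpha> q \<le> A + B" unfolding Hoelder_norm_def by (rule add_mono)
qed

lemma exists_symmetric_minimizer: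
  fixes V :: "real ^ 'n \<Rightarrow> real" and q\<^sub>0 :: "real ^ 'n"
  assumes s: "1 / 2 < s" "s < 1" and Vc: "continuous_on UNIV V"
    and R: "R > 0" "\<And>i. \<bar>q\<^sub>0 $ i\<bar> \<le> R"
    and VR: "\<And>q. q \<notin> {p. \<forall>i. - R < p $ i \<and> p $ i < R} \<Longrightarrow> V q \<le> V (truncv R q)"
    and comp: "p0 \<in> Gam s a q\<^sub>0" "nrg s V p0 \<le> ennreal E" "E \<ge> 0"
  obtains q where "continuous_on UNIV q" "q a = q\<^sub>0" "\<And>x i. \<bar>q x $ i\<bar> \<le> R"
    "\<And>p. p \<in> Gam s a q\<^sub>0 \<Longrightarrow> nrg s V q \<le> nrg s V p" "\<And>x. q (a - x) = q (a + x)"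
proof -
  obtain q where q: "continuous_on UNIV q" "q a = q\<^sub>0" "\<And>x i. \<bar>q x $ i\<bar> \<le> R"
    "\<And>p. p \<in> Gam s a q\<^sub>0 \<Longrightarrow> nrg s V q \<le> nrg s V p"
    using exists_truncated_minimizer[OF s Vc R VR comp] by blast
  have fin: "nrg s V q < \<infinity>" using le_less_trans[OF order_trans[OF q(4)[OF comp(1)] comp(2)]] by simp
  let ?r1 = "\<lambda>x. q (a - \<bar>x - a\<bar>)" and ?r2 = "\<lambda>x. q (a + \<bar>x - a\<bar>)"
  have rc: "continuous_on UNIV ?r1" "continuous_on UNIV ?r2"
    by (auto intro!: continuous_on_compose2[OF q(1)] continuous_intros)
  have refl: "nrg s V ?r1 + nrg s V ?r2 \<le> 2 * nrg s V q"
    using s by (intro nrg_reflect q Vc) simp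
  also have "\<dots> < \<infinity>" using fin by (simp add: ennreal_mult_less_top)
  finally have rfin: "nrg s V ?r1 < \<infinity>" "nrg s V ?r2 < \<infinity>" by simp_all
  have "gagliardo_sq s p < \<infinity>" if "nrg s V p < \<infinity>" for p :: "real \<Rightarrow> real ^ 'n"
    using that by (auto simp: nrg_def ennreal_divide_eq_top_iff less_top[symmetric])
  then have "?r2 \<in> Gam s a q\<^sub>0"
    using continuous_in_Ds2[OF rc(2)] rfin(2) rc(2) q(2) by (auto simp: Gam_def has_point_value_def)
  \<comment> \<open>\<open>?r2\<close> is a competitor, so its energy is at least that of
    \<open>q\<close>; the mean inequality then leaves at most the energy of \<open>q\<close> to
    \<open>?r1\<close>, after cancelling a finite term.\<close>
  from q(4)[OF this] have "nrg s V ?r1 + nrg s V q \<le> 2 * nrg s V q"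
    using refl by (meson add_left_mono order_trans)
  then have le: "nrg s V ?r1 \<le> nrg s V q" using fin by (auto simp: mult_2 ennreal_add_left_cancel_le add.commute[of "nrg s V ?r1"])
  show thesis
  proof (rule that[of ?r1])
    show "nrg s V ?r1 \<le> nrg s V p" if "p \<in> Gam s a q\<^sub>0" for p using le q(4)[OF that] by (rule order_trans)
  qed (use rc q in auto)
qed

text \<open>Test functions supported away from \<open>a\<close> do not see the multiplier \<mu>;
  what remains is the passage from Borel to Lebesgue integrals.\<close>

lemma weak_solution_of_minimizer:
  fixes V :: "real ^ 'n \<Rightarrow> real" and q :: "real \<Rightarrow> real ^ 'n"
  assumes s: "0 < s" "s < 1" and VC1: "C1 V" and V: "\<And>v. V v \<le> 0"
    and q: "continuous_on UNIV q" "q a = q\<^sub>0" and bd: "\<And>x. norm (q x) \<le> B"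
    and D: "q \<in> Ds2 s" and g: "\<And>i. gag s (\<lambda>x. q x $ i) < \<infinity>" and Vint: "integrable lborel (\<lambda>x. V (q x))"
    and min: "\<And>p. p \<in> Gam s a q\<^sub>0 \<Longrightarrow> nrg s V q \<le> nrg s V p"
  shows "weak_solution s V a q\<^sub>0 q"
  unfolding weak_solution_def
proof (intro conjI allI impI)
  show "has_point_value q a q\<^sub>0" using q by (auto simp: has_point_value_def)
  fix i \<phi> assume \<phi>: "test_fun (UNIV - {a}) \<phi>"
  note adm = admissible_test_fun[OF s \<phi>]
  obtain \<mu> where EL: "\<And>\<phi>. admissible s \<phi> \<Longrightarrow>
      c_s s * cform s (\<lambda>x. q x $ i) \<phi> = (LBINT x. grad V (q x) $ i * \<phi> x) + \<mu> * \<phi> a"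
    by (rule euler_lagrange[OF s VC1 V q bd g Vint min, where i=i]) (assumption | (rule that; assumption))+
  have \<phi>c: "continuous_on UNIV \<phi>" using adm(1) by (simp add: admissible_def)
  have qc: "continuous_on UNIV (\<lambda>x. q x $ i)" using q(1) by (intro continuous_intros)
  have [measurable]: "\<phi> \<in> borel_measurable borel" "(\<lambda>x. q x $ i) \<in> borel_measurable borel"
    using \<phi>c qc by (auto intro: borel_measurable_continuous_onI)
  have gc: "continuous_on UNIV (\<lambda>x. grad V (q x) $ i * \<phi> x)"
  proof -
    have "continuous_on UNIV (\<lambda>x. grad V (q x))"
      using VC1 by (intro continuous_on_compose2[OF _ q(1), of UNIV]) (auto simp: C1_def)
    then show ?thesis using \<phi>c by (intro continuous_intros)
  qed
  have m: "(\<lambda>z. (q (fst z) $ i - q (snd z) $ i) * (\<phi> (fst z) - \<phi> (snd z)) / \<bar>fst z - snd z\<bar> powr (1 + 2 * s))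
      \<in> borel_measurable (borel \<Otimes>\<^sub>M borel)" by measurable
  have "integral\<^sup>L (lebesgue :: (real \<times> real) measure)
      (\<lambda>(x, y). (q x $ i - q y $ i) * (\<phi> x - \<phi> y) / \<bar>x - y\<bar> powr (1 + 2 * s)) = cform s (\<lambda>x. q x $ i) \<phi>"
    unfolding cform_def case_prod_unfold lborel_prod
    by (rule integral_completion) (use m in \<open>simp add: borel_prod\<close>)
  moreover have "(LINT x|lebesgue. grad V (q x) $ i * \<phi> x) = (LBINT x. grad V (q x) $ i * \<phi> x)"
    by (rule integral_completion) (use borel_measurable_continuous_onI[OF gc] in simp)
  ultimately show "c_s s * integral\<^sup>L (lebesgue :: (real \<times> real) measure)
      (\<lambda>(x, y). (q x $ i - q y $ i) * (\<phi> x - \<phi> y) / \<bar>x - y\<bar> powr (1 + 2 * s))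
     = (LINT x|lebesgue. grad V (q x) $ i * \<phi> x)"
    using EL[OF adm(1)] adm(2) by simp
qed (rule D)

theorem theorem1p3:
  fixes s :: real and V :: "real ^ 'n \<Rightarrow> real" and q\<^sub>0 :: "real ^ 'n"
  assumes "1 / 2 < s" and "s < 1"
    and "C1 V" and "V 0 = 0" and "\<forall>q. q \<noteq> 0 \<longrightarrow> V q < V 0"
    and "\<exists>R>0. (\<forall>i. \<bar>q\<^sub>0 $ i\<bar> \<le> R) \<and>
           (\<forall>q. q \<notin> {p. \<forall>i. - R < p $ i \<and> p $ i < R} \<longrightarrow> V q \<le> V (\<chi> i. trunc R (q $ i)))"
  shows "\<exists>C>0. \<forall>a. \<exists>q :: real \<Rightarrow> real ^ 'n.
           weak_solution s V a q\<^sub>0 q \<and>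
           q \<in> Hoelder (s - 1 / 2) \<and> Hoelder_norm (s - 1 / 2) q \<le> C \<and>
           energy s V q < \<infinity> \<and> (\<forall>p \<in> Gam s a q\<^sub>0. energy s V q \<le> energy s V p) \<and>
           (q \<longlongrightarrow> 0) at_top \<and> (q \<longlongrightarrow> 0) at_bot \<and>
           ((\<exists>\<gamma>. max 0 (1 - 2 * s) < \<gamma> \<and> \<gamma> < 1 \<and> C1_hoelder \<gamma> V) \<longrightarrow>
              (\<forall>\<^sub>F x in at_top. q differentiable (at x)) \<and>
              (\<forall>\<^sub>F x in at_bot. q differentiable (at x)) \<and>
              ((\<lambda>x. vector_derivative q (at x)) \<longlongrightarrow> 0) at_top \<and>
              ((\<lambda>x. vector_derivative q (at x)) \<longlongrightarrow> 0) at_bot) \<and>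
           (\<forall>x. q (a - x) = q (a + x))"
proof -
  have s: "0 < s" "s < 1" using assms(1,2) by auto
  have V: "V v \<le> 0" "V v \<le> V 0" for v using assms(4,5) by (cases "v = 0", auto simp: less_imp_le)+
  have Vc: "continuous_on UNIV V" by (rule C1_continuous[OF assms(3)])
  obtain R where R: "R > 0" "\<And>i. \<bar>q\<^sub>0 $ i\<bar> \<le> R"
    and VR: "\<And>q. q \<notin> {p. \<forall>i. - R < p $ i \<and> p $ i < R} \<Longrightarrow> V q \<le> V (truncv R q)"
    using assms(6) unfolding truncv_def by blast
  obtain E where E: "E \<ge> 0" "\<And>a. \<exists>p \<in> Gam s a q\<^sub>0. nrg s V p \<le> ennreal E"
    by (rule competitor_energy_bound[OF s assms(3,4), where q\<^sub>0=q\<^sub>0]) (assumption | (rule that; assumption))+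
  \<comment> \<open>\<open>A\<close> bounds \<open>q\<close> through the truncation level,
    \<open>B\<close> bounds the Hoelder quotient through the energy of the competitor; both are
    fixed before \<open>a\<close>.\<close>
  define A where "A = real CARD('n) * R"
  define B where "B = real CARD('n) * (morrey_const s * sqrt (2 * E / c_s s))"
  have A: "A > 0" using R(1) by (simp add: A_def)
  have B: "B \<ge> 0" using E(1) morrey_const_pos[OF assms(1)] c_s_pos[OF s] by (simp add: B_def)
  show ?thesis
  proof (rule exI[of _ "A + B"], intro conjI allI)
    show "A + B > 0" using A B by simp
    fix a
    obtain p0 where p0: "p0 \<in> Gam s a q\<^sub>0" "nrg s V p0 \<le> ennreal E" using E(2) by blast
    obtain q where q: "continuous_on UNIV q" "q a = q\<^sub>0" and qR: "\<And>x i. \<bar>q x $ i\<bar> \<le> R"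
      and min: "\<And>p. p \<in> Gam s a q\<^sub>0 \<Longrightarrow> nrg s V q \<le> nrg s V p" and sym: "\<And>x. q (a - x) = q (a + x)"
      by (rule exists_symmetric_minimizer[OF assms(1,2) Vc R VR p0 E(1)]) (assumption | (rule that; assumption))+
    have nE: "nrg s V q \<le> ennreal E" by (rule order_trans[OF min[OF p0(1)] p0(2)])
    then have fin: "nrg s V q < \<infinity>" by (rule le_less_trans) simp
    have qA: "norm (q x) \<le> A" for x unfolding A_def by (rule norm_vec_le_card[OF qR])
    have qB: "norm (q x - q y) \<le> B * \<bar>x - y\<bar> powr (s - 1 / 2)" for x y
      unfolding B_def by (rule holder_of_nrg[OF assms(1,2) q(1) nE E(1)])
    have uc: "uniformly_continuous_on UNIV q" using assms(1) by (intro continuous_of_holder[OF _ qB]) simp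
    have gi: "gag s (\<lambda>x. q x $ i) < \<infinity>" for i
      using le_less_trans[OF gag_component_le[OF s q(1) nE E(1)]] by simp
    have "gagliardo_sq s q < \<infinity>"
      unfolding gagliardo_sq_eq_gag[OF q(1)] using gi by (simp add: ennreal_mult_less_top)
    then have D: "q \<in> Ds2 s" by (rule continuous_in_Ds2[OF q(1)])
    have neg: "V v < 0" if "v \<noteq> 0" for v using assms(4,5) that by simp
    note dec = minimizer_decays[OF Vc assms(4) neg uc qA fin]
    have "weak_solution s V a q\<^sub>0 q"
      by (rule weak_solution_of_minimizer[OF s assms(3) V(1) q qA D gi dec(1) min])
    moreover have "q \<in> Hoelder (s - 1 / 2)" "Hoelder_norm (s - 1 / 2) q \<le> A + B"
      by (rule Hoelder_norm_le[OF qA qB])+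
    moreover have "energy s V q < \<infinity>"
      unfolding energy_eq_nrg[OF V(1)] using fin by (simp add: less_top[symmetric])
    moreover have "\<forall>p \<in> Gam s a q\<^sub>0. energy s V q \<le> energy s V p"
      unfolding energy_eq_nrg[OF V(1)] using min by (simp add: less_eq_ennreal.rep_eq)
    moreover have "(\<forall>\<^sub>F x in at_top. q differentiable (at x)) \<and> (\<forall>\<^sub>F x in at_bot. q differentiable (at x)) \<and>
              ((\<lambda>x. vector_derivative q (at x)) \<longlongrightarrow> 0) at_top \<and> ((\<lambda>x. vector_derivative q (at x)) \<longlongrightarrow> 0) at_bot"
    proof -
      obtain Z where Z: "\<And>x. x \<noteq> a \<Longrightarrow> (q has_vector_derivative Z x) (at x)" "(Z \<longlongrightarrow> 0) at_top" "(Z \<longlongrightarrow> 0) at_bot"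
        by (rule derivative_of_minimizer[OF assms(1,2,3) V(2) assms(4) q qA gi dec(1) min dec(2,3)]) (assumption | (rule that; assumption))+
      \<comment> \<open>The derivative is known off the point \<open>a\<close> only, which suffices
        near both ends of the line.\<close>
      have ev: "\<forall>\<^sub>F x in at_top. x \<noteq> a" "\<forall>\<^sub>F x in at_bot. x \<noteq> a"
        using eventually_gt_at_top[of a] eventually_gt_at_bot[of a] by (auto elim: eventually_mono)
      have d: "q differentiable (at x)" "Z x = vector_derivative q (at x)" if "x \<noteq> a" for x
        using Z(1)[OF that] by (auto simp: vector_derivative_at intro: differentiableI_vector)
      show ?thesis
        by (intro conjI eventually_mono[OF ev(1)] eventually_mono[OF ev(2)] d(1)
            Lim_transform_eventually[OF Z(2) eventually_mono[OF ev(1) d(2)]]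
            Lim_transform_eventually[OF Z(3) eventually_mono[OF ev(2) d(2)]])
    qed
    ultimately show "\<exists>q :: real \<Rightarrow> real ^ 'n.
           weak_solution s V a q\<^sub>0 q \<and>
           q \<in> Hoelder (s - 1 / 2) \<and> Hoelder_norm (s - 1 / 2) q \<le> A + B \<and>
           energy s V q < \<infinity> \<and> (\<forall>p \<in> Gam s a q\<^sub>0. energy s V q \<le> energy s V p) \<and>
           (q \<longlongrightarrow> 0) at_top \<and> (q \<longlongrightarrow> 0) at_bot \<and>
           ((\<exists>\<gamma>. max 0 (1 - 2 * s) < \<gamma> \<and> \<gamma> < 1 \<and> C1_hoelder \<gamma> V) \<longrightarrow>
              (\<forall>\<^sub>F x in at_top. q differentiable (at x)) \<and>
              (\<forall>\<^sub>F x in at_bot. q differentiable (at x)) \<and>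
              ((\<lambda>x. vector_derivative q (at x)) \<longlongrightarrow> 0) at_top \<and>
              ((\<lambda>x. vector_derivative q (at x)) \<longlongrightarrow> 0) at_bot) \<and>
           (\<forall>x. q (a - x) = q (a + x))"
      using dec(2,3) sym by (intro exI[of _ q]) simp
  qed
qed

end
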